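(* $\delta(4,3)=8$.
   Context: For integers $d\geq 1$, $k\geq 1$, a lattice $(d,k)$-polytope is the convex hull in $\mathbb{R}^d$ of a nonempty set of points of $\mathbb{Z}^d$ all of whose vertices belong to $\{0,1,\dots,k\}^d$ (it need not be full-dimensional). The graph of a polytope $P$ has as its nodes the vertices of $P$ and as its edges the pairs of vertices joined by a one-dimensional face of $P$. The diameter $\delta(P)$ of $P$ is the diameter of its graph (the largest graph distance between two vertices). The quantity $\delta(d,k)$ is the largest value of $\delta(P)$ over all lattice $(d,k)$-polytopes $P$. *)

theory Defs
  imports "HOL-Analysis.Analysis" "HOL-Library.Extended_Nat"
begin

definition lattice_point :: "real ^ 'd \<Rightarrow> bool" where
  "lattice_point x \<longleftrightarrow> (\<forall>i. x $ i \<in> \<int>)"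

definition polytope_vertices :: "'a::euclidean_space set \<Rightarrow> 'a set" where
  "polytope_vertices P = {v. v extreme_point_of P}"

definition lattice_polytope :: "nat \<Rightarrow> (real ^ 'd) set \<Rightarrow> bool" where
  "lattice_polytope k P \<longleftrightarrow>
     (\<exists>S. finite S \<and> S \<noteq> {} \<and> (\<forall>x\<in>S. lattice_point x) \<and> P = convex hull S) \<and>
     (\<forall>v\<in>polytope_vertices P. \<forall>i. v $ i \<in> real ` {0..k})"

text \<open>The adjacency relation of the graph of a polytope. A one-dimensional face of a polytope is
  the segment between the two vertices it joins; \<^const>\<open>edge_of\<close> has affine dimension one
  built in, so the two endpoints are distinct.\<close>

definition polytope_adj :: "'a::euclidean_space set \<Rightarrow> ('a \<times> 'a) set" where
  "polytope_adj P =
     {(u, v). u \<in> polytope_vertices P \<and> v \<in> polytope_vertices P \<and> closed_segment u v edge_of P}"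

text \<open>Distances and diameters take values in \<^typ>\<open>enat\<close>, so that two nodes that no path
  connects have distance \<open>\<infinity>\<close>, and a supremum of a nonempty set that is finite is a maximum.\<close>

definition graph_dist :: "('a \<times> 'a) set \<Rightarrow> 'a \<Rightarrow> 'a \<Rightarrow> enat" where
  "graph_dist E u v = (INF n\<in>{n. (u, v) \<in> E ^^ n}. enat n)"

definition polytope_diameter :: "'a::euclidean_space set \<Rightarrow> enat" where
  "polytope_diameter P =
     (SUP u\<in>polytope_vertices P. SUP v\<in>polytope_vertices P. graph_dist (polytope_adj P) u v)"

text \<open>The dimension \<open>d\<close> is the cardinality of the index type.\<close>

definition max_lattice_diameter :: "'d::finite itself \<Rightarrow> nat \<Rightarrow> enat" where
  "max_lattice_diameter _ k =
     (SUP P\<in>{P :: (real ^ 'd) set. lattice_polytope k P}. polytope_diameter P)"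

end

theory Submission
  imports Defs
begin

text \<open>
  Upper bound. A monotone edge path reaches the face \<open>x\<^sub>i = 0\<close> from a vertex \<open>u\<close> in at most \<open>u\<^sub>i\<close> steps, so two
  vertices \<open>u, v\<close> are joined by a path of length \<open>u\<^sub>i + v\<^sub>i\<close> plus the diameter of a face of smaller dimension,
  and likewise for \<open>x\<^sub>i = 3\<close> and for sums of several coordinates. In the plane this gives \<open>4\<close>, attained only
  by opposite vertices of one octagon; feeding this rigidity into dimension three gives \<open>6\<close>. In dimension
  four a pair at distance at least \<open>9\<close> must satisfy \<open>u + v = (3,3,3,3)\<close>, and every edge at \<open>u\<close> or \<open>v\<close> has
  entries in \<open>{-1,0,1}\<close>, at most two of them nonzero. An edge with two nonzero entries saves a step towards
  a two-dimensional face, which leaves so little room that each possible number of coordinates of \<open>u\<close> in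
  \<open>{1,2}\<close> is contradictory.

  Lower bound. In a zonotope with pairwise non-parallel generators each edge changes the set of generators
  that sum to the vertex by a single element, so \<open>0\<close> and the sum of all generators are as far apart as there
  are generators. The vectors \<open>e\<^sub>i\<close> and \<open>e\<^sub>i + e\<^sub>i\<^sub>+\<^sub>1\<close> (cyclically) have sum \<open>(3,3,3,3)\<close>.
\<close>

section \<open>Monotone edge paths\<close>

text \<open>Dropping one coordinate at a time costs at most 3 per dimension, so the naive bounds are
  1, 4, 7, 10. One step must be saved in dimension three; from its bound 6 the recursion gives 9 in
  dimension four, and one more must be saved. A pair at distance 9 therefore leaves no slack, and
  nearly every distance argument exhibits a path of length 8. Two tools supply the savings. A
  polygon contributes 4 only if its two end points sum to (3,3) and are neither corners nor inner
  points, so as soon as the rest of a path leaves 4 for a polygon, the positions there are almost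
  determined. And a path may aim at the minimum \<open>l\<close> of a sum of coordinates instead of
  at zeros: the two descents save \<open>2 * l\<close>, which pays for crossing the minimal face,
  where each summand is at most \<open>l\<close>. The hardest case is two coordinates of
  \<open>u\<close> in {1,2}: edges with two nonzero entries cannot be excluded at one end and have
  to be played off between both ends. The generators exhaust their budget: the entries of (3,3,3,3)
  add up to 12, which four 0/1 vectors of weight 1 and four of weight 2 use up, while nine distinct
  nonzero ones would need at least 14.\<close>

definition affine_fun :: "('a::euclidean_space \<Rightarrow> real) \<Rightarrow> bool" where
  "affine_fun f \<longleftrightarrow> (\<exists>c b. \<forall>x. f x = c \<bullet> x + b)"

lemma affine_fun_add: "affine_fun f \<Longrightarrow> affine_fun g \<Longrightarrow> affine_fun (\<lambda>x. f x + g x)"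
proof -
  assume "affine_fun f" "affine_fun g"
  then obtain c b c' b' where *: "\<And>x. f x = c \<bullet> x + b" "\<And>x. g x = c' \<bullet> x + b'"
    by (auto simp: affine_fun_def)
  show ?thesis unfolding affine_fun_def
    by (rule exI[of _ "c + c'"], rule exI[of _ "b + b'"]) (simp add: * inner_add_left)
qed

lemma affine_fun_diff_const: "affine_fun f \<Longrightarrow> affine_fun (\<lambda>x. k - f x)"
proof -
  assume "affine_fun f"
  then obtain c b where *: "\<And>x. f x = c \<bullet> x + b"
    by (auto simp: affine_fun_def)
  show ?thesis unfolding affine_fun_def
    by (rule exI[of _ "- c"], rule exI[of _ "k - b"]) (simp add: *)
qed

lemma affine_fun_comb:
  assumes "affine_fun f" "s + t = 1"
  shows "f (s *\<^sub>R x + t *\<^sub>R y) = s * f x + t * f y"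
proof -
  obtain c b where *: "\<And>x. f x = c \<bullet> x + b"
    using assms(1) by (auto simp: affine_fun_def)
  have "s * b + t * b = b"
    using assms(2) by (metis distrib_right mult_1)
  then show ?thesis by (simp add: * inner_add_right algebra_simps)
qed

lemma affine_fun_convex_ge: "affine_fun f \<Longrightarrow> convex {x. f x \<ge> m}"
  unfolding affine_fun_def using convex_halfspace_ge[of "m - b" for b]
  by (smt (verit, best) Collect_cong convex_halfspace_ge)

lemma polytope_eq_hull_vertices:
  assumes "polytope P"
  shows "finite (polytope_vertices P)" "P = convex hull (polytope_vertices P)"
proof -
  obtain S where S: "finite S" "P = convex hull S"
    using assms by (auto simp: polytope_def)
  then show "finite (polytope_vertices P)"
    using extreme_points_of_convex_hull[of S] finite_subset
    by (auto simp: polytope_vertices_def)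
  show "P = convex hull (polytope_vertices P)"
    unfolding polytope_vertices_def
    using Krein_Milman_Minkowski assms polytope_imp_compact polytope_imp_convex by blast
qed

lemma vertex_in: "u \<in> polytope_vertices P \<Longrightarrow> u \<in> P"
  by (simp add: polytope_vertices_def extreme_point_of_def)

lemma vertices_of_face:
  "F face_of P \<Longrightarrow> polytope_vertices F = polytope_vertices P \<inter> F"
  by (auto simp: polytope_vertices_def extreme_point_of_face)

lemma vertex_not_between:
  assumes "u \<in> polytope_vertices P" "p \<in> P" "q \<in> P" "u = (1 - t) *\<^sub>R p + t *\<^sub>R q" "0 < t" "t < 1"
  shows "p = q"
proof (rule ccontr)
  assume "p \<noteq> q"
  then have "u \<in> open_segment p q"
    using assms by (auto simp: in_segment)
  then show False
    using assms by (auto simp: polytope_vertices_def extreme_point_of_def)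
qed

text \<open>The vertex figure of \<open>u\<close>, cut out by a hyperplane that separates
  \<open>u\<close> from the other vertices, has its extreme points on the edges of \<open>P\<close> at \<open>u\<close>.\<close>

lemma descending_neighbor:
  fixes P :: "'a::euclidean_space set"
  assumes P: "polytope P" and u: "u \<in> polytope_vertices P" and f: "affine_fun f"
    and z: "z \<in> P" "f z < f u"
  shows "\<exists>w. (u, w) \<in> polytope_adj P \<and> f w < f u"
proof -
  let ?V = "polytope_vertices P"
  define K where "K = convex hull (?V - {u})"
  note fin = polytope_eq_hull_vertices(1)[OF P] and hull = polytope_eq_hull_vertices(2)[OF P]
  have uP: "u \<in> P" using u by (rule vertex_in)
  have Kne: "?V - {u} \<noteq> {}"
  proof
    assume "?V - {u} = {}"
    then have "?V = {u}" using u by blast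
    then have "P = {u}" using hull by simp
    then show False using z by auto
  qed
  have "convex (P - {u})"
    using u P by (simp add: polytope_vertices_def extreme_point_of_stillconvex polytope_imp_convex)
  then have KP: "K \<subseteq> P - {u}"
    unfolding K_def by (intro hull_minimal) (auto dest: vertex_in)
  have "compact K" unfolding K_def using fin by (simp add: finite_imp_compact_convex_hull)
  then have "closed K" "convex K" by (auto simp: compact_imp_closed K_def)
  moreover have "u \<notin> K" using KP by blast
  ultimately obtain a b where ab: "a \<bullet> u < b" "\<And>x. x \<in> K \<Longrightarrow> a \<bullet> x > b"
    using separating_hyperplane_closed_point[of K u] by metis
  define S where "S = P \<inter> {x. a \<bullet> x = b}"
  have S: "compact S" "convex S"
    unfolding S_def
    using compact_Int_closed[OF polytope_imp_compact[OF P] closed_hyperplane]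
      convex_Int[OF polytope_imp_convex[OF P] convex_hyperplane] by blast+
  have "P = convex hull (insert u (?V - {u}))"
    using hull u by (metis insert_Diff)
  then have "z \<in> convex hull (insert u (?V - {u}))" using z by simp
  then obtain s t k where k: "s \<ge> 0" "t \<ge> 0" "s + t = 1" "k \<in> K" "z = s *\<^sub>R u + t *\<^sub>R k"
    unfolding convex_hull_insert[OF Kne] K_def by auto
  have "f z = s * f u + t * f k" using affine_fun_comb[OF f k(3)] k(5) by simp
  then have "t * (f k - f u) < 0"
    using z k(3) by (smt (verit, best) distrib_right mult_cancel_right1 right_diff_distrib')
  then have fk: "f k < f u" using k(2) by (simp add: mult_less_0_iff)
  \<comment> \<open>The ratio at which the segment from \<open>u\<close> to \<open>k\<close> crosses
    the hyperplane; \<open>h\<close> is the crossing point.\<close>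
  define r where "r = (b - a \<bullet> u) / (a \<bullet> k - a \<bullet> u)"
  have ak: "a \<bullet> k > b" using ab k(4) by blast
  have r: "0 < r" "r < 1" "r * (a \<bullet> k - a \<bullet> u) = b - a \<bullet> u"
    using ab(1) ak by (auto simp: r_def divide_simps)
  define h where "h = (1 - r) *\<^sub>R u + r *\<^sub>R k"
  have "f h = (1 - r) * f u + r * f k" unfolding h_def by (rule affine_fun_comb[OF f]) simp
  moreover have "r * f k < r * f u" using r fk by simp
  ultimately have fh: "f h < f u" by (simp add: algebra_simps)
  have "h \<in> P" unfolding h_def using uP KP k(4) r P
    by (intro convexD) (auto simp: polytope_imp_convex)
  moreover have "a \<bullet> h = b"
    using r(3) by (simp add: h_def inner_add_right algebra_simps)
  ultimately have hS: "h \<in> S" by (simp add: S_def)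
  have "\<exists>x. x extreme_point_of S \<and> f x < f u"
  proof (rule ccontr)
    assume "\<not> ?thesis"
    then have "{x. x extreme_point_of S} \<subseteq> {x. f x \<ge> f u}" by force
    then have "convex hull {x. x extreme_point_of S} \<subseteq> {x. f x \<ge> f u}"
      by (intro hull_minimal affine_fun_convex_ge f)
    then have "S \<subseteq> {x. f x \<ge> f u}"
      using Krein_Milman_Minkowski[OF S] by simp
    then show False using hS fh by auto
  qed
  then obtain x where x: "x extreme_point_of S" "f x < f u" by blast
  then have xS: "x \<in> S" by (simp add: extreme_point_of_def)
  \<comment> \<open>The smallest face through \<open>x\<close>. It has \<open>x\<close> in its
    relative interior, since a proper face of \<open>F\<close> through \<open>x\<close> would have
    to contain \<open>F\<close>.\<close>
  define F where "F = \<Inter> {G. G face_of P \<and> x \<in> G}"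
  have FP: "F face_of P"
    unfolding F_def
    by (rule face_of_Inter) (use xS S_def P face_of_refl polytope_imp_convex in blast)+
  have xF: "x \<in> F" by (auto simp: F_def)
  have polyF: "polytope F" using FP P face_of_polytope_polytope by blast
  have "x \<notin> rel_frontier F"
  proof
    assume "x \<in> rel_frontier F"
    then obtain G where G: "G face_of F" "G \<noteq> F" "x \<in> G"
      using rel_frontier_of_polyhedron_alt[of F] polyF polytope_imp_polyhedron by blast
    then have "G face_of P" using FP face_of_trans by blast
    then have "F \<subseteq> G" using G by (auto simp: F_def)
    then show False using G face_of_imp_subset by blast
  qed
  then have "x \<in> rel_interior F"
    using xF closure_subset by (auto simp: rel_frontier_def)
  then obtain e where e: "e > 0" "cball x e \<inter> affine hull F \<subseteq> F"
    by (auto simp: mem_rel_interior_cball)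
  let ?W = "polytope_vertices F"
  note hullF = polytope_eq_hull_vertices(2)[OF polyF]
  have WV: "?W \<subseteq> ?V" using vertices_of_face[OF FP] by blast
  have VK: "a \<bullet> y > b" if "y \<in> ?V" "y \<noteq> u" for y
    using that ab(2) by (simp add: K_def hull_inc)
  have "u \<in> ?W"
  proof (rule ccontr)
    assume "u \<notin> ?W"
    then have "convex hull ?W \<subseteq> K" unfolding K_def using WV by (intro hull_mono) blast
    then have "F \<subseteq> K" using hullF by argo
    then show False using ab(2) xF xS by (force simp: S_def)
  qed
  have "x \<noteq> u" using x by auto
  then have "?W \<noteq> {u}" using xF hullF by auto
  then obtain w where w: "w \<in> ?W" "w \<noteq> u" using \<open>u \<in> ?W\<close> by blast
  \<comment> \<open>If \<open>F\<close> had a direction not parallel to \<open>w - u\<close>, a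
    combination of the two would be tangent to the hyperplane, and \<open>x\<close> could move both
    ways along it inside \<open>S\<close>.\<close>
  have line: "(a \<bullet> (p - u)) *\<^sub>R (w - u) = (a \<bullet> (w - u)) *\<^sub>R (p - u)" if p: "p \<in> F" for p
  proof (rule ccontr)
    define d where "d = (a \<bullet> (p - u)) *\<^sub>R (w - u) - (a \<bullet> (w - u)) *\<^sub>R (p - u)"
    assume "\<not> ?thesis"
    then have d0: "d \<noteq> 0" by (simp add: d_def)
    have ad: "a \<bullet> d = 0" by (simp add: d_def inner_diff_right mult.commute)
    define \<epsilon> where "\<epsilon> = e / norm d"
    have \<epsilon>: "\<epsilon> > 0" "\<epsilon> * norm d = e" using e d0 by (auto simp: \<epsilon>_def)
    have mem: "x + c *\<^sub>R d \<in> affine hull F" for c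
    proof -
      have uF: "u \<in> F" and wF: "w \<in> F" using \<open>u \<in> ?W\<close> w vertex_in by blast+
      have "w - u \<in> span {y - u | y. y \<in> F}" "p - u \<in> span {y - u | y. y \<in> F}"
        by (rule span_base, use wF p in blast)+
      then have "d \<in> span {y - u | y. y \<in> F}"
        unfolding d_def by (blast intro: span_diff span_scale)
      then have "c *\<^sub>R d \<in> span ((\<lambda>y. - u + y) ` (F - {u}))"
      proof -
        have "{y - u | y. y \<in> F} \<subseteq> insert 0 ((\<lambda>y. - u + y) ` (F - {u}))"
        proof
          fix v assume "v \<in> {y - u | y. y \<in> F}"
          then obtain y where "y \<in> F" "v = y - u" by blast
          then have "v = - u + y" by simp
          then show "v \<in> insert 0 ((\<lambda>y. - u + y) ` (F - {u}))"
            using \<open>y \<in> F\<close> by (cases "y = u") simp_all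
        qed
        from span_mono[OF this]
        have "d \<in> span (insert 0 ((\<lambda>y. - u + y) ` (F - {u})))"
          using \<open>d \<in> span {y - u | y. y \<in> F}\<close> by (rule subsetD)
        then have "d \<in> span ((\<lambda>y. - u + y) ` (F - {u}))"
          unfolding span_insert_0 .
        then show ?thesis by (rule span_scale)
      qed
      moreover have "x - u \<in> span ((\<lambda>y. - u + y) ` (F - {u}))"
        using xF \<open>x \<noteq> u\<close> by (intro span_base) (auto simp: image_iff)
      ultimately have "x - u + c *\<^sub>R d \<in> span ((\<lambda>y. - u + y) ` (F - {u}))"
        by (rule span_add[rotated])
      then have "u + (x - u + c *\<^sub>R d) \<in> affine hull F"
        unfolding affine_hull_span2[OF uF] by (rule imageI)
      then show ?thesis by (simp add: algebra_simps)
    qed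
    have "x + \<epsilon> *\<^sub>R d \<in> F" "x + (- \<epsilon>) *\<^sub>R d \<in> F"
      using e(2) mem[of \<epsilon>] mem[of "- \<epsilon>"] \<epsilon> by (auto simp: subset_iff dist_norm)
    then have "x + \<epsilon> *\<^sub>R d \<in> S" "x - \<epsilon> *\<^sub>R d \<in> S"
      using FP face_of_imp_subset xS ad by (auto simp: S_def inner_add_right inner_diff_right)
    moreover have "x \<in> open_segment (x - \<epsilon> *\<^sub>R d) (x + \<epsilon> *\<^sub>R d)"
      unfolding in_segment using d0 \<epsilon>
      by (intro conjI exI[of _ "1/2"]) (auto simp: algebra_simps scaleR_2[symmetric])
    ultimately show False using x(1) by (auto simp: extreme_point_of_def)
  qed
  have aw: "a \<bullet> (w - u) > 0" using VK[of w] w WV ab(1) by (auto simp: inner_diff_right)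
  have "?W = {u, w}"
  proof (rule ccontr)
    assume "?W \<noteq> {u, w}"
    then obtain p where p: "p \<in> ?W" "p \<noteq> u" "p \<noteq> w" using w \<open>u \<in> ?W\<close> by blast
    have ap: "a \<bullet> (p - u) > 0" using VK[of p] p WV ab(1) by (auto simp: inner_diff_right)
    define c where "c = a \<bullet> (p - u) / (a \<bullet> (w - u))"
    have c: "c > 0" using ap aw by (simp add: c_def)
    have "p - u = c *\<^sub>R (w - u)"
    proof -
      have "c *\<^sub>R (w - u) = (1 / (a \<bullet> (w - u))) *\<^sub>R ((a \<bullet> (w - u)) *\<^sub>R (p - u))"
        unfolding line[OF vertex_in[OF p(1)], symmetric] by (simp add: c_def)
      then show ?thesis using aw by simp
    qed
    then have pe: "p = (1 - c) *\<^sub>R u + c *\<^sub>R w" by (simp add: algebra_simps)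
    then have "c \<noteq> 1" using p by auto
    have uF: "u \<in> F" "w \<in> F" "p \<in> F" using \<open>u \<in> ?W\<close> w p vertex_in by blast+
    consider "c < 1" | "c > 1" using \<open>c \<noteq> 1\<close> by linarith
    then show False
    proof cases
      case 1
      then show False
        using vertex_not_between[OF p(1) uF(1,2) pe c] w(2) by simp
    next
      case 2
      have "w = (1 - 1 / c) *\<^sub>R u + (1 / c) *\<^sub>R p"
        using c by (simp add: pe algebra_simps)
      then show False
        using vertex_not_between[OF w(1) uF(1,3), of "1 / c"] 2 p(2) by simp
    qed
  qed
  then have Feq: "F = closed_segment u w" using hullF by (simp add: segment_convex_hull)
  have "aff_dim F = 1" using w(2) by (simp add: Feq segment_convex_hull aff_dim_convex_hull aff_dim_2)
  then have "(u, w) \<in> polytope_adj P"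
    using FP Feq u w WV by (auto simp: polytope_adj_def edge_of_def)
  moreover have "f w < f u"
  proof -
    obtain t where t: "0 \<le> t" "t \<le> 1" "x = (1 - t) *\<^sub>R u + t *\<^sub>R w"
      using xF Feq by (auto simp: in_segment)
    have "f x = (1 - t) * f u + t * f w"
      unfolding t(3) by (rule affine_fun_comb[OF f]) simp
    then have "t * (f w - f u) < 0" using x(2) by (simp add: algebra_simps)
    then show ?thesis using t(1) by (simp add: mult_less_0_iff)
  qed
  ultimately show ?thesis by blast
qed

section \<open>Bounded distance and descent to faces\<close>

text \<open>The bound is real because it is usually an expression in values of affine functions,
  such as \<open>a u + a v + 1\<close>; bounds of consecutive paths simply add.\<close>

definition near :: "'a::euclidean_space set \<Rightarrow> real \<Rightarrow> 'a \<Rightarrow> 'a \<Rightarrow> bool" where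
  "near P r u v \<longleftrightarrow> (\<exists>n. real n \<le> r \<and> (u, v) \<in> polytope_adj P ^^ n)"

lemma near_refl: "0 \<le> r \<Longrightarrow> near P r u u"
  unfolding near_def by (rule exI[of _ 0]) simp

lemma near_adj: "(u, v) \<in> polytope_adj P \<Longrightarrow> near P 1 u v"
  unfolding near_def by (rule exI[of _ 1]) simp

lemma near_mono: "near P r u v \<Longrightarrow> r \<le> s \<Longrightarrow> near P s u v"
  unfolding near_def using order_trans by blast

lemma near_trans: "near P r u v \<Longrightarrow> near P s v w \<Longrightarrow> r + s \<le> t \<Longrightarrow> near P t u w"
  unfolding near_def
proof (elim exE conjE)
  fix n m assume "r + s \<le> t" "real n \<le> r" "(u, v) \<in> polytope_adj P ^^ n" "real m \<le> s"
    "(v, w) \<in> polytope_adj P ^^ m"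
  then show "\<exists>n. real n \<le> t \<and> (u, w) \<in> polytope_adj P ^^ n"
    by (intro exI[of _ "n + m"]) (auto simp: relpow_add)
qed

lemma polytope_adj_sym: "(u, v) \<in> polytope_adj P \<Longrightarrow> (v, u) \<in> polytope_adj P"
  by (auto simp: polytope_adj_def closed_segment_commute)

lemma near_sym: "near P r u v \<Longrightarrow> near P r v u"
proof -
  have "(v, u) \<in> polytope_adj P ^^ n" if "(u, v) \<in> polytope_adj P ^^ n" for n
    using that
  proof (induction n arbitrary: v)
    case (Suc n)
    then obtain w where "(u, w) \<in> polytope_adj P ^^ n" "(w, v) \<in> polytope_adj P" by auto
    then show ?case using Suc.IH polytope_adj_sym relpow_Suc_I2 by metis
  qed auto
  then show "near P r u v \<Longrightarrow> near P r v u" by (auto simp: near_def)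
qed

lemma adj_vertices:
  "(u, v) \<in> polytope_adj P \<Longrightarrow> u \<in> polytope_vertices P"
  "(u, v) \<in> polytope_adj P \<Longrightarrow> v \<in> polytope_vertices P"
  by (auto simp: polytope_adj_def)

lemma adj_face: "F face_of P \<Longrightarrow> polytope_adj F \<subseteq> polytope_adj P"
  by (auto simp: polytope_adj_def vertices_of_face edge_of_def intro: face_of_trans)

lemma near_face:
  assumes "F face_of P" "near F r u v"
  shows "near P r u v"
proof -
  obtain n where "real n \<le> r" "(u, v) \<in> polytope_adj F ^^ n"
    using assms(2) by (auto simp: near_def)
  moreover have "polytope_adj F ^^ n \<subseteq> polytope_adj P ^^ n"
    using adj_face[OF assms(1)] by (induction n) (auto intro: relcomp_mono[THEN subsetD])
  ultimately show ?thesis by (auto simp: near_def)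
qed

definition level :: "'a set \<Rightarrow> ('a \<Rightarrow> real) \<Rightarrow> real \<Rightarrow> 'a set" where
  "level P f m = {x \<in> P. f x = m}"

lemma affine_fun_ge_on_polytope:
  assumes "polytope P" "affine_fun f" "\<And>x. x \<in> polytope_vertices P \<Longrightarrow> m \<le> f x" "x \<in> P"
  shows "m \<le> f x"
proof -
  have "convex hull (polytope_vertices P) \<subseteq> {x. f x \<ge> m}"
    using assms(3) by (intro hull_minimal affine_fun_convex_ge assms(2)) auto
  then show ?thesis
    using polytope_eq_hull_vertices(2)[OF assms(1)] assms(4) by auto
qed

lemma level_face:
  assumes "polytope P" "affine_fun f" "\<And>x. x \<in> polytope_vertices P \<Longrightarrow> m \<le> f x"
  shows "level P f m face_of P"
proof -
  obtain c b where f: "\<And>x. f x = c \<bullet> x + b"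
    using assms(2) by (auto simp: affine_fun_def)
  have "P \<inter> {x. c \<bullet> x = m - b} face_of P"
    using affine_fun_ge_on_polytope[OF assms] f
    by (intro face_of_Int_supporting_hyperplane_ge polytope_imp_convex assms(1)) (smt (verit))
  moreover have "P \<inter> {x. c \<bullet> x = m - b} = level P f m"
    by (auto simp: level_def f)
  ultimately show ?thesis by simp
qed

lemma level_vertices:
  assumes "polytope P" "affine_fun f" "\<And>x. x \<in> polytope_vertices P \<Longrightarrow> m \<le> f x"
  shows "v \<in> polytope_vertices (level P f m) \<longleftrightarrow> v \<in> polytope_vertices P \<and> f v = m"
  using vertices_of_face[OF level_face[OF assms]] vertex_in by (fastforce simp: level_def)

lemma Ints_less_imp_add1_le: "(a::real) \<in> \<int> \<Longrightarrow> b \<in> \<int> \<Longrightarrow> a < b \<Longrightarrow> a + 1 \<le> b"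
  by (elim Ints_cases) simp

text \<open>Values at vertices are integers, so each descending edge loses at least one and the drop
  bounds the number of edges.\<close>

lemma descend_to_min:
  assumes "polytope P" "affine_fun f" "\<And>x. x \<in> polytope_vertices P \<Longrightarrow> f x \<in> \<int>"
    "\<And>x. x \<in> polytope_vertices P \<Longrightarrow> m \<le> f x" "z \<in> polytope_vertices P" "f z = m"
    "u \<in> polytope_vertices P"
  shows "\<exists>v \<in> polytope_vertices P. f v = m \<and> near P (f u - m) u v"
proof -
  have "\<exists>v \<in> polytope_vertices P. f v = m \<and> near P (f u - m) u v"
    if "u \<in> polytope_vertices P" "f u - m \<le> real n" for n u
    using that
  proof (induction n arbitrary: u)
    case 0
    then have "f u = m" using assms(4)[of u] by simp
    then show ?case using 0 near_refl[of 0] by auto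
  next
    case (Suc n)
    show ?case
    proof (cases "f u = m")
      case True
      then show ?thesis using Suc near_refl[of 0] by auto
    next
      case False
      then have "f z < f u" using assms(4)[OF Suc.prems(1)] assms(6) by simp
      then obtain w where w: "(u, w) \<in> polytope_adj P" "f w < f u"
        using descending_neighbor[OF assms(1) Suc.prems(1) assms(2) vertex_in[OF assms(5)]] by blast
      have le: "f w + 1 \<le> f u"
        using w assms(3) adj_vertices[OF w(1)] by (intro Ints_less_imp_add1_le) auto
      then obtain v where v: "v \<in> polytope_vertices P" "f v = m" "near P (f w - m) w v"
        using Suc.IH[of w] Suc.prems(2) adj_vertices(2)[OF w(1)] by auto
      have "near P (f u - m) u v"
        using near_trans[OF near_adj[OF w(1)] v(3)] le by simp
      then show ?thesis using v by blast
    qed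
  qed
  from this[OF assms(7), of "nat \<lceil>f u - m\<rceil>"] show ?thesis by linarith
qed

lemma min_vertex:
  assumes "polytope P" "u \<in> polytope_vertices P"
  shows "\<exists>z \<in> polytope_vertices P. \<forall>x \<in> polytope_vertices P. (f z :: real) \<le> f x"
proof -
  let ?A = "f ` polytope_vertices P"
  have "finite ?A" "?A \<noteq> {}"
    using polytope_eq_hull_vertices(1)[OF assms(1)] assms(2) by auto
  then have "Min ?A \<in> ?A" "\<forall>y\<in>?A. Min ?A \<le> y" by auto
  then show ?thesis by force
qed

section \<open>Coordinates on faces and the basic recursion\<close>

definition grid :: "'a::euclidean_space set \<Rightarrow> ('a \<Rightarrow> real) \<Rightarrow> bool" where
  "grid P y \<longleftrightarrow> affine_fun y \<and> (\<forall>v \<in> polytope_vertices P. y v \<in> {0, 1, 2, 3})"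

text \<open>Faces of a polytope are studied inside the ambient space: a set of affine functions that
  separate the points of the polytope stands in for a coordinate system of its affine hull.\<close>

definition coords :: "'a::euclidean_space set \<Rightarrow> ('a \<Rightarrow> real) set \<Rightarrow> bool" where
  "coords P Y \<longleftrightarrow> polytope P \<and> (\<forall>y\<in>Y. grid P y) \<and>
     (\<forall>p\<in>P. \<forall>q\<in>P. (\<forall>y\<in>Y. y p = y q) \<longrightarrow> p = q)"

definition rf :: "('a \<Rightarrow> real) \<Rightarrow> 'a \<Rightarrow> real" where
  "rf a = (\<lambda>x. 3 - a x)"

lemma rf_apply [simp]: "rf a x = 3 - a x"
  by (simp add: rf_def)

lemma rf_rf [simp]: "rf (rf a) = a"
  by (simp add: rf_def)

lemma coords_polytope: "coords P Y \<Longrightarrow> polytope P"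
  by (simp add: coords_def)

lemma coords_grid: "coords P Y \<Longrightarrow> y \<in> Y \<Longrightarrow> grid P y"
  by (simp add: coords_def)

lemma coords_inj:
  "coords P Y \<Longrightarrow> p \<in> P \<Longrightarrow> q \<in> P \<Longrightarrow> \<forall>y\<in>Y. y p = y q \<Longrightarrow> p = q"
  unfolding coords_def by blast

lemma gridD:
  assumes "grid P y" "v \<in> polytope_vertices P"
  shows "y v = 0 \<or> y v = 1 \<or> y v = 2 \<or> y v = 3"
  using assms by (auto simp: grid_def)

lemma grid_affine: "grid P y \<Longrightarrow> affine_fun y"
  by (simp add: grid_def)

lemma grid_Ints: "grid P y \<Longrightarrow> v \<in> polytope_vertices P \<Longrightarrow> y v \<in> \<int>"
  by (auto simp: grid_def)

lemma grid_nonneg: "grid P y \<Longrightarrow> v \<in> polytope_vertices P \<Longrightarrow> 0 \<le> y v"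
  by (auto simp: grid_def)

lemma grid_rf: "grid P y \<Longrightarrow> grid P (rf y)"
  by (auto simp: grid_def rf_def affine_fun_diff_const)

lemma coords_rf: "coords P (insert a Y) \<Longrightarrow> coords P (insert (rf a) Y)"
  by (auto simp: coords_def grid_rf)

lemma coords_face:
  assumes "coords P Y" "F face_of P"
  shows "coords F Y"
  using assms(1) face_of_imp_subset[OF assms(2)] vertices_of_face[OF assms(2)]
    face_of_polytope_polytope[OF _ assms(2)]
  unfolding coords_def grid_def by blast

text \<open>On its minimal face \<open>a\<close> is constant and no longer separates points, so it
  is dropped. This replaces the passage to a polytope of smaller dimension.\<close>

lemma coords_level:
  assumes "coords P (insert a Y)" "\<And>x. x \<in> polytope_vertices P \<Longrightarrow> m \<le> a x"
  shows "level P a m face_of P" "coords (level P a m) Y"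
    "v \<in> polytope_vertices (level P a m) \<longleftrightarrow> v \<in> polytope_vertices P \<and> a v = m"
proof -
  have a: "polytope P" "affine_fun a"
    using assms(1) by (auto simp: coords_def grid_def)
  show F: "level P a m face_of P"
    and "v \<in> polytope_vertices (level P a m) \<longleftrightarrow> v \<in> polytope_vertices P \<and> a v = m"
    using level_face[OF a assms(2)] level_vertices[OF a assms(2)] by auto
  have "coords (level P a m) (insert a Y)" by (rule coords_face[OF assms(1) F])
  then show "coords (level P a m) Y" by (auto simp: coords_def level_def)
qed

lemma coords_level0:
  assumes "coords P (insert a Y)"
  shows "level P a 0 face_of P" "coords (level P a 0) Y"
    "v \<in> polytope_vertices (level P a 0) \<longleftrightarrow> v \<in> polytope_vertices P \<and> a v = 0"
  using coords_level[OF assms, of 0] grid_nonneg[OF coords_grid[OF assms]] by auto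

lemma coords_descend:
  assumes "coords P (insert a Y)" "z \<in> polytope_vertices P" "a z = m"
    "\<And>x. x \<in> polytope_vertices P \<Longrightarrow> m \<le> a x" "u \<in> polytope_vertices P"
  shows "\<exists>v \<in> polytope_vertices P. a v = m \<and> near P (a u - m) u v"
  using descend_to_min[OF coords_polytope[OF assms(1)], of a m z u] assms
    grid_affine[OF coords_grid[OF assms(1)]] grid_Ints[OF coords_grid[OF assms(1)]] by auto

lemma coords_descend0:
  assumes "coords P (insert a Y)" "z \<in> polytope_vertices P" "a z = 0" "u \<in> polytope_vertices P"
  shows "\<exists>v \<in> polytope_vertices P. a v = 0 \<and> near P (a u) u v"
  using coords_descend[OF assms(1-3) _ assms(4)] grid_nonneg[OF coords_grid[OF assms(1)]] by auto

lemma near_via_level: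
  assumes P: "polytope P" and f: "affine_fun f" "\<And>x. x \<in> polytope_vertices P \<Longrightarrow> f x \<in> \<int>"
    and m: "\<And>x. x \<in> polytope_vertices P \<Longrightarrow> m \<le> f x" "z \<in> polytope_vertices P" "f z = m"
    and r: "\<And>p q. p \<in> polytope_vertices (level P f m) \<Longrightarrow>
      q \<in> polytope_vertices (level P f m) \<Longrightarrow> near (level P f m) r p q"
    and uv: "u \<in> polytope_vertices P" "v \<in> polytope_vertices P"
  shows "near P (f u + f v - 2 * m + r) u v"
proof -
  obtain p where p: "p \<in> polytope_vertices P" "f p = m" "near P (f u - m) u p"
    using descend_to_min[OF P f m uv(1)] by blast
  obtain q where q: "q \<in> polytope_vertices P" "f q = m" "near P (f v - m) v q"
    using descend_to_min[OF P f m uv(2)] by blast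
  have "near P r p q"
    using r[of p q] p q level_vertices[OF P f(1) m(1)] near_face[OF level_face[OF P f(1) m(1)]]
    by blast
  then have "near P (f u - m + r) u q" using near_trans[OF p(3)] by simp
  then show ?thesis using near_trans near_sym[OF q(3)] by fastforce
qed

text \<open>The actual minimum of \<open>a\<close> may exceed \<open>m\<close>, which only shortens
  both descents. It is not known in advance, hence \<open>r\<close> is required of every
  face.\<close>

lemma near_down_min_face:
  assumes P: "coords P (insert a Y)"
    and m: "\<And>x. x \<in> polytope_vertices P \<Longrightarrow> m \<le> a x"
    and r: "\<And>F p q. F face_of P \<Longrightarrow> coords F Y \<Longrightarrow> p \<in> polytope_vertices F \<Longrightarrow>
      q \<in> polytope_vertices F \<Longrightarrow> near F r p q"
    and uv: "u \<in> polytope_vertices P" "v \<in> polytope_vertices P"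
  shows "near P (a u + a v - 2 * m + r) u v"
proof -
  obtain z where z: "z \<in> polytope_vertices P" "\<And>x. x \<in> polytope_vertices P \<Longrightarrow> a z \<le> a x"
    using min_vertex[OF coords_polytope[OF P] uv(1), of a] by blast
  have "near P (a u + a v - 2 * a z + r) u v"
    using near_via_level[OF coords_polytope[OF P], of a "a z" z r u v] z uv
      grid_affine[OF coords_grid[OF P]] grid_Ints[OF coords_grid[OF P]]
      r[OF coords_level(1,2)[OF P z(2)]] by simp
  then show ?thesis using near_mono m[OF z(1)] by fastforce
qed

text \<open>Descending from both ends and ascending from both ends cost \<open>2 * (h - l)\<close>
  together, so one of them costs at most \<open>h - l\<close>.\<close>

lemma near_range_face:
  assumes P: "coords P (insert a Y)"
    and m: "\<And>x. x \<in> polytope_vertices P \<Longrightarrow> l \<le> a x" "\<And>x. x \<in> polytope_vertices P \<Longrightarrow> a x \<le> h"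
    and r: "\<And>F p q. F face_of P \<Longrightarrow> coords F Y \<Longrightarrow> p \<in> polytope_vertices F \<Longrightarrow>
      q \<in> polytope_vertices F \<Longrightarrow> near F r p q"
    and uv: "u \<in> polytope_vertices P" "v \<in> polytope_vertices P"
  shows "near P (h - l + r) u v"
proof (cases "a u + a v \<le> h + l")
  case True
  show ?thesis
    by (rule near_mono[OF near_down_min_face[OF P m(1) r uv]]) (use True in auto)
next
  case False
  have "3 - h \<le> rf a x" if "x \<in> polytope_vertices P" for x using m(2)[OF that] by simp
  from near_down_min_face[OF coords_rf[OF P] this r uv] show ?thesis
    by (rule near_mono) (use False in auto)
qed

lemma near_down_min:
  assumes "coords P (insert a Y)" "\<And>x. x \<in> polytope_vertices P \<Longrightarrow> m \<le> a x"
    and "\<And>F p q. coords F Y \<Longrightarrow> p \<in> polytope_vertices F \<Longrightarrow> q \<in> polytope_vertices F \<Longrightarrow> near F r p q"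
    and "u \<in> polytope_vertices P" "v \<in> polytope_vertices P"
  shows "near P (a u + a v - 2 * m + r) u v"
  by (rule near_down_min_face) (use assms in auto)

lemma near_down:
  assumes P: "coords P (insert a Y)"
    and r: "\<And>F p q. coords F Y \<Longrightarrow> p \<in> polytope_vertices F \<Longrightarrow> q \<in> polytope_vertices F \<Longrightarrow> near F r p q"
    and uv: "u \<in> polytope_vertices P" "v \<in> polytope_vertices P"
  shows "near P (a u + a v + r) u v"
  using near_down_min[OF P _ r uv, of 0] grid_nonneg[OF coords_grid[OF P]] by simp

lemma near_range:
  assumes "coords P (insert a Y)"
    and "\<And>x. x \<in> polytope_vertices P \<Longrightarrow> l \<le> a x" "\<And>x. x \<in> polytope_vertices P \<Longrightarrow> a x \<le> h"
    and "\<And>F p q. coords F Y \<Longrightarrow> p \<in> polytope_vertices F \<Longrightarrow> q \<in> polytope_vertices F \<Longrightarrow> near F r p q"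
    and "u \<in> polytope_vertices P" "v \<in> polytope_vertices P"
  shows "near P (h - l + r) u v"
  by (rule near_range_face) (use assms in auto)

lemma vertex_between:
  assumes P: "coords P Y" and u: "u \<in> polytope_vertices P" and pq: "p \<in> P" "q \<in> P"
    and t: "0 < t" "t < 1" and eq: "\<forall>y\<in>Y. y u = (1 - t) * y p + t * y q"
  shows "p = q"
proof -
  let ?x = "(1 - t) *\<^sub>R p + t *\<^sub>R q"
  have "?x \<in> P" using P pq t by (intro convexD) (auto simp: coords_def polytope_imp_convex)
  moreover have "\<forall>y\<in>Y. y u = y ?x"
  proof
    fix y assume "y \<in> Y"
    then show "y u = y ?x"
      using affine_fun_comb[OF grid_affine[OF coords_grid[OF P]], of y "1 - t" t p q] eq by simp
  qed
  ultimately have "u = ?x" by (rule coords_inj[OF P vertex_in[OF u]])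
  then show ?thesis using vertex_not_between[OF u pq _ t] by blast
qed

lemma coords_eqI:
  "coords P Y \<Longrightarrow> p \<in> polytope_vertices P \<Longrightarrow> q \<in> polytope_vertices P \<Longrightarrow>
    \<forall>y\<in>Y. y p = y q \<Longrightarrow> p = q"
  by (simp add: coords_inj vertex_in)

lemma near_dim1:
  assumes P: "coords P {a}" and uv: "u \<in> polytope_vertices P" "v \<in> polytope_vertices P"
  shows "near P 1 u v"
proof -
  have *: "near P 1 u v"
    if uv: "u \<in> polytope_vertices P" "v \<in> polytope_vertices P" "a v < a u" for u v
  proof -
    obtain w where w: "(u, w) \<in> polytope_adj P" "a w < a u"
      using descending_neighbor[OF coords_polytope[OF P] uv(1) _ vertex_in[OF uv(2)] uv(3)]
        grid_affine[OF coords_grid[OF P]] by auto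
    have wV: "w \<in> polytope_vertices P" using adj_vertices w by blast
    have bet: False if x: "x \<in> polytope_vertices P" "y \<in> polytope_vertices P" "a y < a x" "a x < a u" for x y
    proof -
      define t where "t = (a x - a y) / (a u - a y)"
      have "0 < t" "t < 1" using x by (auto simp: t_def divide_simps)
      moreover have "a x = (1 - t) * a y + t * a u"
      proof -
        have "t * (a u - a y) = a x - a y" using x by (simp add: t_def)
        then show ?thesis by (simp add: algebra_simps)
      qed
      ultimately have "y = u"
        using vertex_between[OF P x(1) vertex_in[OF x(2)] vertex_in[OF uv(1)]] by simp
      then show False using x by simp
    qed
    have "a w = a v" using bet[of w v] bet[of v w] w uv wV by (meson linorder_cases)
    then have "w = v" using coords_eqI[OF P wV uv(2)] by simp
    then show ?thesis using near_adj w by blast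
  qed
  consider "a v < a u" | "a u < a v" | "u = v" using coords_eqI[OF P uv] by fastforce
  then show ?thesis
    using *[OF uv] *[OF uv(2,1)] near_sym near_refl[of 1 P u] by cases auto
qed

lemma near_dim2:
  assumes "coords P {a, b}" "u \<in> polytope_vertices P" "v \<in> polytope_vertices P"
  shows "near P 4 u v"
proof -
  have "near P (3 - 0 + 1) u v"
  proof (rule near_range[OF assms(1) _ _ near_dim1 assms(2,3)])
    show "0 \<le> a x" "a x \<le> 3" if "x \<in> polytope_vertices P" for x
      using gridD[OF coords_grid[OF assms(1)] that, of a] by auto
  qed
  then show ?thesis by simp
qed

section \<open>Lattice polygons in the box\<close>

text \<open>Merging two of the three points into one reduces this to \<open>vertex_between\<close>.
  It rules out configurations of vertices by explicit barycentric coordinates.\<close>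

lemma vertex_not_in_triangle:
  assumes P: "coords P Y" and u: "u \<in> polytope_vertices P" and x: "x \<in> P" "y \<in> P" "z \<in> P"
    and l: "0 < r" "0 < s" "0 < t" "r + s + t = 1"
    and eq: "\<forall>f\<in>Y. f u = r * f x + s * f y + t * f z"
  shows "x = u"
proof -
  define w where "w = (s / (s + t)) *\<^sub>R y + (t / (s + t)) *\<^sub>R z"
  have st: "s / (s + t) + t / (s + t) = 1" using l by (simp add: add_divide_distrib[symmetric])
  have "w \<in> P" unfolding w_def
    using P x l st by (intro convexD) (auto simp: coords_def polytope_imp_convex)
  have w: "(s + t) * f w = s * f y + t * f z" if "f \<in> Y" for f
  proof -
    have "f w = s / (s + t) * f y + t / (s + t) * f z"
      unfolding w_def by (rule affine_fun_comb[OF grid_affine[OF coords_grid[OF P that]] st])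
    moreover have "(s + t) * (s / (s + t)) = s" "(s + t) * (t / (s + t)) = t" using l by auto
    ultimately show ?thesis by (metis distrib_left mult.assoc)
  qed
  have r: "1 - (s + t) = r" using l by simp
  have "x = w"
    using vertex_between[OF P u x(1) \<open>w \<in> P\<close>, of "s + t"] l w eq by (simp add: r add.assoc)
  then have "f u = f x" if "f \<in> Y" for f
  proof -
    have "f u = r * f x + (s + t) * f x"
      using w[OF that] eq that \<open>x = w\<close> by (simp add: add.assoc)
    also have "\<dots> = (r + s + t) * f x" by (simp add: distrib_right)
    finally show ?thesis using l(4) by simp
  qed
  then show ?thesis using coords_inj[OF P x(1) vertex_in[OF u]] by metis
qed

text \<open>On a level of \<open>a + b\<close> the value of \<open>b\<close> is determined by that
  of \<open>a\<close>, so one coordinate is dropped here as well.\<close>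

lemma coords_sum_level:
  assumes P: "coords P (insert a (insert b Y))"
    and m: "\<And>x. x \<in> polytope_vertices P \<Longrightarrow> m \<le> a x + b x"
  shows "level P (\<lambda>x. a x + b x) m face_of P" "coords (level P (\<lambda>x. a x + b x) m) (insert a Y)"
    "v \<in> polytope_vertices (level P (\<lambda>x. a x + b x) m) \<longleftrightarrow> v \<in> polytope_vertices P \<and> a v + b v = m"
proof -
  let ?F = "level P (\<lambda>x. a x + b x) m"
  have "grid P a" "grid P b" using P by (auto simp: coords_def)
  then have f: "affine_fun (\<lambda>x. a x + b x)" by (simp add: grid_affine affine_fun_add)
  show F: "?F face_of P"
    and "v \<in> polytope_vertices ?F \<longleftrightarrow> v \<in> polytope_vertices P \<and> a v + b v = m"
    using level_face[OF coords_polytope[OF P] f m] level_vertices[OF coords_polytope[OF P] f m] by auto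
  have C: "coords ?F (insert a (insert b Y))" by (rule coords_face[OF P F])
  show "coords ?F (insert a Y)"
    unfolding coords_def
  proof (intro conjI ballI impI)
    fix p q assume pq: "p \<in> ?F" "q \<in> ?F" "\<forall>y\<in>insert a Y. y p = y q"
    then have "b p = b q" by (simp add: level_def)
    then show "p = q" using coords_inj[OF C pq(1,2)] pq(3) by simp
  qed (use C in \<open>auto simp: coords_def\<close>)
qed

text \<open>The minimum \<open>l\<close> of \<open>a + b\<close> is unknown. The bound demanded of
  its face grows by \<open>2 * l\<close>, exactly what the two descents save, so \<open>l\<close>
  cancels.\<close>

lemma near_via_sum:
  assumes P: "coords P (insert a (insert b Y))"
    and m: "\<And>x. x \<in> polytope_vertices P \<Longrightarrow> m \<le> a x + b x"
    and r: "\<And>F p q l. coords F (insert a Y) \<Longrightarrow> m \<le> l \<Longrightarrow> (\<And>x. x \<in> polytope_vertices F \<Longrightarrow> a x \<le> l) \<Longrightarrow>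
      p \<in> polytope_vertices F \<Longrightarrow> q \<in> polytope_vertices F \<Longrightarrow> near F (2 * l - 2 * m + r) p q"
    and uv: "u \<in> polytope_vertices P" "v \<in> polytope_vertices P"
  shows "near P (a u + b u + a v + b v - 2 * m + r) u v"
proof -
  let ?f = "\<lambda>x. a x + b x"
  have g: "grid P a" "grid P b" using P by (auto simp: coords_def)
  obtain z where z: "z \<in> polytope_vertices P" "\<And>x. x \<in> polytope_vertices P \<Longrightarrow> ?f z \<le> ?f x"
    using min_vertex[OF coords_polytope[OF P] uv(1), of ?f] by blast
  have "near P (?f u + ?f v - 2 * ?f z + (2 * ?f z - 2 * m + r)) u v"
  proof (rule near_via_level[where f = ?f and m = "?f z" and z = z])
    show "polytope P" "z \<in> polytope_vertices P" "u \<in> polytope_vertices P" "v \<in> polytope_vertices P"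
      using coords_polytope[OF P] z uv by auto
    show "?f z \<le> ?f x" if "x \<in> polytope_vertices P" for x by (rule z(2)[OF that])
    show "affine_fun ?f" using g by (simp add: grid_affine affine_fun_add)
    show "?f x \<in> \<int>" if "x \<in> polytope_vertices P" for x
      using g that by (simp add: grid_Ints)
    fix p q assume pq: "p \<in> polytope_vertices (level P ?f (?f z))" "q \<in> polytope_vertices (level P ?f (?f z))"
    show "near (level P ?f (?f z)) (2 * ?f z - 2 * m + r) p q"
    proof (rule r[OF coords_sum_level(2)[OF P z(2)] m[OF z(1)] _ pq])
      fix x assume "x \<in> polytope_vertices (level P ?f (?f z))"
      then have "x \<in> polytope_vertices P" "?f x = ?f z"
        using coords_sum_level(3)[OF P z(2)] by auto
      then show "a x \<le> ?f z" using grid_nonneg[OF g(2)] by force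
    qed
  qed simp
  then show ?thesis by (simp add: algebra_simps)
qed

text \<open>The vertices of the only lattice polygon in the box \<open>[0,3]\<^sup>2\<close> that has diameter four.\<close>

definition octagon :: "(real \<times> real) set" where
  "octagon = {(0, 1), (0, 2), (1, 0), (2, 0), (3, 1), (3, 2), (1, 3), (2, 3)}"

lemma coords2:
  assumes "coords P {a, b}"
  shows "coords P {b, a}" "coords P {rf a, b}" "coords P {a, rf b}" "coords P {rf a, rf b}"
    "coords P {b, rf a}" "coords P {rf b, a}" "coords P {rf b, rf a}"
  using assms coords_rf[of P a "{b}"] coords_rf[of P b "{a}"] coords_rf[of P "rf a" "{b}"]
    coords_rf[of P b "{rf a}"]
  by (simp_all add: insert_commute)

lemma near_down2:
  "coords P {a, b} \<Longrightarrow> u \<in> polytope_vertices P \<Longrightarrow> v \<in> polytope_vertices P \<Longrightarrow> near P (a u + a v + 1) u v"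
  using near_down[of P a "{b}" 1 u v] near_dim1 by blast

lemma near_line2:
  assumes "coords P {a, b}" "u \<in> polytope_vertices P" "v \<in> polytope_vertices P"
    "b u = b v" "b u = 0 \<or> b u = 3"
  shows "near P 1 u v"
  using near_down2[OF coords2(1)[OF assms(1)] assms(2,3)] assms(4,5)
    near_down2[OF coords2(6)[OF assms(1)] assms(2,3)] by auto

text \<open>The locales \<open>far2\<close>, \<open>far3\<close>, \<open>far4\<close> fix two vertices that are too far apart. They are closed under
  permuting and reflecting the coordinates, which is how statements are transferred to the other orientations.\<close>

locale far2 =
  fixes P :: "'a::euclidean_space set" and a b p q
  assumes C: "coords P {a, b}" and p: "p \<in> polytope_vertices P" and q: "q \<in> polytope_vertices P"
    and far: "\<not> near P 3 p q"
begin

lemma swap: "far2 P a b q p"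
  using C p q far near_sym by unfold_locales blast+

lemma comm: "far2 P b a p q"
  using coords2[OF C] p q far by unfold_locales

lemma refl1: "far2 P (rf a) b p q"
  using coords2[OF C] p q far by unfold_locales

lemma ga: "v \<in> polytope_vertices P \<Longrightarrow> a v = 0 \<or> a v = 1 \<or> a v = 2 \<or> a v = 3"
  using gridD[OF coords_grid[OF C]] by blast

lemma gb: "v \<in> polytope_vertices P \<Longrightarrow> b v = 0 \<or> b v = 1 \<or> b v = 2 \<or> b v = 3"
  using gridD[OF coords_grid[OF C]] by blast

lemma farD: "near P r p q \<Longrightarrow> 3 < r"
  using far near_mono[of P r p q 3] by linarith

lemma far_via: "near P r p x \<Longrightarrow> near P s x q \<Longrightarrow> 3 < r + s"
  using far near_trans by (metis linorder_not_less)

lemma sum_a: "a p + a q = 3"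
  using farD[OF near_down2[OF C p q]] farD[OF near_down2[OF coords2(2)[OF C] p q]] ga[OF p] ga[OF q]
  by auto

text \<open>Otherwise both descents in \<open>a\<close> are one step shorter and 3 - 2 + 1 = 2 steps
  suffice.\<close>

lemma ex_low: "\<exists>x \<in> polytope_vertices P. a x = 0"
proof (rule ccontr)
  assume "\<not> ?thesis"
  then have *: "1 \<le> a x" if "x \<in> polytope_vertices P" for x using that ga[OF that] by auto
  have "near P (a p + a q - 2 * 1 + 1) p q"
    by (rule near_down_min[OF C * near_dim1 p q])
  then show False using farD[of "a p + a q - 2 * 1 + 1"] sum_a by simp
qed

text \<open>An edge that lowers \<open>a\<close> by two would begin a path of length 1 + (3 - 2) + 1
  = 3.\<close>

lemma step: "(p, w) \<in> polytope_adj P \<Longrightarrow> a p - 1 \<le> a w"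
  using far_via[OF near_adj near_down2[OF C _ q], of w] ga[OF p] ga[of w] adj_vertices(2)[of p w P] sum_a by (smt (verit))

end

context far2
begin

lemma sum_b: "b p + b q = 3"
  by (rule far2.sum_a[OF comm])

text \<open>At \<open>p\<close> and \<open>q\<close> together \<open>a + b\<close> amounts to 6.
  With minimum at least 2, descending and crossing one edge takes 6 - 4 + 1 = 3 steps.\<close>

lemma ex_corner: "\<exists>x \<in> polytope_vertices P. a x + b x \<le> 1"
proof (rule ccontr)
  assume *: "\<not> ?thesis"
  have "2 \<le> a x + b x" if "x \<in> polytope_vertices P" for x
    using * that ga[OF that] gb[OF that] by auto
  then have "near P (a p + b p + a q + b q - 2 * 2 + 1) p q"
  proof (rule near_via_sum[OF C _ _ p q])
    fix F p q l assume F: "coords F {a}" "p \<in> polytope_vertices F" "q \<in> polytope_vertices F" "(2::real) \<le> l"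
    show "near F (2 * l - 2 * 2 + 1) p q"
      by (rule near_mono[OF near_dim1[OF F(1-3)]]) (use F in simp)
  qed
  then show False using farD[of "a p + b p + a q + b q - 2 * 2 + 1"] sum_a sum_b by simp
qed

lemma step_up: "(p, w) \<in> polytope_adj P \<Longrightarrow> a w \<le> a p + 1"
  using far2.step[OF refl1, of w] by simp

lemma ex_corner_rb: "\<exists>x \<in> polytope_vertices P. b x + 2 \<le> a x"
  using far2.ex_corner[OF refl1] by force

end

text \<open>There is a vertex at (2,0), (3,0) or (3,1). It shares a side of the box with
  \<open>p\<close> or with \<open>q\<close>, which saves the missing step.\<close>

lemma (in far2) not_corner: "\<not> (a p = 0 \<and> b p = 0)"
proof
  assume *: "a p = 0 \<and> b p = 0"
  then have aq: "a q = 3" "b q = 3" using sum_a sum_b by auto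
  obtain x where x: "x \<in> polytope_vertices P" "b x + 2 \<le> a x" using ex_corner_rb by blast
  have "near P 1 p x" if "b x = 0"
    using near_line2[OF C p x(1)] * that by simp
  moreover have "near P 1 x q" if "a x = 3"
    using near_line2[OF coords2(1)[OF C] x(1) q] aq that by simp
  moreover have "near P (3 - a x + (3 - a q) + 1) x q"
    using near_down2[OF coords2(2)[OF C] x(1) q] by simp
  moreover have "near P (b p + b x + 1) p x"
    by (rule near_down2[OF coords2(1)[OF C] p x(1)])
  ultimately show False
    using far_via[of 1 x] far_via[of _ x 1] far_via[of _ x] ga[OF x(1)] gb[OF x(1)] x(2) * aq
    by (smt (verit))
qed

text \<open>A vertex \<open>y\<close> near the corner (0,3) puts \<open>p\<close> inside the
  triangle of \<open>x\<close>, \<open>y\<close>, \<open>q\<close>, or on the segment from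
  \<open>x\<close> to \<open>y\<close> if \<open>y\<close> is (1,3).\<close>

lemma (in far2) not_center_aux:
  assumes "a p = 1" "b p = 1" and x: "x \<in> polytope_vertices P" "a x = 1" "b x = 0"
  shows False
proof -
  have q2: "a q = 2" "b q = 2" using sum_a sum_b assms by auto
  obtain y where y: "y \<in> polytope_vertices P" "a y + 2 \<le> b y"
    using far2.ex_corner_rb[OF comm] by blast
  then have "a y = 0 \<and> b y = 2 \<or> a y = 0 \<and> b y = 3 \<or> a y = 1 \<and> b y = 3"
    using ga[OF y(1)] gb[OF y(1)] by auto
  moreover have "x = p" if "a y = 0" "b y = 2"
    using vertex_not_in_triangle[OF C p vertex_in[OF x(1)] vertex_in[OF y(1)] vertex_in[OF q], of "1/2" "1/4" "1/4"]
      assms q2 that by auto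
  moreover have "x = p" if "a y = 0" "b y = 3"
    using vertex_not_in_triangle[OF C p vertex_in[OF x(1)] vertex_in[OF y(1)] vertex_in[OF q], of "3/5" "1/5" "1/5"]
      assms q2 that by auto
  moreover have "x = y" if "a y = 1" "b y = 3"
    using vertex_between[OF C p vertex_in[OF x(1)] vertex_in[OF y(1)], of "1/3"] assms that by auto
  ultimately show False using assms by auto
qed

lemma (in far2) not_center: "\<not> (a p = 1 \<and> b p = 1)"
proof
  assume *: "a p = 1 \<and> b p = 1"
  obtain x where x: "x \<in> polytope_vertices P" "a x + b x \<le> 1" using ex_corner by blast
  then have "a x = 1 \<and> b x = 0 \<or> a x = 0 \<and> b x = 1 \<or> a x = 0 \<and> b x = 0"
    using ga[OF x(1)] gb[OF x(1)] by auto
  then consider "a x = 1" "b x = 0" | "a x = 0" "b x = 1" | "a x = 0" "b x = 0" by blast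
  then show False
  proof cases
    case 1 then show ?thesis using not_center_aux * x by blast
  next
    case 2 then show ?thesis using far2.not_center_aux[OF comm] * x by blast
  next
    case 3
    then have "x = q"
      using vertex_between[OF C p vertex_in[OF x(1)] vertex_in[OF q], of "1/2"] * sum_a sum_b by auto
    then show ?thesis using 3 sum_a * by auto
  qed
qed

context far2
begin

lemma ex_up_neighbor: "\<exists>w. (p, w) \<in> polytope_adj P \<and> a w = a p + 1" if "a p < 3"
proof -
  obtain z where z: "z \<in> polytope_vertices P" "rf a z = 0"
    using far2.ex_low[OF refl1] by blast
  then have "rf a z < rf a p" using that by simp
  then obtain w where w: "(p, w) \<in> polytope_adj P" "rf a w < rf a p"
    using descending_neighbor[OF coords_polytope[OF C] p _ vertex_in[OF z(1)]]
      grid_affine[OF coords_grid[OF coords2(2)[OF C]]] by blast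
  then have "a w = a p + 1"
    using step_up[OF w(1)] ga[OF p] ga[OF adj_vertices(2)[OF w(1)]] by auto
  then show ?thesis using w by blast
qed

text \<open>The point (2,1) lies inside the triangle (1,0), (3,1), (2,3) of \<open>p\<close>,
  \<open>x\<close>, \<open>q\<close>.\<close>

lemma vertex_21:
  assumes p1: "a p = 1" "b p = 0" and x: "x \<in> polytope_vertices P" "a x = 3" "b x = 1"
    and y: "y \<in> polytope_vertices P" "a y = 2" "b y = 1"
  shows False
proof -
  have "p = y"
    using vertex_not_in_triangle[OF C y(1) vertex_in[OF p] vertex_in[OF x(1)] vertex_in[OF q], of "2/5" "2/5" "1/5"]
      assms sum_a sum_b by auto
  then show False using assms by simp
qed

lemma far_edge:
  assumes p1: "a p = 1" "b p = 0"
  shows "\<exists>x \<in> polytope_vertices P. a x = 2 \<and> b x = 0 \<or> a x = 3 \<and> b x = 1"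
proof -
  obtain x where x: "x \<in> polytope_vertices P" "b x + 2 \<le> a x" using ex_corner_rb by blast
  have "\<not> (a x = 3 \<and> b x = 0)"
  proof
    assume *: "a x = 3 \<and> b x = 0"
    have "near P 1 p x" using near_line2[OF C p x(1)] p1 * by simp
    moreover have "near P 2 x q" using near_down2[OF coords2(2)[OF C] x(1) q] p1 * sum_a by simp
    ultimately show False using far_via by force
  qed
  then show ?thesis using x ga[OF x(1)] gb[OF x(1)] by force
qed

lemma up_neighbor10:
  assumes p1: "a p = 1" "b p = 0"
  shows "\<exists>y. (p, y) \<in> polytope_adj P \<and> a y = 2 \<and> (b y = 0 \<or> b y = 1)"
proof -
  obtain y where y: "(p, y) \<in> polytope_adj P" "a y = 2" using ex_up_neighbor p1 by force
  then show ?thesis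
    using far2.step_up[OF comm y(1)] gb[OF adj_vertices(2)[OF y(1)]] p1 by auto
qed

lemma vertex_30:
  assumes p1: "a p = 1" "b p = 0" and x: "x \<in> polytope_vertices P" "a x = 3" "b x = 0"
  shows False
proof -
  have "near P 1 p x" using near_line2[OF C p x(1)] p1 x by simp
  moreover have "near P 2 x q" using near_down2[OF coords2(2)[OF C] x(1) q] p1 x sum_a by simp
  ultimately show False using far_via by force
qed

text \<open>Next to (0,0) there is no vertex (2,0), whose midpoint with (0,0) is \<open>p\<close>.
  Then \<open>far_edge\<close> and \<open>up_neighbor10\<close> produce (3,1) and (2,1), which
  exclude each other.\<close>

lemma vertex_00:
  assumes p1: "a p = 1" "b p = 0" and x: "x \<in> polytope_vertices P" "a x = 0" "b x = 0"
  shows False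
proof -
  have no20: False if "y \<in> polytope_vertices P" "a y = 2" "b y = 0" for y
    using vertex_between[OF C p vertex_in[OF x(1)] vertex_in[OF that(1)], of "1/2"] p1 x that by auto
  show False
    using far_edge[OF p1] up_neighbor10[OF p1] no20 vertex_21[OF p1] adj_vertices(2) by metis
qed

lemma down_neighbor10:
  assumes p1: "a p = 1" "b p = 0"
  shows "\<exists>y. (p, y) \<in> polytope_adj P \<and> a y = 0 \<and> b y = 1"
proof -
  obtain y where y: "(p, y) \<in> polytope_adj P" "a y = 0" using far2.ex_up_neighbor[OF refl1] p1 by force
  then show ?thesis
    using far2.step_up[OF comm y(1)] gb[OF adj_vertices(2)[OF y(1)]] p1
      vertex_00[OF p1 adj_vertices(2)[OF y(1)]] by auto
qed

lemma rot: "far2 P (rf a) (rf b) q p"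
  using far2.refl1[OF far2.comm[OF far2.refl1[OF comm]]] far2.comm far2.swap by metis

text \<open>The walk from \<open>p\<close> around the octagon is (1,0), (2,0), (3,1). The vertex
  after (2,0) cannot be (3,2): that is a neighbour of \<open>q\<close>, and \<open>q\<close> would
  be reached in three steps. The walk of length two to (3,1) is used again in dimension
  three.\<close>

lemma edge10:
  assumes p1: "a p = 1" "b p = 0"
  shows "\<exists>y \<in> polytope_vertices P. a y = 2 \<and> b y = 0"
    "\<exists>z \<in> polytope_vertices P. a z = 3 \<and> b z = 1 \<and> near P 2 p z"
proof -
  have q1: "rf a q = 1" "rf b q = 0" using sum_a sum_b p1 by auto
  obtain y where y: "y \<in> polytope_vertices P" "a y = 2" "b y = 0"
    using far_edge[OF p1] up_neighbor10[OF p1] vertex_21[OF p1] adj_vertices(2) by metis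
  then show "\<exists>y \<in> polytope_vertices P. a y = 2 \<and> b y = 0" by blast
  have py: "near P 1 p y" using near_line2[OF C p y(1)] y p1 by simp
  obtain x where x: "x \<in> polytope_vertices P" "rf a x = 0"
    using far2.ex_low[OF refl1] by blast
  then have "rf a x < rf a y" using y by simp
  then obtain z where z: "(y, z) \<in> polytope_adj P" "rf a z < rf a y"
    using descending_neighbor[OF coords_polytope[OF C] y(1) _ vertex_in[OF x(1)]]
      grid_affine[OF coords_grid[OF coords2(2)[OF C]]] by blast
  have zV: "z \<in> polytope_vertices P" using z(1) by (rule adj_vertices)
  have z3: "a z = 3" using z(2) y ga[OF zV] by auto
  have pz: "near P 2 p z" using near_trans[OF py near_adj[OF z(1)]] by simp
  have "b z \<noteq> 0" using vertex_30[OF p1 zV z3] by blast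
  moreover have "b z \<noteq> 3" using far2.vertex_00[OF rot q1 zV] z3 by auto
  moreover have "b z \<noteq> 2"
  proof
    assume "b z = 2"
    obtain w where w: "(q, w) \<in> polytope_adj P" "rf a w = 0" "rf b w = 1"
      using far2.down_neighbor10[OF rot q1] by blast
    have "w = z"
      using coords_eqI[OF C adj_vertices(2)[OF w(1)] zV] w z3 \<open>b z = 2\<close> by auto
    then show False using far_via[OF pz near_sym[OF near_adj]] w(1) by force
  qed
  ultimately have "b z = 1" using gb[OF zV] by blast
  then show "\<exists>z \<in> polytope_vertices P. a z = 3 \<and> b z = 1 \<and> near P 2 p z"
    using zV z3 pz by blast
qed

definition full :: "('a \<Rightarrow> real) \<Rightarrow> ('a \<Rightarrow> real) \<Rightarrow> bool" where
  "full f g \<longleftrightarrow> (\<forall>(i, j)\<in>octagon. \<exists>x \<in> polytope_vertices P. f x = i \<and> g x = j)"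

lemma full10:
  assumes p1: "a p = 1" "b p = 0"
  shows "full a b"
proof -
  have q1: "rf a q = 1" "rf b q = 0" using sum_a sum_b p1 by auto
  have "\<exists>x \<in> polytope_vertices P. a x = 0 \<and> b x = 1"
    using down_neighbor10[OF p1] adj_vertices(2) by blast
  moreover have "\<exists>x \<in> polytope_vertices P. a x = 3 \<and> b x = 2"
    using far2.down_neighbor10[OF rot q1] adj_vertices(2) by force
  moreover have "\<exists>x \<in> polytope_vertices P. a x = 1 \<and> b x = 3"
    using far2.edge10(1)[OF rot q1] by force
  moreover have "\<exists>x \<in> polytope_vertices P. a x = 0 \<and> b x = 2"
    using far2.edge10(2)[OF rot q1] by force
  moreover have "\<exists>x \<in> polytope_vertices P. a x = 2 \<and> b x = 3"
    using q q1 by force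
  moreover have "\<exists>x \<in> polytope_vertices P. a x = 1 \<and> b x = 0"
    using p p1 by force
  moreover note edge10[OF p1]
  ultimately show ?thesis unfolding full_def octagon_def by auto
qed

end

lemma (in far2) full_comm: "far2.full P b a \<Longrightarrow> full a b"
  unfolding full_def far2.full_def[OF comm] octagon_def by auto

lemma (in far2) full_refl1: "far2.full P (rf a) b \<Longrightarrow> full a b"
  unfolding full_def far2.full_def[OF refl1] octagon_def by force

lemma (in far2) refl2: "far2 P a (rf b) p q"
  using far2.comm[OF far2.refl1[OF comm]] .

lemma (in far2) full_refl2: "far2.full P a (rf b) \<Longrightarrow> full a b"
  unfolding full_def far2.full_def[OF refl2] octagon_def by force

lemma (in far2) not_corner_any: "\<not> (a p \<in> {0, 3} \<and> b p \<in> {0, 3})"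
  using not_corner far2.not_corner[OF refl1] far2.not_corner[OF refl2]
    far2.not_corner[OF far2.refl2[OF refl1]] by auto

lemma (in far2) not_center_any: "\<not> (a p \<in> {1, 2} \<and> b p \<in> {1, 2})"
  using not_center far2.not_center[OF refl1] far2.not_center[OF refl2]
    far2.not_center[OF far2.refl2[OF refl1]] by auto

lemma (in far2) full_edge_aux: "a p \<in> {1, 2} \<Longrightarrow> b p \<in> {0, 3} \<Longrightarrow> full a b"
  using full10 full_refl1[OF far2.full10[OF refl1]] full_refl2[OF far2.full10[OF refl2]]
    full_refl2[OF far2.full_refl1[OF refl2 far2.full10[OF far2.refl1[OF refl2]]]] by auto

lemma (in far2) octagon:
  shows "(a p, b p) \<in> octagon" and "full a b"
proof -
  show "(a p, b p) \<in> octagon"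
    using ga[OF p] gb[OF p] not_corner_any not_center_any unfolding octagon_def by auto
  then have "a p \<in> {1, 2} \<and> b p \<in> {0, 3} \<or> b p \<in> {1, 2} \<and> a p \<in> {0, 3}"
    unfolding octagon_def by auto
  then show "full a b"
    using full_edge_aux full_comm[OF far2.full_edge_aux[OF comm]] by blast
qed

section \<open>Dimension three\<close>

lemma coords_dep:
  assumes "coords F (insert b Y)"
    "\<And>p q. p \<in> F \<Longrightarrow> q \<in> F \<Longrightarrow> \<forall>y\<in>Y. y p = y q \<Longrightarrow> b p = b q"
  shows "coords F Y"
  unfolding coords_def
proof (intro conjI ballI impI)
  fix p q assume pq: "p \<in> F" "q \<in> F" "\<forall>y\<in>Y. y p = y q"
  then have "b p = b q" by (rule assms(2))
  then show "p = q" using coords_inj[OF assms(1) pq(1,2)] pq(3) by simp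
qed (use assms(1) in \<open>auto simp: coords_def\<close>)

lemma coords3:
  assumes "coords P {a, b, c}"
  shows "coords P {b, a, c}" "coords P {a, c, b}" "coords P {c, a, b}" "coords P {c, b, a}" "coords P {b, c, a}"
    "coords P {rf a, b, c}" "coords P {a, rf b, c}" "coords P {a, b, rf c}"
  using assms coords_rf[of P a "{b, c}"] coords_rf[of P b "{a, c}"] coords_rf[of P c "{a, b}"]
  by (simp_all add: insert_commute)

text \<open>The face at the minimum \<open>l\<close> of \<open>a + b\<close> has coordinates
  \<open>a\<close>, \<open>c\<close> with \<open>a\<close> in [0,l]; crossing it takes
  \<open>l + 1\<close> steps, at most \<open>2 * l + 1\<close>.\<close>

lemma near_sum2_dim3:
  assumes P: "coords P {a, b, c}" and uv: "u \<in> polytope_vertices P" "v \<in> polytope_vertices P"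
  shows "near P (a u + b u + a v + b v + 1) u v"
proof -
  have "near P (a u + b u + a v + b v - 2 * 0 + 1) u v"
  proof (rule near_via_sum[OF P _ _ uv])
    show "0 \<le> a x + b x" if "x \<in> polytope_vertices P" for x
      using that grid_nonneg[OF coords_grid[OF P]] by simp
    fix F p q l
    assume F: "coords F {a, c}" "(0::real) \<le> l" "\<And>x. x \<in> polytope_vertices F \<Longrightarrow> a x \<le> l"
      "p \<in> polytope_vertices F" "q \<in> polytope_vertices F"
    have "near F (l - 0 + 1) p q"
      using grid_nonneg[OF coords_grid[OF F(1)]] by (intro near_range[OF F(1) _ F(3) near_dim1 F(4,5)]) auto
    then show "near F (2 * l - 2 * 0 + 1) p q" by (rule near_mono) (use F(2) in simp)
  qed
  then show ?thesis by simp
qed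

lemma near_down3:
  "coords P {a, b, c} \<Longrightarrow> u \<in> polytope_vertices P \<Longrightarrow> v \<in> polytope_vertices P \<Longrightarrow> near P (a u + a v + 4) u v"
  by (rule near_down[OF _ near_dim2])

lemma near_level0:
  assumes P: "coords P (insert a Y)" and uv: "u \<in> polytope_vertices P" "v \<in> polytope_vertices P" "a u = 0" "a v = 0"
    and r: "u \<in> polytope_vertices (level P a 0) \<Longrightarrow> v \<in> polytope_vertices (level P a 0) \<Longrightarrow> near (level P a 0) r u v"
  shows "near P r u v"
  using near_face[OF coords_level0(1)[OF P] r] coords_level0(3)[OF P] uv by blast

lemma near_level_dim2:
  assumes P: "coords P {a, b, c}" and uv: "u \<in> polytope_vertices P" "v \<in> polytope_vertices P" "a u = 0" "a v = 0"
  shows "near P 3 u v \<or> far2 (level P a 0) b c u v"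
proof -
  have V: "u \<in> polytope_vertices (level P a 0)" "v \<in> polytope_vertices (level P a 0)"
    using uv coords_level0(3)[OF P] by auto
  show ?thesis
  proof (cases "near (level P a 0) 3 u v")
    case True
    then show ?thesis using near_face[OF coords_level0(1)[OF P]] by simp
  next
    case False
    then show ?thesis using far2.intro[OF coords_level0(2)[OF P] V] by simp
  qed
qed

lemma octagonD: "(i, j) \<in> octagon \<Longrightarrow> i \<in> {0, 3} \<and> j \<in> {1, 2} \<or> i \<in> {1, 2} \<and> j \<in> {0, 3}"
  unfolding octagon_def by auto

locale far3 =
  fixes P :: "'a::euclidean_space set" and a b c u v
  assumes C: "coords P {a, b, c}" and u: "u \<in> polytope_vertices P" and v: "v \<in> polytope_vertices P"
    and far: "\<not> near P 6 u v"
begin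

lemma comm12: "far3 P b a c u v" and comm23: "far3 P a c b u v" and refl1: "far3 P (rf a) b c u v"
  using coords3[OF C] u v far by unfold_locales

lemma ga: "x \<in> polytope_vertices P \<Longrightarrow> a x = 0 \<or> a x = 1 \<or> a x = 2 \<or> a x = 3"
  using gridD[OF coords_grid[OF C]] by blast

lemma farD: "near P r u v \<Longrightarrow> 6 < r"
  using far near_mono[of P r u v 6] by linarith

lemma far_via: "near P r u x \<Longrightarrow> near P s x v \<Longrightarrow> 6 < r + s"
  using near_trans[of P r u x s v "r + s"] farD by blast

lemma far_via2: "near P r u x \<Longrightarrow> near P s x y \<Longrightarrow> near P t y v \<Longrightarrow> 6 < r + s + t"
  using near_trans[of P r u x s y "r + s"] far_via by blast

lemma sum_a: "a u + a v = 3"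
  using farD[OF near_down3[OF C u v]] farD[OF near_down3[OF coords3(6)[OF C] u v]] ga[OF u] ga[OF v]
  by auto

lemma ex_low: "\<exists>x \<in> polytope_vertices P. a x = 0"
proof (rule ccontr)
  assume "\<not> ?thesis"
  then have *: "1 \<le> a x" if "x \<in> polytope_vertices P" for x using that ga[OF that] by auto
  have "near P (a u + a v - 2 * 1 + 4) u v"
    by (rule near_down_min[OF C * near_dim2 u v])
  then show False using farD[of "a u + a v - 2 * 1 + 4"] sum_a by simp
qed

text \<open>Three steps lead from \<open>v\<close> to the face \<open>a = 0\<close>, so at least
  four remain inside it: that polygon is an octagon.\<close>

lemma low_face:
  assumes "a u = 0"
  shows "\<exists>p. far2 (level P a 0) b c u p"
proof -
  obtain p where p: "p \<in> polytope_vertices P" "a p = 0" "near P (a v) v p"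
    using coords_descend0[OF C u assms v] by blast
  have "near P 3 p v" using near_sym[OF p(3)] sum_a assms by simp
  then have "\<not> near P 3 u p" using far_via by force
  then show ?thesis using near_level_dim2[OF C u p(1) assms p(2)] by blast
qed

lemma low_octagon: "a u = 0 \<Longrightarrow> (b u, c u) \<in> octagon"
  using low_face far2.octagon(1) by blast

end

lemma (in far3) extreme_octagon: "a u \<in> {0, 3} \<Longrightarrow> (b u, c u) \<in> octagon"
  using low_octagon far3.low_octagon[OF refl1] by auto

lemma (in far3) edge_path:
  assumes "a u = 1" "b u = 0" "c u = 0"
  shows "\<exists>z \<in> polytope_vertices P. a z = 3 \<and> b z = 0 \<and> c z = 1 \<and> near P 2 u z"
proof -
  obtain p where f: "far2 (level P b 0) a c u p" using far3.low_face[OF comm12 assms(2)] by blast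
  obtain z where "z \<in> polytope_vertices (level P b 0)" "a z = 3" "c z = 1" "near (level P b 0) 2 u z"
    using far2.edge10(2)[OF f assms(1,3)] by blast
  then show ?thesis
    using coords_level0[OF coords3(1)[OF C]] near_face by blast
qed

text \<open>Octagons in the faces \<open>b = 0\<close> and \<open>c = 0\<close> provide (3,0,1) and
  (3,1,0) two steps from \<open>u\<close>. A vertex \<open>w\<close> of the face
  \<open>a = 3\<close> next to \<open>v\<close> would have to be opposite to both.\<close>

lemma (in far3) not_edge: "\<not> (a u = 1 \<and> b u = 0 \<and> c u = 0)"
proof
  assume *: "a u = 1 \<and> b u = 0 \<and> c u = 0"
  obtain z where z: "z \<in> polytope_vertices P" "a z = 3" "b z = 0" "c z = 1" "near P 2 u z"
    using edge_path * by blast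
  obtain y where y: "y \<in> polytope_vertices P" "a y = 3" "c y = 0" "b y = 1" "near P 2 u y"
    using far3.edge_path[OF comm23] * by blast
  note C' = coords3(6)[OF C]
  obtain w where w: "w \<in> polytope_vertices P" "rf a w = 0" "near P (rf a v) v w"
    using coords_descend0[OF C' z(1) _ v] z(2) by auto
  have w1: "near P 1 w v" using near_sym[OF w(3)] sum_a * by simp
  have "\<not> near P 3 z w" using far_via2[OF z(5) _ w1] by force
  then have "far2 (level P (rf a) 0) b c z w"
    using near_level_dim2[OF C' z(1) w(1)] z w by auto
  then have "b w = 3" using far2.sum_a z by fastforce
  have "\<not> near P 3 y w" using far_via2[OF y(5) _ w1] by force
  then have "far2 (level P (rf a) 0) b c y w"
    using near_level_dim2[OF C' y(1) w(1)] y w by auto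
  then have "b w = 2" using far2.sum_a y by fastforce
  then show False using \<open>b w = 3\<close> by simp
qed

lemma (in far3) refl2: "far3 P a (rf b) c u v" and refl3: "far3 P a b (rf c) u v"
  using coords3[OF C] u v far by unfold_locales

lemma (in far3) not_edge_any: "\<not> (a u \<in> {1, 2} \<and> b u \<in> {0, 3} \<and> c u \<in> {0, 3})"
proof -
  have 1: "\<not> (a u = 1 \<and> b u \<in> {0, 3} \<and> c u \<in> {0, 3})"
    using not_edge far3.not_edge[OF refl2] far3.not_edge[OF refl3]
      far3.not_edge[OF far3.refl3[OF refl2]] by auto
  interpret r: far3 P "rf a" b c u v by (rule refl1)
  have "\<not> (rf a u = 1 \<and> b u \<in> {0, 3} \<and> c u \<in> {0, 3})"
    using r.not_edge far3.not_edge[OF r.refl2] far3.not_edge[OF r.refl3]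
      far3.not_edge[OF far3.refl3[OF r.refl2]] by auto
  then show ?thesis using 1 by auto
qed

text \<open>One step from \<open>u\<close> and two from \<open>v\<close> reach the face
  \<open>a = 0\<close>, which must be an octagon. Its vertex \<open>w\<close> has \<open>b\<close>
  or \<open>c\<close> in {0,3}, and from there a path aimed at \<open>a\<close> together with that
  coordinate takes at most five steps.\<close>

lemma (in far3) not_center_aux:
  assumes "a u = 1" "b u \<in> {1, 2}" "c u \<in> {1, 2}"
  shows False
proof -
  obtain x where x: "x \<in> polytope_vertices P" "a x = 0" using ex_low by blast
  obtain w where w: "w \<in> polytope_vertices P" "a w = 0" "near P (a u) u w"
    using coords_descend0[OF C x u] by blast
  obtain p where p: "p \<in> polytope_vertices P" "a p = 0" "near P (a v) v p"
    using coords_descend0[OF C x v] by blast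
  have v2: "a v = 2" "b v \<in> {1, 2}" "c v \<in> {1, 2}"
    using sum_a far3.sum_a[OF comm12] far3.sum_a[OF far3.comm12[OF comm23]] assms by auto
  have uw: "near P 1 u w" using w assms by simp
  have "\<not> near P 3 w p" using far_via2[OF uw _ near_sym[OF p(3)]] v2 by force
  then have "far2 (level P a 0) b c w p" using near_level_dim2[OF C w(1) p(1) w(2) p(2)] by blast
  then have "b w \<in> {0, 3} \<or> c w \<in> {0, 3}" using octagonD far2.octagon(1) by blast
  moreover have "near P (a w + b w + a v + b v + 1) w v" "near P (a w + rf b w + a v + rf b v + 1) w v"
    "near P (a w + c w + a v + c v + 1) w v" "near P (a w + rf c w + a v + rf c v + 1) w v"
    using near_sum2_dim3[OF C w(1) v] near_sum2_dim3[OF coords3(7)[OF C] w(1) v]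
     near_sum2_dim3[OF coords3(2)[OF C] w(1) v] near_sum2_dim3[OF coords3(2)[OF coords3(8)[OF C]] w(1) v]
    by auto
  note this[THEN far_via[OF uw]]
  ultimately show False using v2 w(2) by auto
qed

text \<open>By \<open>extreme_octagon\<close> a coordinate of \<open>u\<close> in {0,3} has exactly
  one companion in {0,3}, so the number of such coordinates is 0 or 2; both are excluded.\<close>

lemma (in far3) contradiction: False
proof -
  have 1: "\<not> (a u \<in> {1, 2} \<and> b u \<in> {1, 2} \<and> c u \<in> {1, 2})"
    using not_center_aux far3.not_center_aux[OF refl1] by auto
  have g: "a u \<in> {0, 3} \<or> a u \<in> {1, 2}" "b u \<in> {0, 3} \<or> b u \<in> {1, 2}" "c u \<in> {0, 3} \<or> c u \<in> {1, 2}"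
    using gridD[OF coords_grid[OF C] u] by auto
  have "b u \<in> {0, 3} \<and> c u \<in> {1, 2} \<or> b u \<in> {1, 2} \<and> c u \<in> {0, 3}" if "a u \<in> {0, 3}"
    by (rule octagonD[OF extreme_octagon[OF that]])
  moreover have "a u \<in> {0, 3} \<and> c u \<in> {1, 2} \<or> a u \<in> {1, 2} \<and> c u \<in> {0, 3}" if "b u \<in> {0, 3}"
    by (rule octagonD[OF far3.extreme_octagon[OF comm12 that]])
  moreover have "a u \<in> {0, 3} \<and> b u \<in> {1, 2} \<or> a u \<in> {1, 2} \<and> b u \<in> {0, 3}" if "c u \<in> {0, 3}"
    by (rule octagonD[OF far3.extreme_octagon[OF far3.comm12[OF comm23] that]])
  moreover note not_edge_any far3.not_edge_any[OF comm12] far3.not_edge_any[OF far3.comm12[OF comm23]]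
  ultimately show False using g 1 by argo
qed

lemma near_dim3:
  assumes "coords P {a, b, c}" "u \<in> polytope_vertices P" "v \<in> polytope_vertices P"
  shows "near P 6 u v"
  using far3.contradiction far3.intro assms by blast

section \<open>Special positions in dimension three\<close>

text \<open>At most two steps lead from \<open>v\<close> to the face \<open>a = 0\<close>, in which
  \<open>u\<close> is a corner of the box and so never at distance four.\<close>

lemma near_corner_dim3_aux:
  assumes P: "coords P {a, b, c}" and uv: "u \<in> polytope_vertices P" "v \<in> polytope_vertices P"
    and u0: "a u = 0" "b u = 0" "c u = 0" and "a v \<noteq> 3"
  shows "near P 5 u v"
proof -
  obtain p where p: "p \<in> polytope_vertices P" "a p = 0" "near P (a v) v p"
    using coords_descend0[OF P uv(1) u0(1) uv(2)] by blast
  have "near P 3 u p"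
    using near_level_dim2[OF P uv(1) p(1) u0(1) p(2)] far2.not_corner u0 by blast
  then show ?thesis
    using near_trans[OF _ near_sym[OF p(3)], of 3 u 5] gridD[OF coords_grid[OF P] uv(2), of a] assms by auto
qed

lemma near_corner_dim3:
  assumes P: "coords P {a, b, c}" and uv: "u \<in> polytope_vertices P" "v \<in> polytope_vertices P"
    and u0: "a u = 0" "b u = 0" "c u = 0" and "\<not> (a v = 3 \<and> b v = 3 \<and> c v = 3)"
  shows "near P 5 u v"
  using near_corner_dim3_aux[OF P uv u0] near_corner_dim3_aux[OF coords3(1)[OF P] uv u0(2,1,3)]
    near_corner_dim3_aux[OF coords3(3)[OF P] uv u0(3,1,2)] assms(7) by blast

text \<open>Going through the face \<open>c = 0\<close> fails only if \<open>c v = 2\<close> and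
  that face is an octagon. It then contains a vertex with \<open>a = 3\<close>, \<open>c = 0\<close>
  two steps from \<open>u\<close>, which is not opposite to \<open>v\<close> in the face
  \<open>a = 3\<close>.\<close>

lemma near_edge_dim3_aux:
  assumes P: "coords P {a, b, c}" and uv: "u \<in> polytope_vertices P" "v \<in> polytope_vertices P"
    and u0: "a u = 1" "b u = 0" "c u = 0" and v3: "a v = 3" "c v \<in> {1, 2}"
  shows "near P 5 u v"
proof (rule ccontr)
  assume far: "\<not> ?thesis"
  note C = coords3(6)[OF P]
  note Cc = coords3(3)[OF P]
  obtain p where p: "p \<in> polytope_vertices P" "c p = 0" "near P (c v) v p"
    using coords_descend0[OF Cc uv(1) u0(3) uv(2)] by blast
  have "near P 4 u p"
    using near_level0[OF Cc uv(1) p(1) u0(3) p(2)] near_dim2[OF coords_level0(2)[OF Cc]] by blast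
  then have "c v \<noteq> 1" using near_trans[OF _ near_sym[OF p(3)], of 4 u 5] far by auto
  then have c2: "c v = 2" using v3 by simp
  then have "\<not> near P 3 u p" using near_trans[OF _ near_sym[OF p(3)], of 3 u 5] far by auto
  then have f: "far2 (level P c 0) a b u p"
    using near_level_dim2[OF Cc uv(1) p(1) u0(3) p(2)] by blast
  obtain z where "z \<in> polytope_vertices (level P c 0)" "a z = 3" "b z = 1" "near (level P c 0) 2 u z"
    using far2.edge10(2)[OF f u0(1,2)] by blast
  then have z: "z \<in> polytope_vertices P" "a z = 3" "c z = 0" "near P 2 u z"
    using coords_level0[OF Cc] near_face by blast+
  then have "\<not> near P 3 z v" using near_trans[OF z(4), of 3 v 5] far by auto
  then have "far2 (level P (rf a) 0) b c z v"
    using near_level_dim2[OF C z(1) uv(2)] z v3 by auto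
  then show False using far2.sum_b z c2 by fastforce
qed

lemma near_edge_dim3:
  assumes P: "coords P {a, b, c}" and uv: "u \<in> polytope_vertices P" "v \<in> polytope_vertices P"
    and u0: "a u = 1" "b u = 0" "c u = 0" and v3: "a v = 3"
  shows "near P 5 u v"
proof (rule ccontr)
  assume far: "\<not> ?thesis"
  note C = coords3(6)[OF P]
  obtain p where p: "p \<in> polytope_vertices P" "rf a p = 0" "near P (rf a u) u p"
    using coords_descend0[OF C uv(2) _ uv(1)] v3 by auto
  have up: "near P 2 u p" using p(3) u0 by simp
  have "\<not> near P 3 p v" using near_trans[OF up, of 3 v 5] far by auto
  then have "far2 (level P (rf a) 0) b c p v"
    using near_level_dim2[OF C p(1) uv(2)] p v3 by auto
  then have "(b v, c v) \<in> octagon" using far2.swap far2.octagon(1) by blast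
  then have "b v \<in> {1, 2} \<or> c v \<in> {1, 2}" using octagonD by blast
  then show False
    using near_edge_dim3_aux[OF P uv u0 v3] near_edge_dim3_aux[OF coords3(2)[OF P] uv u0(1,3,2) v3] far by blast
qed

text \<open>This describes \<open>v\<close> in the face \<open>d = 3\<close> when \<open>u\<close>
  has three coordinates in {1,2} and \<open>d u = 0\<close>; the assumptions \<open>step\<close> are
  inherited from the four-dimensional polytope.\<close>

locale far_center3 =
  fixes P :: "'a::euclidean_space set" and a b c v p
  assumes C: "coords P {a, b, c}" and v: "v \<in> polytope_vertices P" and p: "p \<in> polytope_vertices P"
    and inner: "a v \<in> {1, 2}" "b v \<in> {1, 2}" "c v \<in> {1, 2}"
    and step: "\<And>w. (v, w) \<in> polytope_adj P \<Longrightarrow> \<bar>a w - a v\<bar> \<le> 1"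
      "\<And>w. (v, w) \<in> polytope_adj P \<Longrightarrow> \<bar>b w - b v\<bar> \<le> 1"
      "\<And>w. (v, w) \<in> polytope_adj P \<Longrightarrow> \<bar>c w - c v\<bar> \<le> 1"
    and far: "\<not> near P 5 v p"
begin

lemma refl1: "far_center3 P (rf a) b c v p"
  using coords3(6)[OF C] v p inner step far by unfold_locales (force simp: abs_le_iff)+

lemma comm12: "far_center3 P b a c v p" and comm23: "far_center3 P a c b v p"
  using coords3[OF C] v p inner step far by unfold_locales auto

lemma ga: "x \<in> polytope_vertices P \<Longrightarrow> a x = 0 \<or> a x = 1 \<or> a x = 2 \<or> a x = 3"
  using gridD[OF coords_grid[OF C]] by blast

lemma farD: "near P r v p \<Longrightarrow> 5 < r"
  using far near_mono[of P r v p 5] by linarith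

lemma far_via: "near P r v x \<Longrightarrow> near P s x p \<Longrightarrow> 5 < r + s"
  using near_trans[of P r v x s p "r + s"] farD by blast

lemma far_via2: "near P r v x \<Longrightarrow> near P s x y \<Longrightarrow> near P t y p \<Longrightarrow> 5 < r + s + t"
  using near_trans[of P r v x s y "r + s"] far_via by blast

definition ext2 :: bool where
  "ext2 \<longleftrightarrow> a p \<in> {0, 3} \<and> b p \<in> {0, 3} \<or> a p \<in> {0, 3} \<and> c p \<in> {0, 3} \<or> b p \<in> {0, 3} \<and> c p \<in> {0, 3}"

lemma ext_aux: "a v = 1 \<Longrightarrow> a p \<in> {0, 3} \<Longrightarrow> b p \<in> {0, 3} \<or> c p \<in> {0, 3}"
proof -
  assume v1: "a v = 1" and p03: "a p \<in> {0, 3}"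
  note C' = coords3(6)[OF C]
  have "a p \<noteq> 0" using farD[OF near_down3[OF C v p]] v1 by auto
  then have p3: "a p = 3" using p03 by simp
  obtain w where w: "w \<in> polytope_vertices P" "rf a w = 0" "near P (rf a v) v w"
    using coords_descend0[OF C' p _ v] p3 by auto
  have "\<not> near P 3 w p" using far_via[OF w(3)] v1 by force
  then have "far2 (level P (rf a) 0) b c w p"
    using near_level_dim2[OF C' w(1) p] w p3 by auto
  then have "(b p, c p) \<in> octagon" using far2.swap far2.octagon(1) by blast
  then show ?thesis using octagonD by blast
qed

end

lemma (in far_center3) ext: "a p \<in> {0, 3} \<Longrightarrow> ext2"
  using ext_aux far_center3.ext_aux[OF refl1] inner(1) unfolding ext2_def by auto

lemma (in far_center3) ext2_sym:
  "far_center3.ext2 b a c p \<longleftrightarrow> ext2" "far_center3.ext2 a c b p \<longleftrightarrow> ext2"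
  "far_center3.ext2 (rf a) b c p \<longleftrightarrow> ext2"
  unfolding ext2_def far_center3.ext2_def[OF comm12] far_center3.ext2_def[OF comm23]
    far_center3.ext2_def[OF refl1] by auto

lemma (in far_center3) ext_b: "b p \<in> {0, 3} \<Longrightarrow> ext2"
  using far_center3.ext[OF comm12] ext2_sym by simp

text \<open>If \<open>b w = 0\<close>, the path through \<open>w\<close> aimed at
  \<open>a + b\<close> has length 3 + \<open>b p\<close>, which forces \<open>b p = 3\<close>; the
  case \<open>b w = 3\<close> is its reflection.\<close>

lemma (in far_center3) level_aux:
  assumes v1: "a v = 1" "a p = 1" and w: "(v, w) \<in> polytope_adj P" "a w = 0" "b w \<in> {0, 3}"
  shows ext2
proof -
  have wV: "w \<in> polytope_vertices P" using w(1) by (rule adj_vertices)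
  have bp: "b p \<in> {0, 1, 2, 3}" using gridD[OF coords_grid[OF C] p, of b] by auto
  have "near P (a w + b w + a p + b p + 1) w p" "near P (a w + rf b w + a p + rf b p + 1) w p"
    using near_sum2_dim3[OF C wV p] near_sum2_dim3[OF coords3(7)[OF C] wV p] by auto
  note this[THEN far_via[OF near_adj[OF w(1)]]]
  then have "b p \<in> {0, 3}" using w(2,3) v1 step(2)[OF w(1)] inner(2) bp by auto
  then show ?thesis by (rule ext_b)
qed

text \<open>A neighbour \<open>w\<close> of \<open>v\<close> and a vertex \<open>q\<close> one step
  from \<open>p\<close> lie in the face \<open>a = 0\<close>, at distance four, so \<open>w\<close>
  has a second coordinate in {0,3}.\<close>

lemma (in far_center3) level_same:
  assumes v1: "a v = 1" "a p = 1"
  shows ext2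
proof -
  obtain x where x: "x \<in> polytope_vertices P" "a x = 0"
  proof -
    have False if "\<And>x. x \<in> polytope_vertices P \<Longrightarrow> a x \<noteq> 0"
    proof -
      have *: "1 \<le> a x" if "x \<in> polytope_vertices P" for x
        using ga[OF that] \<open>\<And>x. x \<in> polytope_vertices P \<Longrightarrow> a x \<noteq> 0\<close>[OF that] by auto
      have "near P (a v + a p - 2 * 1 + 4) v p"
        by (rule near_down_min[OF C * near_dim2 v p])
      then show False using farD[of "a v + a p - 2 * 1 + 4"] v1 by simp
    qed
    then show ?thesis using that by blast
  qed
  then have "a x < a v" using v1 by simp
  then obtain w where w: "(v, w) \<in> polytope_adj P" "a w < a v"
    using descending_neighbor[OF coords_polytope[OF C] v _ vertex_in[OF x(1)]]
      grid_affine[OF coords_grid[OF C]] by blast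
  have wV: "w \<in> polytope_vertices P" using w(1) by (rule adj_vertices)
  have w0: "a w = 0" using ga[OF wV] w v1 by auto
  obtain q where q: "q \<in> polytope_vertices P" "a q = 0" "near P (a p) p q"
    using coords_descend0[OF C x p] by blast
  have "\<not> near P 3 w q" using far_via2[OF near_adj[OF w(1)] _ near_sym[OF q(3)]] v1 by force
  then have "far2 (level P a 0) b c w q" using near_level_dim2[OF C wV q(1) w0 q(2)] by blast
  then have "(b w, c w) \<in> octagon" by (rule far2.octagon(1))
  then have "b w \<in> {0, 3} \<or> c w \<in> {0, 3}" using octagonD by blast
  then show ?thesis
    using level_aux[OF v1 w(1) w0] far_center3.level_aux[OF comm23 v1 w(1) w0] ext2_sym by blast
qed

lemma (in far_center3) ext2_or_sum_a: "ext2 \<or> a v + a p = 3"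
proof -
  have 1: "a v = 1 \<Longrightarrow> ext2 \<or> a p = 2"
    using ext level_same ga[OF p] by auto
  interpret r: far_center3 P "rf a" b c v p by (rule refl1)
  have "rf a v = 1 \<Longrightarrow> ext2 \<or> rf a p = 2"
    using r.ext r.level_same ga[OF p] ext2_sym(3) by auto
  then show ?thesis using 1 inner(1) by auto
qed

lemma (in far_center3) antipodal_or_ext2:
  "ext2 \<or> (a v + a p = 3 \<and> b v + b p = 3 \<and> c v + c p = 3)"
  using ext2_or_sum_a far_center3.ext2_or_sum_a[OF comm12]
    far_center3.ext2_or_sum_a[OF far_center3.comm12[OF comm23]] ext2_sym
    far_center3.ext2_sym[OF comm23] by blast

section \<open>Distance bounds in dimension four\<close>

lemma coords4:
  assumes "coords P {a, b, c, d}"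
  shows "coords P {b, a, c, d}" "coords P {a, c, b, d}" "coords P {a, b, d, c}"
    "coords P {rf a, b, c, d}" "coords P {a, rf b, c, d}" "coords P {a, b, rf c, d}" "coords P {a, b, c, rf d}"
    "coords P {c, d, a, b}" "coords P {d, a, b, c}" "coords P {c, a, b, d}"
  using assms coords_rf[of P a "{b, c, d}"] coords_rf[of P b "{a, c, d}"] coords_rf[of P c "{a, b, d}"]
    coords_rf[of P d "{a, b, c}"]
  by (simp_all add: insert_commute)

lemma near_down4:
  "coords P {a, b, c, d} \<Longrightarrow> u \<in> polytope_vertices P \<Longrightarrow> v \<in> polytope_vertices P \<Longrightarrow> near P (a u + a v + 6) u v"
  by (rule near_down[OF _ near_dim3])

lemma near_range2:
  assumes "coords F {a, b, d}" and n: "\<And>x. x \<in> polytope_vertices F \<Longrightarrow> a x \<le> n \<and> b x \<le> n"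
    and pq: "p \<in> polytope_vertices F" "q \<in> polytope_vertices F"
  shows "near F (2 * n + 1) p q"
proof -
  have nonneg: "0 \<le> a x" "0 \<le> b x" if "x \<in> polytope_vertices F" for x
    using grid_nonneg[OF coords_grid[OF assms(1)] that] by auto
  have "near F (n - 0 + (n - 0 + 1)) p q"
  proof (rule near_range_face[OF assms(1) _ _ _ pq])
    fix G x y
    assume G: "G face_of F" "coords G {b, d}" "x \<in> polytope_vertices G" "y \<in> polytope_vertices G"
    show "near G (n - 0 + 1) x y"
      by (rule near_range[OF G(2) _ _ near_dim1 G(3,4)])
        (use nonneg n vertices_of_face[OF G(1)] in auto)
  qed (use nonneg n in auto)
  then show ?thesis by simp
qed

text \<open>The face at the minimum \<open>l\<close> of \<open>a + b + c\<close> has coordinates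
  \<open>a\<close>, \<open>b\<close>, \<open>d\<close> with the first two at most \<open>l\<close>;
  crossing it takes \<open>2 * l + 1\<close> steps, and the descents save
  \<open>2 * l\<close>.\<close>

lemma near_sum3_dim4:
  assumes P: "coords P {a, b, c, d}" and uv: "u \<in> polytope_vertices P" "v \<in> polytope_vertices P"
  shows "near P (a u + b u + c u + a v + b v + c v + 1) u v"
proof -
  define f where "f = (\<lambda>x. a x + b x + c x)"
  have g: "grid P a" "grid P b" "grid P c" using P by (auto simp: coords_def)
  have f: "affine_fun f" unfolding f_def by (intro affine_fun_add g[THEN grid_affine])
  have fZ: "f x \<in> \<int>" if "x \<in> polytope_vertices P" for x
    using g that by (simp add: f_def grid_Ints)
  obtain z where z: "z \<in> polytope_vertices P" "\<And>x. x \<in> polytope_vertices P \<Longrightarrow> f z \<le> f x"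
    using min_vertex[OF coords_polytope[OF P] uv(1), of f] by blast
  let ?F = "level P f (f z)"
  have F: "?F face_of P" by (rule level_face[OF coords_polytope[OF P] f z(2)])
  have C: "coords ?F {c, a, b, d}" by (rule coords_face[OF coords4(10)[OF P] F])
  have C': "coords ?F {a, b, d}"
    by (rule coords_dep[OF C]) (auto simp: level_def f_def)
  have "near P (f u + f v - 2 * f z + (2 * f z + 1)) u v"
  proof (rule near_via_level[OF coords_polytope[OF P] f fZ z(2,1) refl _ uv])
    fix p q assume pq: "p \<in> polytope_vertices ?F" "q \<in> polytope_vertices ?F"
    show "near ?F (2 * f z + 1) p q"
    proof (rule near_range2[OF C' _ pq])
      fix x assume x: "x \<in> polytope_vertices ?F"
      then have "x \<in> polytope_vertices P" "f x = f z"
        using vertices_of_face[OF F] vertex_in[OF x] by (auto simp: level_def)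
      then show "a x \<le> f z \<and> b x \<le> f z"
        using grid_nonneg[OF g(1)] grid_nonneg[OF g(2)] grid_nonneg[OF g(3)] unfolding f_def by force
    qed
  qed
  then show ?thesis by (simp add: f_def algebra_simps)
qed

lemma near_sum2_dim4:
  assumes P: "coords P {a, b, c, d}" and uv: "u \<in> polytope_vertices P" "v \<in> polytope_vertices P"
  shows "near P (a u + b u + a v + b v + 4) u v"
proof -
  have "near P (a u + b u + a v + b v - 2 * 0 + 4) u v"
  proof (rule near_via_sum[OF P _ _ uv])
    show "0 \<le> a x + b x" if "x \<in> polytope_vertices P" for x
      using that grid_nonneg[OF coords_grid[OF P]] by simp
    fix F p q l
    assume F: "coords F {a, c, d}" "(0::real) \<le> l" "\<And>x. x \<in> polytope_vertices F \<Longrightarrow> a x \<le> l"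
      "p \<in> polytope_vertices F" "q \<in> polytope_vertices F"
    have "near F (l - 0 + 4) p q"
      using grid_nonneg[OF coords_grid[OF F(1)]] by (intro near_range[OF F(1) _ F(3) near_dim2 F(4,5)]) auto
    then show "near F (2 * l - 2 * 0 + 4) p q" by (rule near_mono) (use F(2) in simp)
  qed
  then show ?thesis by simp
qed

text \<open>If the values of \<open>a + b\<close> at both ends add up to s, the path through its
  minimal level \<open>l\<close> has length s - 2l + (l + 4). Without a vertex at
  \<open>a = b = 0\<close> one has \<open>l\<close> at least 1.\<close>

lemma near_sum2_no_corner:
  assumes P: "coords P {a, b, c, d}" and uv: "u \<in> polytope_vertices P" "v \<in> polytope_vertices P"
    and no: "\<And>x. x \<in> polytope_vertices P \<Longrightarrow> \<not> (a x = 0 \<and> b x = 0)"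
  shows "near P (a u + b u + a v + b v + 3) u v"
proof -
  have "near P (a u + b u + a v + b v - 2 * 1 + 5) u v"
  proof (rule near_via_sum[OF P _ _ uv])
    show "1 \<le> a x + b x" if "x \<in> polytope_vertices P" for x
      using no[OF that] gridD[OF coords_grid[OF P] that, of a] gridD[OF coords_grid[OF P] that, of b] by auto
    fix F p q l
    assume F: "coords F {a, c, d}" "(1::real) \<le> l" "\<And>x. x \<in> polytope_vertices F \<Longrightarrow> a x \<le> l"
      "p \<in> polytope_vertices F" "q \<in> polytope_vertices F"
    have "near F (l - 0 + 4) p q"
      using grid_nonneg[OF coords_grid[OF F(1)]] by (intro near_range[OF F(1) _ F(3) near_dim2 F(4,5)]) auto
    then show "near F (2 * l - 2 * 1 + 5) p q" by (rule near_mono) (use F(2) in simp)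
  qed
  then show ?thesis by (simp add: algebra_simps)
qed

text \<open>Since both coordinates are nonnegative, \<open>a + b = 0\<close> exposes the face
  \<open>a = b = 0\<close> at once, and descending the sum reaches it.\<close>

lemma corner_face:
  assumes P: "coords P {a, b, c, d}" and x: "x \<in> polytope_vertices P" "a x = 0" "b x = 0"
  obtains F where "F face_of P" "coords F {c, d}"
    "\<And>y. y \<in> polytope_vertices F \<longleftrightarrow> y \<in> polytope_vertices P \<and> a y = 0 \<and> b y = 0"
    "\<And>y. y \<in> polytope_vertices P \<Longrightarrow> \<exists>z \<in> polytope_vertices F. near P (a y + b y) y z"
proof -
  define f where "f = (\<lambda>x. a x + b x)"
  have g: "grid P a" "grid P b" using P by (auto simp: coords_def)
  have f: "affine_fun f" unfolding f_def by (intro affine_fun_add g[THEN grid_affine])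
  have fZ: "f x \<in> \<int>" if "x \<in> polytope_vertices P" for x
    using g that by (simp add: f_def grid_Ints)
  have f0: "0 \<le> f x" if "x \<in> polytope_vertices P" for x
    using g that by (simp add: f_def grid_nonneg)
  let ?F = "level P f 0"
  have F: "?F face_of P" by (rule level_face[OF coords_polytope[OF P] f f0])
  have ab: "a y = 0 \<and> b y = 0" if "y \<in> ?F" for y
  proof -
    have "0 \<le> a y" "0 \<le> b y"
      using affine_fun_ge_on_polytope[OF coords_polytope[OF P] grid_affine[OF g(1)] grid_nonneg[OF g(1)]]
        affine_fun_ge_on_polytope[OF coords_polytope[OF P] grid_affine[OF g(2)] grid_nonneg[OF g(2)]]
        that by (auto simp: level_def)
    then show ?thesis using that by (simp add: level_def f_def)
  qed
  have "coords ?F {b, c, d}"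
    by (rule coords_dep[OF coords_face[OF P F]]) (simp add: ab)
  then have C: "coords ?F {c, d}"
    by (rule coords_dep) (simp add: ab)
  have V: "y \<in> polytope_vertices ?F \<longleftrightarrow> y \<in> polytope_vertices P \<and> a y = 0 \<and> b y = 0" for y
  proof
    assume "y \<in> polytope_vertices ?F"
    then have "y \<in> polytope_vertices P" "y \<in> ?F" using vertices_of_face[OF F] by blast+
    then show "y \<in> polytope_vertices P \<and> a y = 0 \<and> b y = 0" using ab by blast
  next
    assume y: "y \<in> polytope_vertices P \<and> a y = 0 \<and> b y = 0"
    then have "y \<in> ?F" using vertex_in[of y P] by (simp add: level_def f_def)
    then show "y \<in> polytope_vertices ?F" using vertices_of_face[OF F] y by blast
  qed
  have "\<exists>z \<in> polytope_vertices ?F. near P (a y + b y) y z" if y: "y \<in> polytope_vertices P" for y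
  proof -
    obtain z where z: "z \<in> polytope_vertices P" "f z = 0" "near P (f y - 0) y z"
      using descend_to_min[OF coords_polytope[OF P] f fZ f0 x(1) _ y] x by (auto simp: f_def)
    then have "z \<in> ?F" using vertex_in[of z P] by (simp add: level_def)
    then have "z \<in> polytope_vertices ?F" using vertices_of_face[OF F] z(1) by blast
    then show ?thesis using z(3) by (auto simp: f_def)
  qed
  then show thesis by (rule that[OF F C V])
qed

lemma near_level_dim3:
  assumes P: "coords P {a, b, c, d}" and uv: "u \<in> polytope_vertices P" "v \<in> polytope_vertices P" "a u = 0" "a v = 0"
  shows "near P 6 u v"
  using near_level0[OF P uv] near_dim3[OF coords_level0(2)[OF P]] by blast

lemma near_line3:
  assumes P: "coords P {a, b, c}" and uv: "u \<in> polytope_vertices P" "v \<in> polytope_vertices P"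
    and eq: "a u = 0" "b u = 0" "a v = 0" "b v = 0"
  shows "near P 1 u v"
proof (rule near_level0[OF P uv eq(1,3)])
  assume V: "u \<in> polytope_vertices (level P a 0)" "v \<in> polytope_vertices (level P a 0)"
  show "near (level P a 0) 1 u v"
    by (rule near_line2[OF coords2(1)[OF coords_level0(2)[OF P]] V]) (simp_all add: eq)
qed

lemma near_line4:
  assumes P: "coords P {a, b, c, d}" and uv: "u \<in> polytope_vertices P" "v \<in> polytope_vertices P"
    and eq: "b u = 0" "c u = 0" "d u = 0" "b v = 0" "c v = 0" "d v = 0"
  shows "near P 1 u v"
proof (rule near_level0[OF coords4(1)[OF P] uv eq(1,4)])
  assume V: "u \<in> polytope_vertices (level P b 0)" "v \<in> polytope_vertices (level P b 0)"
  show "near (level P b 0) 1 u v"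
    by (rule near_line3[OF coords3(5)[OF coords_level0(2)[OF coords4(1)[OF P]]] V]) (simp_all add: eq)
qed

section \<open>Dimension four\<close>

locale far4 =
  fixes P :: "'a::euclidean_space set" and a b c d u v
  assumes C: "coords P {a, b, c, d}" and u: "u \<in> polytope_vertices P" and v: "v \<in> polytope_vertices P"
    and far: "\<not> near P 8 u v"
begin

lemma comm12: "far4 P b a c d u v" and comm23: "far4 P a c b d u v" and comm34: "far4 P a b d c u v"
  and refl1: "far4 P (rf a) b c d u v" and refl2: "far4 P a (rf b) c d u v"
  and refl3: "far4 P a b (rf c) d u v" and refl4: "far4 P a b c (rf d) u v"
  and perm: "far4 P c d a b u v"
  using coords4[OF C] u v far by unfold_locales

lemma swap: "far4 P a b c d v u"
  using C u v far near_sym[of P 8 v u] by unfold_locales blast+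

lemma ga: "x \<in> polytope_vertices P \<Longrightarrow> a x = 0 \<or> a x = 1 \<or> a x = 2 \<or> a x = 3"
  using gridD[OF coords_grid[OF C]] by blast

lemma farD: "near P r u v \<Longrightarrow> 8 < r"
  using far near_mono[of P r u v 8] by linarith

lemma far_via: "near P r u x \<Longrightarrow> near P s x v \<Longrightarrow> 8 < r + s"
  using near_trans[of P r u x s v "r + s"] farD by blast

lemma far_via2: "near P r u x \<Longrightarrow> near P s x y \<Longrightarrow> near P t y v \<Longrightarrow> 8 < r + s + t"
  using near_trans[of P r u x s y "r + s"] far_via by blast

lemma far_via3: "near P r u x \<Longrightarrow> near P s x y \<Longrightarrow> near P t y z \<Longrightarrow> near P q z v \<Longrightarrow> 8 < r + s + t + q"
  using near_trans[of P r u x s y "r + s"] far_via2 by blast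

lemma sum_a: "a u + a v = 3"
  using farD[OF near_down4[OF C u v]] farD[OF near_down4[OF coords4(4)[OF C] u v]] ga[OF u] ga[OF v]
  by auto

lemma ex_low: "\<exists>x \<in> polytope_vertices P. a x = 0"
proof (rule ccontr)
  assume "\<not> ?thesis"
  then have *: "1 \<le> a x" if "x \<in> polytope_vertices P" for x using that ga[OF that] by auto
  have "near P (a u + a v - 2 * 1 + 6) u v"
    by (rule near_down_min[OF C * near_dim3 u v])
  then show False using farD[of "a u + a v - 2 * 1 + 6"] sum_a by simp
qed

lemma step_low: "(u, w) \<in> polytope_adj P \<Longrightarrow> a u - 1 \<le> a w"
  using far_via[OF near_adj near_down4[OF C _ v], of w] ga[OF u] ga[of w] adj_vertices(2)[of u w P] sum_a
  by (smt (verit))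

end

context far4
begin

lemma sum_b: "b u + b v = 3"
  by (rule far4.sum_a[OF comm12])

lemma sum_c: "c u + c v = 3"
  by (rule far4.sum_a[OF perm])

lemma sum_d: "d u + d v = 3"
  by (rule far4.sum_b[OF perm])

lemma gb: "x \<in> polytope_vertices P \<Longrightarrow> b x = 0 \<or> b x = 1 \<or> b x = 2 \<or> b x = 3"
  by (rule far4.ga[OF comm12])

lemma gc: "x \<in> polytope_vertices P \<Longrightarrow> c x = 0 \<or> c x = 1 \<or> c x = 2 \<or> c x = 3"
  by (rule far4.ga[OF perm])

lemma gd: "x \<in> polytope_vertices P \<Longrightarrow> d x = 0 \<or> d x = 1 \<or> d x = 2 \<or> d x = 3"
  by (rule far4.gb[OF perm])

lemma step_a: "(u, w) \<in> polytope_adj P \<Longrightarrow> \<bar>a w - a u\<bar> \<le> 1"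
  using step_low far4.step_low[OF refl1, of w] by force

lemma step_b: "(u, w) \<in> polytope_adj P \<Longrightarrow> \<bar>b w - b u\<bar> \<le> 1"
  by (rule far4.step_a[OF comm12])

lemma step_c: "(u, w) \<in> polytope_adj P \<Longrightarrow> \<bar>c w - c u\<bar> \<le> 1"
  by (rule far4.step_a[OF perm])

lemma neighbor_low:
  assumes "0 < a u"
  shows "\<exists>w. (u, w) \<in> polytope_adj P \<and> a w = a u - 1"
proof -
  obtain x where x: "x \<in> polytope_vertices P" "a x = 0" using ex_low by blast
  then have "a x < a u" using assms by simp
  then obtain w where w: "(u, w) \<in> polytope_adj P" "a w < a u"
    using descending_neighbor[OF coords_polytope[OF C] u _ vertex_in[OF x(1)]]
      grid_affine[OF coords_grid[OF C]] by blast
  then have "a w = a u - 1"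
    using step_a[OF w(1)] ga[OF u] ga[OF adj_vertices(2)[OF w(1)]] by auto
  then show ?thesis using w by blast
qed

lemma neighbor_high:
  assumes "a u < 3"
  shows "\<exists>w. (u, w) \<in> polytope_adj P \<and> a w = a u + 1"
  using far4.neighbor_low[OF refl1] assms by force

lemma low_step_eq: "(u, w) \<in> polytope_adj P \<Longrightarrow> a w < a u \<Longrightarrow> a w = a u - 1"
  using step_a[of w] ga[OF u] ga[of w] adj_vertices(2)[of u w P] by force

text \<open>Such an edge followed by a path aimed at \<open>a + b + c\<close> has total length 1 +
  (9 - 3) + 1 = 8.\<close>

lemma not_triple:
  assumes w: "(u, w) \<in> polytope_adj P" "a w < a u" "b w < b u" "c w < c u"
  shows False
proof -
  have "a w \<le> a u - 1" "b w \<le> b u - 1" "c w \<le> c u - 1"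
    using low_step_eq[OF w(1,2)] far4.low_step_eq[OF comm12 w(1,3)] far4.low_step_eq[OF perm w(1,4)] by auto
  then show False
    using far_via[OF near_adj[OF w(1)] near_sum3_dim4[OF C adj_vertices(2)[OF w(1)] v]] sum_a sum_b sum_c
    by linarith
qed

end

text \<open>Reflecting coordinates turns every change into a decrease, so \<open>not_triple\<close>
  forbids three changes.\<close>

lemma (in far4) two_changes_c:
  assumes w: "(u, w) \<in> polytope_adj P" "a w \<noteq> a u" "b w \<noteq> b u"
  shows "c w = c u"
proof (rule ccontr)
  assume c: "c w \<noteq> c u"
  have 1: False if "far4 P f g c d u v" "f w < f u" "g w < g u" for f g
    using far4.not_triple[OF that(1) w(1)] far4.not_triple[OF far4.refl3[OF that(1)] w(1)] c that(2,3)
    by fastforce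
  have 2: False if "far4 P f b c d u v" "f w < f u" for f
    using 1[OF that] 1[OF far4.refl2[OF that(1)] that(2)] w(3) by fastforce
  show False
    using 2[OF far4.intro[OF C u v far]] 2[OF refl1] w(2) by fastforce
qed

lemma (in far4) two_changes:
  assumes w: "(u, w) \<in> polytope_adj P" "a w \<noteq> a u" "b w \<noteq> b u"
  shows "c w = c u" "d w = d u"
  using two_changes_c[OF w] far4.two_changes_c[OF comm34 w] by auto

text \<open>An edge at \<open>u\<close> that lowers two coordinates at once saves a step on the way to the two-dimensional face
  where both vanish. That face must then be the octagon, and a point reached in it may not have gained
  anything in the other two coordinates.\<close>

lemma (in far4) double_corner_aux:
  assumes p: "p \<in> polytope_vertices P" "a p = 0" "b p = 0" "near P (a u + b u - 1) u p" and c0: "c p = 0"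
  shows "c u = 0"
proof (rule ccontr)
  assume "c u \<noteq> 0"
  then have "c v \<le> 2" using sum_c gc[OF u] by auto
  then show False
    using far_via[OF p(4) near_sum3_dim4[OF C p(1) v]] p(2,3) c0 sum_a sum_b by simp
qed

context far4
begin

text \<open>Otherwise \<open>near_sum2_no_corner\<close> after the edge to \<open>w\<close> gives 1
  + (6 - 2) + 3 = 8.\<close>

lemma double_exists_corner:
  assumes w: "(u, w) \<in> polytope_adj P" "a w < a u" "b w < b u"
  shows "\<exists>x \<in> polytope_vertices P. a x = 0 \<and> b x = 0"
proof (rule ccontr)
  assume "\<not> ?thesis"
  then have "near P (a w + b w + a v + b v + 3) w v"
    using near_sum2_no_corner[OF C adj_vertices(2)[OF w(1)] v] by blast
  then show False
    using far_via[OF near_adj[OF w(1)]] low_step_eq[OF w(1,2)] far4.low_step_eq[OF comm12 w(1,3)] sum_a sum_b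
    by fastforce
qed

lemma double_corner:
  assumes w: "(u, w) \<in> polytope_adj P" "a w < a u" "b w < b u"
    and p: "p \<in> polytope_vertices P" "a p = 0" "b p = 0" "near P (a u + b u - 1) u p"
  shows "(c p, d p) \<in> octagon"
    and "c p \<in> {0, 3} \<Longrightarrow> c u = c p"
    and "d p \<in> {0, 3} \<Longrightarrow> d u = d p"
    and "(i, j) \<in> octagon \<Longrightarrow> \<exists>x \<in> polytope_vertices P. a x = 0 \<and> b x = 0 \<and> c x = i \<and> d x = j"
proof -
  obtain F where F: "F face_of P" "coords F {c, d}"
    "\<And>y. y \<in> polytope_vertices F \<longleftrightarrow> y \<in> polytope_vertices P \<and> a y = 0 \<and> b y = 0"
    "\<And>y. y \<in> polytope_vertices P \<Longrightarrow> \<exists>z \<in> polytope_vertices F. near P (a y + b y) y z"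
    using corner_face[OF C p(1-3)] by metis
  obtain q where q: "q \<in> polytope_vertices F" "near P (a v + b v) v q"
    using F(4)[OF v] by blast
  have pF: "p \<in> polytope_vertices F" using F(3) p by blast
  \<comment> \<open>Reaching \<open>F\<close> from both ends takes 6 - 1 = 5 steps altogether, so
    more than 3 are needed inside it.\<close>
  have "\<not> near F 3 p q"
    using far_via2[OF p(4) near_face[OF F(1)] near_sym[OF q(2)]] sum_a sum_b by force
  then have f: "far2 F c d p q" by (rule far2.intro[OF F(2) pF q(1)])
  show "(c p, d p) \<in> octagon" by (rule far2.octagon(1)[OF f])
  show "\<exists>x \<in> polytope_vertices P. a x = 0 \<and> b x = 0 \<and> c x = i \<and> d x = j" if "(i, j) \<in> octagon"
    using far2.octagon(2)[OF f] that F(3) unfolding far2.full_def[OF f] by fastforce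
  show "c u = c p" if "c p \<in> {0, 3}"
    using double_corner_aux[OF p] far4.double_corner_aux[OF refl3 p] that by auto
  show "d u = d p" if "d p \<in> {0, 3}"
    using far4.double_corner_aux[OF comm34 p] far4.double_corner_aux[OF far4.refl3[OF comm34] p] that by auto
qed

lemma double_reach_corner:
  assumes w: "(u, w) \<in> polytope_adj P" "a w < a u" "b w < b u"
  shows "\<exists>p \<in> polytope_vertices P. a p = 0 \<and> b p = 0 \<and> near P (a u + b u - 1) u p"
proof -
  obtain x where x: "x \<in> polytope_vertices P" "a x = 0" "b x = 0" using double_exists_corner[OF w] by blast
  obtain F where F: "F face_of P" "coords F {c, d}"
    "\<And>y. y \<in> polytope_vertices F \<longleftrightarrow> y \<in> polytope_vertices P \<and> a y = 0 \<and> b y = 0"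
    "\<And>y. y \<in> polytope_vertices P \<Longrightarrow> \<exists>z \<in> polytope_vertices F. near P (a y + b y) y z"
    using corner_face[OF C x] by metis
  obtain p where p: "p \<in> polytope_vertices F" "near P (a w + b w) w p"
    using F(4)[OF adj_vertices(2)[OF w(1)]] by blast
  have "near P (a u + b u - 1) u p"
    by (rule near_trans[OF near_adj[OF w(1)] p(2)])
      (use low_step_eq[OF w(1,2)] far4.low_step_eq[OF comm12 w(1,3)] in simp)
  then show ?thesis using p(1) F(3) by blast
qed

text \<open>The octagon vertex reached by \<open>double_reach_corner\<close> has a coordinate in
  {0,3}, which by \<open>double_corner\<close> it shares with \<open>u\<close>.\<close>

lemma double_not_inner:
  assumes w: "(u, w) \<in> polytope_adj P" "a w < a u" "b w < b u" and "c u \<in> {1, 2}" "d u \<in> {1, 2}"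
  shows False
proof -
  obtain p where p: "p \<in> polytope_vertices P" "a p = 0" "b p = 0" "near P (a u + b u - 1) u p"
    using double_reach_corner[OF w] by blast
  then show False
    using octagonD[OF double_corner(1)[OF w p]] double_corner(2,3)[OF w p] assms(4,5) by auto
qed

lemma double_octagon:
  assumes w: "(u, w) \<in> polytope_adj P" "a w < a u" "b w < b u" and "(i, j) \<in> octagon"
  shows "\<exists>x \<in> polytope_vertices P. a x = 0 \<and> b x = 0 \<and> c x = i \<and> d x = j"
  using double_reach_corner[OF w] double_corner(4)[OF w] assms(4) by blast

text \<open>Between \<open>w\<close> and \<open>z\<close> a path aimed at \<open>a + b\<close> takes
  (6 - 4) + 4 steps, and the two edges add 2.\<close>

lemma double_double:
  assumes w: "(u, w) \<in> polytope_adj P" "a w < a u" "b w < b u"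
    and z: "(v, z) \<in> polytope_adj P" "a z < a v" "b z < b v"
  shows False
proof -
  have 1: "a w = a u - 1" "b w = b u - 1"
    using low_step_eq[OF w(1,2)] far4.low_step_eq[OF comm12 w(1,3)] by auto
  have 2: "a z = a v - 1" "b z = b v - 1"
    using far4.low_step_eq[OF swap z(1,2)] far4.low_step_eq[OF far4.comm12[OF swap] z(1,3)] by auto
  show False
    using far_via2[OF near_adj[OF w(1)] near_sum2_dim4[OF C adj_vertices(2)[OF w(1)] adj_vertices(2)[OF z(1)]]
        near_sym[OF near_adj[OF z(1)]]] 1 2 sum_a sum_b by linarith
qed

text \<open>By \<open>two_changes\<close> each edge leaves the third coordinate alone, so
  \<open>a + b + c\<close> loses 4 in all: 1 + (9 - 4) + 1 + 1 = 8.\<close>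

lemma double_double_third:
  assumes w: "(u, w) \<in> polytope_adj P" "a w < a u" "b w < b u"
    and z: "(v, z) \<in> polytope_adj P" "a z < a v" "c z < c v"
  shows False
proof -
  have 1: "a w = a u - 1" "b w = b u - 1" "c w = c u"
    using low_step_eq[OF w(1,2)] far4.low_step_eq[OF comm12 w(1,3)] two_changes(1)[OF w(1)] w by auto
  have 2: "a z = a v - 1" "c z = c v - 1" "b z = b v"
    using far4.low_step_eq[OF swap z(1,2)] far4.low_step_eq[OF far4.perm[OF swap] z(1,3)]
      far4.two_changes(1)[OF far4.comm23[OF swap] z(1)] z by auto
  show False
    using far_via2[OF near_adj[OF w(1)] near_sum3_dim4[OF C adj_vertices(2)[OF w(1)] adj_vertices(2)[OF z(1)]]
        near_sym[OF near_adj[OF z(1)]]] 1 2 sum_a sum_b sum_c by linarith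
qed

section \<open>Four, zero or three coordinates of \<open>u\<close> in {1,2}\<close>

text \<open>By \<open>double_not_inner\<close> every edge at \<open>u\<close> is parallel to an
  axis, so \<open>u\<close> would be the midpoint of its neighbours in the two directions of
  \<open>a\<close>.\<close>

lemma no_inner4:
  assumes "a u \<in> {1, 2}" "b u \<in> {1, 2}" "c u \<in> {1, 2}" "d u \<in> {1, 2}"
  shows False
proof -
  obtain w where w: "(u, w) \<in> polytope_adj P" "a w = a u - 1" using neighbor_low assms(1) by auto
  obtain x where x: "(u, x) \<in> polytope_adj P" "a x = a u + 1" using neighbor_high assms(1) by auto
  have bw: "b w = b u" if "far4 P f b c d u v" "c u \<in> {1, 2}" "d u \<in> {1, 2}" "(u, w) \<in> polytope_adj P" "f w < f u"
    for f b c d w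
    using far4.double_not_inner[OF that(1) that(4,5)] far4.double_not_inner[OF far4.refl2[OF that(1)] that(4,5)]
      that(2,3) by fastforce
  have all: "b w = b u \<and> c w = c u \<and> d w = d u"
    if f: "far4 P f b c d u v" "(u, w) \<in> polytope_adj P" "f w < f u" for f w
    using bw[OF f(1) _ _ f(2,3)] bw[OF far4.comm23[OF f(1)] _ _ f(2,3)]
      bw[OF far4.comm23[OF far4.comm34[OF f(1)]] _ _ f(2,3)] assms by blast
  have "b w = b u \<and> c w = c u \<and> d w = d u" using all[OF far4.intro[OF C u v far] w(1)] w(2) by simp
  moreover have "b x = b u \<and> c x = c u \<and> d x = d u" using all[OF refl1 x(1)] x(2) by simp
  moreover have "a u = (1 - 1 / 2) * a w + 1 / 2 * a x" using w x by (simp add: field_simps)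
  ultimately have "w = x"
    using vertex_between[OF C u vertex_in[OF adj_vertices(2)[OF w(1)]] vertex_in[OF adj_vertices(2)[OF x(1)]], of "1/2"]
    by simp
  then show False using w x by simp
qed

text \<open>Three steps lead to a vertex \<open>p\<close> of the face \<open>a = 3\<close>, in which
  \<open>v\<close> is a corner of the box: 3 + 5 unless \<open>p\<close> is the opposite corner
  (3,0,0,0). That corner is one edge away from \<open>u\<close>: 1 + 6.\<close>

lemma no_corner:
  assumes u0: "a u = 0" "b u = 0" "c u = 0" "d u = 0"
  shows False
proof -
  have v3: "a v = 3" "b v = 3" "c v = 3" "d v = 3" using sum_a sum_b sum_c sum_d u0 by auto
  note C1 = coords4(4)[OF C]
  obtain p where p: "p \<in> polytope_vertices P" "rf a p = 0" "near P (rf a u) u p"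
    using coords_descend0[OF C1 v _ u] v3 by auto
  note G = coords_level0[OF C1]
  have pG: "p \<in> polytope_vertices (level P (rf a) 0)" "v \<in> polytope_vertices (level P (rf a) 0)"
    using G(3) p v v3 by auto
  have CG: "coords (level P (rf a) 0) {rf b, rf c, rf d}"
    using coords3(6)[OF coords3(7)[OF coords3(8)[OF G(2)]]] .
  show False
  proof (cases "b p = 0 \<and> c p = 0 \<and> d p = 0")
    case True
    have "near P 1 u p" by (rule near_line4[OF C u p(1)]) (use True u0 in auto)
    moreover have "near P 6 p v" by (rule near_level_dim3[OF C1 p(1) v p(2)]) (use v3 in simp)
    ultimately show False using far_via by fastforce
  next
    case False
    have "near (level P (rf a) 0) 5 v p"
      by (rule near_corner_dim3[OF CG pG(2,1)]) (use False v3 in auto)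
    then have "near P 5 p v" using near_face[OF G(1)] near_sym by blast
    then show False using far_via[OF p(3)] u0 by fastforce
  qed
qed

lemma inner3_neighbor:
  assumes "b u \<in> {1, 2}" "c u \<in> {1, 2}" and w: "(u, w) \<in> polytope_adj P" "d w \<noteq> d u"
  shows "a w = a u"
proof (rule ccontr)
  assume aw: "a w \<noteq> a u"
  have 1: "far4 P d a b c u v" using far4.comm12[OF far4.comm23[OF comm34]] .
  have 2: False if "far4 P f g b c u v" "f w < f u" "g w < g u" for f g
    using far4.double_not_inner[OF that(1) w(1) that(2,3) assms(1,2)] .
  have 3: False if "far4 P f a b c u v" "f w < f u" for f
    using 2[OF that] 2[OF far4.refl2[OF that(1)] that(2)] aw by fastforce
  show False using 3[OF 1] 3[OF far4.refl1[OF 1]] w(2) by fastforce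
qed

text \<open>The neighbour \<open>w\<close> above \<open>u\<close> differs only in \<open>d\<close>,
  and \<open>p\<close> in the face \<open>d = 3\<close> must be at distance six from
  \<open>v\<close>. If \<open>p\<close> is antipodal to \<open>v\<close> there, it lies straight
  above \<open>u\<close> and \<open>w\<close> is between them; otherwise it has two coordinates in
  {0,3}.\<close>

lemma no_inner3:
  assumes inner: "a u \<in> {1, 2}" "b u \<in> {1, 2}" "c u \<in> {1, 2}" and d0: "d u = 0"
  shows False
proof -
  have vi: "a v \<in> {1, 2}" "b v \<in> {1, 2}" "c v \<in> {1, 2}" "d v = 3"
    using sum_a sum_b sum_c sum_d inner d0 by auto
  have f4: "far4 P d a b c u v" using far4.comm12[OF far4.comm23[OF comm34]] .
  obtain w where w: "(u, w) \<in> polytope_adj P" "d w = 1"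
    using far4.neighbor_high[OF f4] d0 by auto
  have wV: "w \<in> polytope_vertices P" using w(1) by (rule adj_vertices)
  have dw: "d w \<noteq> d u" using w d0 by simp
  have w': "a w = a u" "b w = b u" "c w = c u"
    using inner3_neighbor[OF inner(2,3) w(1) dw] far4.inner3_neighbor[OF comm12 inner(1,3) w(1) dw]
      far4.inner3_neighbor[OF far4.comm12[OF comm23] inner(1,2) w(1) dw] by auto
  have C4: "coords P {rf d, a, b, c}" using coords4(9)[OF coords4(7)[OF C]] .
  note G = coords_level0[OF C4]
  obtain p where p: "p \<in> polytope_vertices P" "rf d p = 0" "near P (rf d w) w p"
    using coords_descend0[OF C4 v _ wV] vi by auto
  have pG: "p \<in> polytope_vertices (level P (rf d) 0)" "v \<in> polytope_vertices (level P (rf d) 0)"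
    using G(3) p v vi by auto
  have wp: "near P 2 w p" using p(3) w by simp
  have "\<not> near (level P (rf d) 0) 5 v p"
    using far_via2[OF near_adj[OF w(1)] wp, of 5] near_sym[OF near_face[OF G(1)], of 5 v p] by auto
  then have f: "far_center3 (level P (rf d) 0) a b c v p"
    using G(2) pG vi far4.step_a[OF swap] far4.step_b[OF swap] far4.step_c[OF swap] adj_face[OF G(1)]
    by unfold_locales blast+
  have up: "near P 3 u p" using near_trans[OF near_adj[OF w(1)] wp] by simp
  consider "a p = a u \<and> b p = b u \<and> c p = c u"
    | "a p \<in> {0, 3} \<and> b p \<in> {0, 3} \<or> a p \<in> {0, 3} \<and> c p \<in> {0, 3} \<or> b p \<in> {0, 3} \<and> c p \<in> {0, 3}"
    using far_center3.antipodal_or_ext2[OF f] far_center3.ext2_def[OF f] sum_a sum_b sum_c by auto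
  then show False
  proof cases
    case 1
    then have "u = p"
      using vertex_between[OF C wV vertex_in[OF u] vertex_in[OF p(1)], of "1/3"] w w' d0 p by simp
    then show False using d0 p by auto
  next
    case 2
    \<comment> \<open>A path from \<open>p\<close> to \<open>v\<close> aimed at \<open>f\<close>,
      \<open>g\<close> and \<open>rf d\<close> takes at most 2 + 2 + 1 steps, after three from
      \<open>u\<close> to \<open>p\<close>.\<close>
    have T: False if "far4 P f g h (rf d) u v" "f p = 0" "g p = 0" "f v \<le> 2" "g v \<le> 2" for f g h
    proof -
      have "coords P {f, g, rf d, h}" using far4.C[OF far4.comm34[OF that(1)]] .
      from far_via[OF up near_sum3_dim4[OF this p(1) v]] show False using that p vi by simp
    qed
    have T': False if "far4 P f g h (rf d) u v" "f p \<in> {0, 3}" "g p \<in> {0, 3}" "f v \<in> {1, 2}" "g v \<in> {1, 2}" for f g h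
      using T[OF that(1)] T[OF far4.refl1[OF that(1)]] T[OF far4.refl2[OF that(1)]]
        T[OF far4.refl2[OF far4.refl1[OF that(1)]]] that(2-) by auto
    show False
      using T'[OF refl4] T'[OF far4.comm23[OF refl4]] T'[OF far4.comm12[OF far4.comm23[OF far4.comm12[OF refl4]]]]
        2 vi by blast
  qed
qed

end

section \<open>One coordinate of \<open>u\<close> in {1,2}\<close>

text \<open>The corner \<open>z\<close> is one step from \<open>u\<close>, and \<open>v\<close>
  reaches the face \<open>a = 0\<close> in two: 1 + 5 + 2, unless it arrives at (0,3,3,3). That
  vertex is a single edge from \<open>v\<close>: 1 + 6 + 1.\<close>

lemma (in far4) no_vertex_0000:
  assumes u0: "a u = 1" "b u = 0" "c u = 0" "d u = 0"
    and z: "z \<in> polytope_vertices P" "a z = 0" "b z = 0" "c z = 0" "d z = 0"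
  shows False
proof -
  have v3: "a v = 2" "b v = 3" "c v = 3" "d v = 3" using sum_a sum_b sum_c sum_d u0 by auto
  have uz: "near P 1 u z" by (rule near_line4[OF C u z(1)]) (use u0 z in auto)
  obtain q where q: "q \<in> polytope_vertices P" "a q = 0" "near P (a v) v q"
    using coords_descend0[OF C z(1,2) v] by blast
  note G = coords_level0[OF C]
  have qG: "z \<in> polytope_vertices (level P a 0)" "q \<in> polytope_vertices (level P a 0)"
    using G(3) q z by auto
  show False
  proof (cases "b q = 3 \<and> c q = 3 \<and> d q = 3")
    case True
    have C': "coords P {a, rf b, rf c, rf d}" using coords4(5)[OF coords4(6)[OF coords4(7)[OF C]]] .
    have "near P 1 q v" by (rule near_line4[OF C' q(1) v]) (use True v3 in auto)
    moreover have "near P 6 z q" by (rule near_level_dim3[OF C z(1) q(1) z(2) q(2)])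
    ultimately show False using far_via2[OF uz] by fastforce
  next
    case False
    have "near (level P a 0) 5 z q"
      by (rule near_corner_dim3[OF G(2) qG z(3-5) False])
    then have "near P 5 z q" using near_face[OF G(1)] by blast
    then show False using far_via2[OF uz _ near_sym[OF q(3)]] v3 by fastforce
  qed
qed

lemma (in far4) refl_all: "far4 P (rf a) (rf b) (rf c) (rf d) u v"
  using far4.refl4[OF far4.refl3[OF far4.refl2[OF refl1]]] .

lemma (in far4) no_vertex_3333:
  assumes u0: "a u = 1" "b u = 0" "c u = 0" "d u = 0"
    and z: "z \<in> polytope_vertices P" "a z = 3" "b z = 3" "c z = 3" "d z = 3"
  shows False
  by (rule far4.no_vertex_0000[OF far4.refl_all[OF swap] _ _ _ _ z(1)])
    (use u0 z sum_a sum_b sum_c sum_d in auto)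

lemma (in far4) no_vertex_2000_aux:
  assumes u0: "a u = 1" "b u = 0" "c u = 0" "d u = 0"
    and r: "r \<in> polytope_vertices P" "a r = 2" "b r = 0" "c r = 0" "d r = 0"
    and z: "(v, z) \<in> polytope_adj P" "a z = 3" "b z \<noteq> 3"
  shows False
proof -
  have v3: "a v = 2" "b v = 3" "c v = 3" "d v = 3" using sum_a sum_b sum_c sum_d u0 by auto
  have zV: "z \<in> polytope_vertices P" using z(1) by (rule adj_vertices)
  have z': "b z = 2" "c z = 3" "d z = 3"
    using far4.two_changes[OF swap z(1)] z v3 far4.step_b[OF swap z(1)] gb[OF zV] by auto
  have ur: "near P 1 u r" by (rule near_line4[OF C u r(1)]) (use u0 r in auto)
  note Cb = coords4(1)[OF C]
  note B = coords_level0[OF Cb]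
  have rB: "r \<in> polytope_vertices (level P b 0)" "u \<in> polytope_vertices (level P b 0)"
    using B(3) r u u0 by auto
  note CB' = coords3(6)[OF B(2)]
  note Ca = coords4(4)[OF C]
  note A = coords_level0[OF Ca]
  show False
  proof (cases "\<exists>x \<in> polytope_vertices P. b x = 0 \<and> a x = 3")
    \<comment> \<open>In the face \<open>a = 3\<close> the reflected coordinates of \<open>z\<close>
      are (1,0,0), so \<open>near_edge_dim3\<close> applies: 1 + 1 + 5 + 1 = 8.\<close>
    case True
    then obtain x where x: "x \<in> polytope_vertices (level P b 0)" "rf a x = 0" using B(3) by auto
    obtain p where p: "p \<in> polytope_vertices (level P b 0)" "rf a p = 0" "near (level P b 0) (rf a r) r p"
      using coords_descend0[OF CB' x rB(1)] by blast
    have rp: "near P 1 r p" using near_face[OF B(1) p(3)] r by simp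
    have p': "p \<in> polytope_vertices P" "b p = 0" "a p = 3" using B(3) p by auto
    have V: "z \<in> polytope_vertices (level P (rf a) 0)" "p \<in> polytope_vertices (level P (rf a) 0)"
      using A(3) zV z p' by auto
    have CA: "coords (level P (rf a) 0) {rf b, rf c, rf d}"
      using coords3(6)[OF coords3(7)[OF coords3(8)[OF A(2)]]] .
    have "near (level P (rf a) 0) 5 z p"
      by (rule near_edge_dim3[OF CA V]) (use z' p' in auto)
    then have pz: "near P 5 p z" using near_sym near_face[OF A(1)] by blast
    show False using far_via3[OF ur rp pz near_sym[OF near_adj[OF z(1)]]] by simp
  next
    \<comment> \<open>Now \<open>a\<close> is at most 2 on the face \<open>b = 0\<close>. If
      \<open>a q = 0\<close>, the polygon \<open>a = b = 0\<close> yields 1 + 4 + 3. Otherwise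
      \<open>q\<close> is within one step of the face \<open>a = 2\<close> of \<open>b = 0\<close>,
      where \<open>r\<close> is a corner: 1 + 3 + 1 + 3.\<close>
    case False
    then have no3: "a x \<le> 2" if "x \<in> polytope_vertices (level P b 0)" for x
      using that B(3) ga by force
    obtain q where q: "q \<in> polytope_vertices P" "b q = 0" "near P (b v) v q"
      using coords_descend0[OF Cb u u0(2) v] by blast
    have qB: "q \<in> polytope_vertices (level P b 0)" using B(3) q by blast
    have qv: "near P 3 q v" using near_sym[OF q(3)] v3 by simp
    have a1: "1 \<le> rf a x" if "x \<in> polytope_vertices (level P b 0)" for x
      using no3[OF that] by simp
    show False
    proof (cases "a q = 0")
      case True
      obtain p where p: "p \<in> polytope_vertices (level P b 0)" "a p = 0" "near (level P b 0) (a u) u p"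
        using coords_descend0[OF B(2) qB True rB(2)] by blast
      have up: "near P 1 u p" using near_face[OF B(1) p(3)] u0 by simp
      have "near (level P b 0) 4 p q"
        by (rule near_level0[OF B(2) p(1) qB p(2) True near_dim2[OF coords_level0(2)[OF B(2)]]])
      then have "near P 4 p q" by (rule near_face[OF B(1)])
      then show False using far_via2[OF up _ qv] by force
    next
      case False
      have "rf a r = 1" using r by simp
      then obtain p where p: "p \<in> polytope_vertices (level P b 0)" "rf a p = 1"
        "near (level P b 0) (rf a q - 1) q p"
        using coords_descend[OF CB' rB(1) _ a1 qB] by blast
      have pq: "near P 1 p q"
        using near_mono[OF near_sym[OF near_face[OF B(1) p(3)]], of 1] False ga[OF q(1)] by auto
      note L = coords_level[where a = "rf a", OF CB' a1]
      have V: "r \<in> polytope_vertices (level (level P b 0) (rf a) 1)"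
        "p \<in> polytope_vertices (level (level P b 0) (rf a) 1)"
        using L(3) rB p \<open>rf a r = 1\<close> by auto
      have "near (level (level P b 0) (rf a) 1) 3 r p"
        using far2.not_corner[OF far2.intro[OF L(2) V]] r by blast
      then have "near P 3 r p" using near_face[OF B(1) near_face[OF L(1)]] by blast
      then show False using far_via3[OF ur _ pq qv] by force
    qed
  qed
qed

lemma (in far4) no_vertex_2000:
  assumes u0: "a u = 1" "b u = 0" "c u = 0" "d u = 0"
    and r: "r \<in> polytope_vertices P" "a r = 2" "b r = 0" "c r = 0" "d r = 0"
  shows False
proof -
  obtain z where z: "(v, z) \<in> polytope_adj P" "a z = 3"
    using far4.neighbor_high[OF swap] sum_a u0 by auto
  have "b z \<noteq> 3 \<or> c z \<noteq> 3 \<or> d z \<noteq> 3"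
    using no_vertex_3333[OF u0 adj_vertices(2)[OF z(1)] z(2)] by blast
  then show False
    using no_vertex_2000_aux[OF u0 r z] far4.no_vertex_2000_aux[OF comm23 u0(1,3,2,4) r(1,2,4,3,5) z]
      far4.no_vertex_2000_aux[OF far4.comm23[OF comm34] u0(1,4,2,3) r(1,2,5,3,4) z] by blast
qed

text \<open>The edge to \<open>w\<close> provides a vertex with \<open>a = b = 3\<close>, hence a
  neighbour \<open>z\<close> of \<open>v\<close> in the face \<open>b = 3\<close> with
  \<open>a = 3\<close>. As \<open>z\<close> is not (3,3,3,3), it lowers \<open>c\<close> or
  \<open>d\<close>, and both edges raise \<open>a\<close>:
  \<open>double_double_third\<close>.\<close>

lemma (in far4) no_inner1_aux:
  assumes u0: "a u = 1" "b u = 0" "c u = 0" "d u = 0"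
    and w: "(u, w) \<in> polytope_adj P" "a w = 2" "b w \<noteq> 0"
  shows False
proof -
  have v3: "a v = 2" "b v = 3" "c v = 3" "d v = 3" using sum_a sum_b sum_c sum_d u0 by auto
  have f: "far4 P (rf a) (rf b) c d u v" by (rule far4.refl1[OF refl2])
  have w': "rf a w < rf a u" "rf b w < rf b u"
    using w u0 gb[OF adj_vertices(2)[OF w(1)]] by auto
  obtain x where x: "x \<in> polytope_vertices P" "rf a x = 0" "rf b x = 0"
    using far4.double_exists_corner[OF f w(1) w'] by blast
  have CB: "coords P {rf b, a, c, d}" using coords4(4)[OF coords4(1)[OF C]] .
  note B = coords_level0[OF CB]
  have V: "v \<in> polytope_vertices (level P (rf b) 0)" "x \<in> polytope_vertices (level P (rf b) 0)"
    using B(3) x v v3 by auto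
  have CA: "grid (level P (rf b) 0) (rf a)" using grid_rf[OF coords_grid[OF B(2)]] by simp
  have "rf a x < rf a v" using x v3 by simp
  then obtain z where z: "(v, z) \<in> polytope_adj (level P (rf b) 0)" "rf a z < rf a v"
    using descending_neighbor[OF coords_polytope[OF B(2)] V(1) grid_affine[OF CA] vertex_in[OF V(2)]] by blast
  have zP: "(v, z) \<in> polytope_adj P" using z(1) adj_face[OF B(1)] by blast
  have zV: "z \<in> polytope_vertices P" using zP by (rule adj_vertices)
  have z3: "a z = 3" using z(2) v3 ga[OF zV] by auto
  have "b z = 3" using adj_vertices(2)[OF z(1)] B(3) by auto
  then have "c z \<noteq> 3 \<or> d z \<noteq> 3"
    using no_vertex_3333[OF u0 zV z3] by blast
  moreover have "c z = 3"
    using far4.double_double_third[OF f w(1) w' zP z(2)] v3 gc[OF zV] by force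
  moreover have "d z = 3"
    using far4.double_double_third[OF far4.comm34[OF f] w(1) w' zP z(2)] v3 gd[OF zV] by force
  ultimately show False by blast
qed

lemma (in far4) no_inner1:
  assumes u0: "a u = 1" "b u = 0" "c u = 0" "d u = 0"
  shows False
proof -
  obtain w where w: "(u, w) \<in> polytope_adj P" "a w = 2" using neighbor_high u0 by auto
  have "b w \<noteq> 0 \<or> c w \<noteq> 0 \<or> d w \<noteq> 0"
    using no_vertex_2000[OF u0 adj_vertices(2)[OF w(1)] w(2)] by blast
  then show False
    using no_inner1_aux[OF u0 w] far4.no_inner1_aux[OF comm23 u0(1,3,2,4) w]
      far4.no_inner1_aux[OF far4.comm23[OF comm34] u0(1,4,2,3) w] by blast
qed

section \<open>Two coordinates of \<open>u\<close> in {1,2}\<close>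

locale far4_inner2 = far4 +
  assumes inner: "a u \<in> {1, 2}" "b u \<in> {1, 2}" and u0: "c u = 0" "d u = 0"
begin

lemma i_comm12: "far4_inner2 P b a c d u v" and i_comm34: "far4_inner2 P a b d c u v"
  and i_refl1: "far4_inner2 P (rf a) b c d u v" and i_refl2: "far4_inner2 P a (rf b) c d u v"
  using comm12 comm34 refl1 refl2 inner u0 by (auto simp: far4_inner2_def far4_inner2_axioms_def)

lemma i_swap: "far4_inner2 P a b (rf c) (rf d) v u"
proof -
  have "far4 P a b (rf c) (rf d) v u" using far4.refl3[OF far4.refl4[OF swap]] .
  then show ?thesis
    using inner u0 sum_a sum_b sum_c sum_d by (auto simp: far4_inner2_def far4_inner2_axioms_def)
qed

lemma v3: "c v = 3" "d v = 3" "a v \<in> {1, 2}" "b v \<in> {1, 2}"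
  using inner u0 sum_a sum_b sum_c sum_d by auto

text \<open>The edge at \<open>v\<close> provides a vertex with \<open>a = c = 0\<close>, hence a
  neighbour \<open>y\<close> of \<open>u\<close> with these values;
  \<open>double_double_third\<close> leaves its \<open>b\<close> and \<open>d\<close> unchanged. The
  edge at \<open>u\<close> provides the octagon \<open>a = 0\<close>, \<open>c = 3\<close> with a
  vertex \<open>q\<close> above \<open>y\<close>, and \<open>w\<close> lies between them.\<close>

lemma opposite_outer_aux:
  assumes a1: "a u = 1" and w: "(u, w) \<in> polytope_adj P" "a w < a u" "c w > c u"
    and z: "(v, z) \<in> polytope_adj P" "a z < a v" "c z < c v"
  shows False
proof -
  have wV: "w \<in> polytope_vertices P" using w(1) by (rule adj_vertices)
  have w1: "a w = 0" "c w = 1" "b w = b u" "d w = 0"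
    using w a1 u0 ga[OF wV] gc[OF wV] step_c[OF w(1)] two_changes[OF w(1)]
      far4.two_changes[OF comm23 w(1)] by auto
  have fac: "far4 P a c b d v u" by (rule far4.comm23[OF swap])
  obtain x where x: "x \<in> polytope_vertices P" "a x = 0" "c x = 0"
    using far4.double_exists_corner[OF fac z] by blast
  have Cc: "coords P {c, a, b, d}" by (rule coords4(10)[OF C])
  note B = coords_level0[OF Cc]
  have V: "u \<in> polytope_vertices (level P c 0)" "x \<in> polytope_vertices (level P c 0)"
    using B(3) x u u0 by auto
  have "a x < a u" using x a1 by simp
  then obtain y where y: "(u, y) \<in> polytope_adj (level P c 0)" "a y < a u"
    using descending_neighbor[OF coords_polytope[OF B(2)] V(1) grid_affine[OF coords_grid[OF B(2)]] vertex_in[OF V(2)]]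
    by blast
  have yP: "(u, y) \<in> polytope_adj P" using y(1) adj_face[OF B(1)] by blast
  have yV: "y \<in> polytope_vertices P" using yP by (rule adj_vertices)
  have cy: "c y = 0" using adj_vertices(2)[OF y(1)] B(3) by auto
  have ay: "a y = 0" using y(2) a1 ga[OF yV] by auto
  have 1: "\<not> b y < b u" using double_double_third[OF yP y(2) _ z] by blast
  have 2: "\<not> b u < b y" using far4.double_double_third[OF refl2 yP y(2) _ z] by force
  have 3: "d y = 0"
    using far4.double_double_third[OF far4.comm34[OF far4.comm23[OF far4.comm34[OF refl4]]] yP y(2) _ z]
      u0 gd[OF yV] by force
  have "(b u, 0) \<in> octagon" using inner(2) by (auto simp: octagon_def)
  then obtain q where q: "q \<in> polytope_vertices P" "a q = 0" "rf c q = 0" "b q = b u" "d q = 0"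
    using far4.double_octagon[OF far4.comm23[OF refl3] w(1,2)] w(3) by fastforce
  have "y = q"
    by (rule vertex_between[OF C wV vertex_in[OF yV] vertex_in[OF q(1)], of "1/3"])
      (use w1 ay cy 1 2 3 q in auto)
  then show False using cy q by auto
qed

text \<open>The edge at \<open>v\<close> blocks every sideways move of the edge from
  \<open>u\<close> that raises \<open>b\<close>, so \<open>w = (0,1,0,0)\<close>,
  \<open>u = (1,2,0,0)\<close> and \<open>y = (1,3,0,0)\<close>. This makes the polygon
  \<open>c = d = 0\<close> too thin.\<close>

lemma opposite_inner_aux:
  assumes a1: "a u = 1" and w: "(u, w) \<in> polytope_adj P" "a w < a u" "b w < b u"
    and z: "(v, z) \<in> polytope_adj P" "a z < a v" "b z > b v"
  shows False
proof -
  have wV: "w \<in> polytope_vertices P" using w(1) by (rule adj_vertices)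
  have w1: "a w = 0" "b w = b u - 1" "c w = 0" "d w = 0"
    using w a1 u0 ga[OF wV] far4.low_step_eq[OF comm12 w(1,3)] two_changes[OF w(1)] by auto
  have "b u \<noteq> 1"
  proof
    assume "b u = 1"
    then have "(c w, d w) \<in> octagon"
      using double_corner(1)[OF w wV] near_adj[OF w(1)] a1 w1 by simp
    then show False using w1 by (simp add: octagon_def)
  qed
  then have b2: "b u = 2" using inner(2) by simp
  obtain y where y: "(u, y) \<in> polytope_adj P" "b y = 3"
    using far4.neighbor_high[OF comm12] b2 by auto
  have yV: "y \<in> polytope_vertices P" using y(1) by (rule adj_vertices)
  have yb: "rf b y < rf b u" using y b2 by simp
  have zb: "rf b z < rf b v" using z by simp
  have 1: "\<not> a y < a u"
    using far4.double_double[OF refl2 y(1) _ yb z(1,2) zb] by blast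
  have 2: "\<not> a u < a y"
  proof
    assume "a u < a y"
    then have "a y = 2" "c y = 0" "d y = 0"
      using step_a[OF y(1)] ga[OF yV] a1 two_changes[OF y(1)] y b2 u0 by auto
    then have "w = y"
      by (intro vertex_between[OF C u vertex_in[OF wV] vertex_in[OF yV], of "1/2"])
        (use w1 b2 a1 y u0 in auto)
    then show False using w1 \<open>a y = 2\<close> by simp
  qed
  have 3: "\<not> c u < c y"
    using far4.double_double_third[OF far4.comm23[OF far4.comm12[OF far4.refl3[OF refl2]]] y(1) yb _ z(1) zb z(2)]
    by auto
  have 4: "\<not> d u < d y"
    using far4.double_double_third[OF far4.comm23[OF far4.comm12[OF far4.comm34[OF far4.refl4[OF refl2]]]]
        y(1) yb _ z(1) zb z(2)] by auto
  have y1: "a y = 1" "c y = 0" "d y = 0"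
    using 1 2 3 4 a1 u0 gc[OF yV] gd[OF yV] by auto
  \<comment> \<open>With only the values 0 and 1 of \<open>a\<close> the polygon is crossed in two
    steps, and \<open>v\<close> reaches it in six.\<close>
  have low: "a x \<le> 1" if x: "x \<in> polytope_vertices P" "c x = 0" "d x = 0" for x
  proof (rule ccontr)
    assume "\<not> a x \<le> 1"
    then have ax: "a x = 2 \<or> a x = 3" using ga[OF x(1)] by auto
    show False
    proof (cases "a x = 2 \<and> b x = 3")
      case True
      have "w = x"
        by (rule vertex_between[OF C u vertex_in[OF wV] vertex_in[OF x(1)], of "1/2"])
          (use w1 b2 a1 True x u0 in auto)
      then show False using w1 True by simp
    next
      case False
      \<comment> \<open>Common denominator of the barycentric coordinates of (1,2) with respect to
        (0,1), (1,3) and \<open>x\<close>. The weight of \<open>y\<close> vanishes only for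
        \<open>x\<close> at (2,3), treated before.\<close>
      define D where "D = 2 * a x - b x + 1"
      have D: "D > 0" "a x - 1 > 0" "a x - b x + 1 > 0"
        using ax gb[OF x(1)] False by (auto simp: D_def)
      have "w = u"
      proof (rule vertex_not_in_triangle[OF C u vertex_in[OF wV] vertex_in[OF yV] vertex_in[OF x(1)]])
        show "0 < (a x - 1) / D" "0 < (a x - b x + 1) / D" "0 < 1 / D" using D by auto
        have "(a x - 1) + (a x - b x + 1) + 1 = D" by (simp add: D_def)
        then show "(a x - 1) / D + (a x - b x + 1) / D + 1 / D = 1"
          using D(1) by (simp add: add_divide_distrib[symmetric])
        have "a u * D = (a x - 1) * a w + (a x - b x + 1) * a y + a x"
          "b u * D = (a x - 1) * b w + (a x - b x + 1) * b y + b x"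
          using a1 b2 w1 y1 y by (auto simp: D_def algebra_simps)
        then have "a u = ((a x - 1) * a w + (a x - b x + 1) * a y + a x) / D"
          "b u = ((a x - 1) * b w + (a x - b x + 1) * b y + b x) / D"
          using D(1) by (simp_all add: nonzero_eq_divide_eq)
        moreover have "(k * l + m * n + i) / D = k / D * l + m / D * n + 1 / D * i" for k l m n i
          by (simp add: add_divide_distrib)
        ultimately have "a u = (a x - 1) / D * a w + (a x - b x + 1) / D * a y + 1 / D * a x"
          "b u = (a x - 1) / D * b w + (a x - b x + 1) / D * b y + 1 / D * b x"
          by simp_all
        then show "\<forall>f\<in>{a, b, c, d}. f u = (a x - 1) / D * f w + (a x - b x + 1) / D * f y + 1 / D * f x"
          using u0 w1 y1 x by simp
      qed
      then show False using w1 a1 by simp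
    qed
  qed
  obtain F where F: "F face_of P" "coords F {a, b}"
    "\<And>y. y \<in> polytope_vertices F \<longleftrightarrow> y \<in> polytope_vertices P \<and> c y = 0 \<and> d y = 0"
    "\<And>y. y \<in> polytope_vertices P \<Longrightarrow> \<exists>z \<in> polytope_vertices F. near P (c y + d y) y z"
    using corner_face[OF coords4(8)[OF C] u u0] by metis
  obtain q where q: "q \<in> polytope_vertices F" "near P (c v + d v) v q" using F(4)[OF v] by blast
  have "u \<in> polytope_vertices F" using F(3) u u0 by blast
  have "near F (1 - 0 + 1) u q"
  proof (rule near_range[OF F(2) _ _ near_dim1 \<open>u \<in> polytope_vertices F\<close> q(1)])
    show "0 \<le> a x" "a x \<le> 1" if "x \<in> polytope_vertices F" for x
      using that F(3) low ga[of x] by force+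
  qed
  then show False using far_via[OF near_face[OF F(1)] near_sym[OF q(2)]] v3 by force
qed

lemma opposite_outer:
  assumes w: "(u, w) \<in> polytope_adj P" "a w < a u" "c w > c u"
    and z: "(v, z) \<in> polytope_adj P" "a z < a v" "c z < c v"
  shows False
proof (cases "a u = 1")
  case True
  then show ?thesis using opposite_outer_aux[OF _ w z] by blast
next
  case False
  then have "a v = 1" using inner sum_a by auto
  then show ?thesis using far4_inner2.opposite_outer_aux[OF i_swap _ z(1,2) _ w(1,2)] w z by simp
qed

lemma opposite_inner:
  assumes w: "(u, w) \<in> polytope_adj P" "a w < a u" "b w < b u"
    and z: "(v, z) \<in> polytope_adj P" "a z < a v" "b z > b v"
  shows False
proof (cases "a u = 1")
  case True
  then show ?thesis using opposite_inner_aux[OF _ w z] by blast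
next
  case False
  then have "a v = 1" using inner sum_a by auto
  then show ?thesis
    using far4_inner2.opposite_inner_aux[OF far4_inner2.i_refl2[OF i_swap] _ z(1,2) _ w(1,2)] w z by simp
qed

end

context far4_inner2
begin

text \<open>Each edge changes a second coordinate. Different second coordinates fall under
  \<open>double_double_third\<close>, the same one in the same direction under
  \<open>double_double\<close>, and in opposite directions under \<open>opposite_inner\<close> or
  \<open>opposite_outer\<close>.\<close>

lemma double_low_exclusive:
  assumes w: "(u, w) \<in> polytope_adj P" "a w < a u" "b w \<noteq> b u \<or> c w \<noteq> c u \<or> d w \<noteq> d u"
    and z: "(v, z) \<in> polytope_adj P" "a z < a v" "b z \<noteq> b v \<or> c z \<noteq> c v \<or> d z \<noteq> d v"
  shows False
proof -
  have wV: "w \<in> polytope_vertices P" using w(1) by (rule adj_vertices)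
  have zV: "z \<in> polytope_vertices P" using z(1) by (rule adj_vertices)
  have wc: "b w < b u \<or> b u < b w \<or> c u < c w \<or> d u < d w"
    using w(3) u0 gc[OF wV] gd[OF wV] by auto
  have zc: "b z < b v \<or> b v < b z \<or> c z < c v \<or> d z < d v"
    using z(3) v3 gc[OF zV] gd[OF zV] by auto
  have same: False if "far4 P a f g h u v" "f w < f u" "f z < f v" for f g h
    using far4.double_double[OF that(1) w(1,2) that(2) z(1,2) that(3)] .
  have third: False if "far4 P a f g h u v" "f w < f u" "g z < g v" for f g h
    using far4.double_double_third[OF that(1) w(1,2) that(2) z(1,2) that(3)] .
  have f34: "far4 P a b (rf c) (rf d) u v" by (rule far4.refl4[OF refl3])
  have bb: "\<not> (b w < b u \<and> b z < b v)" using same[OF far4.intro[OF C u v far]] by blast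
  have bb': "\<not> (b u < b w \<and> b v < b z)" using same[OF refl2] by auto
  have bB: "\<not> (b w < b u \<and> b v < b z)" using opposite_inner[OF w(1,2) _ z(1,2)] by blast
  have Bb: "\<not> (b u < b w \<and> b z < b v)"
    using far4_inner2.opposite_inner[OF i_refl2 w(1,2) _ z(1,2)] by auto
  have bc: "\<not> (b w < b u \<and> c z < c v)" "\<not> (b w < b u \<and> d z < d v)"
    using third[OF far4.intro[OF C u v far]] third[OF comm34] by blast+
  have Bc: "\<not> (b u < b w \<and> c z < c v)" "\<not> (b u < b w \<and> d z < d v)"
    using third[OF refl2] third[OF far4.comm34[OF refl2]] by auto
  have cb: "\<not> (c u < c w \<and> b z < b v)" "\<not> (c u < c w \<and> b v < b z)"
    using third[OF far4.comm23[OF refl3]] third[OF far4.comm23[OF far4.refl3[OF refl2]]] by auto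
  have db: "\<not> (d u < d w \<and> b z < b v)" "\<not> (d u < d w \<and> b v < b z)"
    using third[OF far4.comm23[OF far4.comm34[OF refl4]]]
      third[OF far4.comm23[OF far4.comm34[OF far4.refl4[OF refl2]]]] by auto
  have cd: "\<not> (c u < c w \<and> d z < d v)"
    using third[OF far4.comm34[OF far4.comm23[OF refl3]]] by auto
  have dc: "\<not> (d u < d w \<and> c z < c v)"
    using third[OF far4.comm34[OF far4.comm23[OF far4.comm34[OF refl4]]]] by auto
  have cc: "\<not> (c u < c w \<and> c z < c v)" using opposite_outer[OF w(1,2) _ z(1,2)] by blast
  have dd: "\<not> (d u < d w \<and> d z < d v)"
    using far4_inner2.opposite_outer[OF i_comm34 w(1,2) _ z(1,2)] by blast
  show False using wc zc bb bb' bB Bb bc Bc cb db cd dc cc dd by argo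
qed

end

text \<open>Some edge at \<open>y\<close> lowers the coordinate \<open>f\<close> without being parallel to its axis; \<open>R\<close> holds the other
  coordinates.\<close>

definition bends :: "'a::euclidean_space set \<Rightarrow> ('a \<Rightarrow> real) \<Rightarrow> ('a \<Rightarrow> real) set \<Rightarrow> 'a \<Rightarrow> bool" where
  "bends P f R y \<longleftrightarrow> (\<exists>w. (y, w) \<in> polytope_adj P \<and> f w < f y \<and> (\<exists>g\<in>R. g w \<noteq> g y))"

lemma bends_rf: "bends P f {g, rf h, rf k} y = bends P f {g, h, k} y" "bends P f {rf g, h, k} y = bends P f {g, h, k} y"
  by (auto simp: bends_def)

lemma not_bendsD:
  "\<not> bends P f {g, h, k} y \<Longrightarrow> (y, w) \<in> polytope_adj P \<Longrightarrow> f w < f y \<Longrightarrow> g w = g y \<and> h w = h y \<and> k w = k y"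
  by (auto simp: bends_def)

context far4_inner2
begin

lemma bends_exists: "bends P a {b, c, d} u \<or> bends P (rf a) {b, c, d} u"
proof (rule ccontr)
  assume "\<not> ?thesis"
  then have n: "\<not> bends P a {b, c, d} u" "\<not> bends P (rf a) {b, c, d} u" by auto
  obtain w where w: "(u, w) \<in> polytope_adj P" "a w = a u - 1" using neighbor_low inner by auto
  obtain x where x: "(u, x) \<in> polytope_adj P" "a x = a u + 1" using neighbor_high inner by auto
  have "b w = b u \<and> c w = c u \<and> d w = d u" using not_bendsD[OF n(1) w(1)] w(2) by simp
  moreover have "b x = b u \<and> c x = c u \<and> d x = d u" using not_bendsD[OF n(2) x(1)] x(2) by simp
  moreover have "a u = (1 - 1 / 2) * a w + 1 / 2 * a x" using w x by (simp add: field_simps)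
  ultimately have "w = x"
    by (intro vertex_between[OF C u vertex_in[OF adj_vertices(2)[OF w(1)]] vertex_in[OF adj_vertices(2)[OF x(1)]], of "1/2"])
      auto
  then show False using w x by simp
qed

lemma bends_exists_opposite: "bends P a {b, c, d} v \<or> bends P (rf a) {b, c, d} v"
  using far4_inner2.bends_exists[OF i_swap] by (simp add: bends_rf)

lemma bends_exclusive: "\<not> (bends P a {b, c, d} u \<and> bends P a {b, c, d} v)"
  unfolding bends_def using double_low_exclusive by blast

text \<open>The edges at \<open>u\<close> that raise \<open>a\<close> or \<open>b\<close> are
  parallel to the axes. A neighbour of \<open>u\<close> with smaller \<open>a\<close> in the polygon
  would make \<open>u\<close> a midpoint with \<open>s\<close> or the centroid with \<open>s\<close>
  and \<open>t\<close>, or would be a bending edge that raises \<open>b\<close>.\<close>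

lemma bottom_face_above:
  assumes A: "\<not> bends P (rf a) {b, c, d} u" and B: "\<not> bends P (rf b) {a, c, d} u"
    and x: "x \<in> polytope_vertices P" "c x = 0" "d x = 0"
  shows "a u \<le> a x"
proof (rule ccontr)
  assume "\<not> ?thesis"
  then have ax: "a x < a u" by simp
  obtain s where s: "(u, s) \<in> polytope_adj P" "a s = a u + 1" using neighbor_high inner by auto
  obtain t where t: "(u, t) \<in> polytope_adj P" "b t = b u + 1"
    using far4.neighbor_high[OF comm12] inner by auto
  have s': "b s = b u" "c s = c u" "d s = d u" using not_bendsD[OF A s(1)] s(2) by auto
  have t': "a t = a u" "c t = c u" "d t = d u" using not_bendsD[OF B t(1)] t(2) by auto
  have sP: "s \<in> P" and tP: "t \<in> P" using adj_vertices(2) s(1) t(1) vertex_in by blast+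
  obtain F where F: "F face_of P" "coords F {a, b}"
    "\<And>y. y \<in> polytope_vertices F \<longleftrightarrow> y \<in> polytope_vertices P \<and> c y = 0 \<and> d y = 0"
    "\<And>y. y \<in> polytope_vertices P \<Longrightarrow> \<exists>z \<in> polytope_vertices F. near P (c y + d y) y z"
    using corner_face[OF coords4(8)[OF C] u u0] by metis
  have uF: "u \<in> polytope_vertices F" and xF: "x \<in> polytope_vertices F" using F(3) u u0 x by blast+
  have gF: "affine_fun a" by (rule grid_affine[OF coords_grid[OF F(2)]]) simp
  obtain y where y: "(u, y) \<in> polytope_adj F" "a y < a u"
    using descending_neighbor[OF coords_polytope[OF F(2)] uF gF vertex_in[OF xF] ax] by blast
  have yP: "(u, y) \<in> polytope_adj P" using y(1) adj_face[OF F(1)] by blast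
  have y': "c y = 0" "d y = 0" using adj_vertices(2)[OF y(1)] F(3) by auto
  have yV: "y \<in> P" using adj_vertices(2)[OF yP] by (rule vertex_in)
  have ay: "a y = a u - 1" by (rule low_step_eq[OF yP y(2)])
  consider "b y = b u" | "b y > b u" | "b y < b u" by linarith
  then show False
  proof cases
    case 1
    have "y = s"
      by (rule vertex_between[OF C u yV sP, of "1/2"]) (use 1 ay s s' y' u0 in \<open>auto simp: field_simps\<close>)
    then show False using ay s by simp
  next
    case 2
    then show False using not_bendsD[OF B yP] ay by simp
  next
    case 3
    then have by1: "b y = b u - 1" by (rule far4.low_step_eq[OF comm12 yP])
    have "y = u"
      by (rule vertex_not_in_triangle[OF C u yV sP tP, of "1/3" "1/3" "1/3"])
        (use by1 ay s s' t t' y' u0 in \<open>auto simp: field_simps\<close>)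
    then show False using ay by simp
  qed
qed

end

lemma (in far4_inner2) oriented_contradiction:
  assumes A: "\<not> bends P (rf a) {b, c, d} u" "\<not> bends P a {b, c, d} v" "bends P (rf a) {b, c, d} v"
    and B: "\<not> bends P (rf b) {a, c, d} u" "\<not> bends P b {a, c, d} v"
  shows False
proof -
  obtain F where F: "F face_of P" "coords F {a, b}"
    "\<And>y. y \<in> polytope_vertices F \<longleftrightarrow> y \<in> polytope_vertices P \<and> c y = 0 \<and> d y = 0"
    "\<And>y. y \<in> polytope_vertices P \<Longrightarrow> \<exists>z \<in> polytope_vertices F. near P (c y + d y) y z"
    using corner_face[OF coords4(8)[OF C] u u0] by metis
  have uF: "u \<in> polytope_vertices F" using F(3) u u0 by blast
  obtain q where q: "q \<in> polytope_vertices F" "near P (c v + d v) v q" using F(4)[OF v] by blast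
  have qP: "q \<in> polytope_vertices P" "c q = 0" "d q = 0" using F(3) q by blast+
  have qv: "near P 6 q v" using near_sym[OF q(2)] v3 by simp
  have far_u: "\<not> near F 2 u q" using far_via[OF near_face[OF F(1)] qv] by force
  have la: "a u \<le> a x" if "x \<in> polytope_vertices F" for x
    using bottom_face_above[OF A(1) B(1)] F(3) that by blast
  have lb: "b u \<le> b x" if "x \<in> polytope_vertices F" for x
    using far4_inner2.bottom_face_above[OF i_comm12 B(1) A(1)] F(3) that by blast
  \<comment> \<open>Six steps from \<open>v\<close> to \<open>q\<close> leave more than 2 between
    \<open>u\<close> and \<open>q\<close>. Since \<open>f u\<close> is the minimum on
    \<open>F\<close>, a path of length \<open>f q - f u + 1\<close> exists, so
    \<open>f q - f u\<close> is at least 2.\<close>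
  have 1: "f u = 1 \<and> f q = 3"
    if f: "coords F {f, g}" "f u \<in> {1, 2}" "\<And>x. x \<in> polytope_vertices F \<Longrightarrow> f u \<le> f x" for f g
  proof -
    have "near F (f u + f q - 2 * f u + 1) u q"
      by (rule near_down_min[OF f(1,3) near_dim1 uF q(1)])
    then have "f u + f q - 2 * f u + 1 > 2" using far_u near_mono[of F _ u q 2] by fastforce
    then show ?thesis using f(2) gridD[OF coords_grid[OF f(1)] q(1), of f] by auto
  qed
  have a13: "a u = 1" "a q = 3" using 1[OF F(2) inner(1) la] by auto
  have b13: "b u = 1" "b q = 3" using 1[OF coords2(1)[OF F(2)] inner(2) lb] by auto
  have av: "a v = 2" "b v = 2" using sum_a sum_b a13 b13 by auto
  have "near F (a u + a q - 2 * 1 + 1) u q"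
    by (rule near_down_min[OF F(2) _ near_dim1 uF q(1)]) (use la a13 in auto)
  then have uq: "near P 3 u q" using near_face[OF F(1)] a13 by simp
  obtain z where z: "(v, z) \<in> polytope_adj P" "rf a z < rf a v" "b z \<noteq> b v \<or> c z \<noteq> c v \<or> d z \<noteq> d v"
    using A(3) by (auto simp: bends_def)
  have zV: "z \<in> polytope_vertices P" using z(1) by (rule adj_vertices)
  have z3: "a z = 3" using z(2) av ga[OF zV] by auto
  have f: "far4 P (rf a) (rf b) c d v u" by (rule far4.refl1[OF far4.refl2[OF swap]])
  \<comment> \<open>Otherwise \<open>z = (3,3,3,3)\<close> is itself the corner point of
    \<open>double_corner\<close> for \<open>v\<close>, but (3,3) is not on the octagon.\<close>
  have "\<not> b v < b z"
  proof
    assume bz: "b v < b z"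
    then have z': "b z = 3" "c z = 3" "d z = 3"
      using gb[OF zV] far4.two_changes[OF swap z(1)] z3 av v3 by auto
    have "(c z, d z) \<in> octagon"
      by (rule far4.double_corner(1)[OF f z(1,2) _ zV]) (use z3 z' av near_adj[OF z(1)] in auto)
    then show False using z' by (simp add: octagon_def)
  qed
  moreover have "\<not> b z < b v" using not_bendsD[OF B(2) z(1)] z3 av by auto
  ultimately have bz: "b z = 2" using av by simp
  have CA: "coords P {rf a, b, c, d}" by (rule coords4(4)[OF C])
  note G = coords_level0[OF CA]
  have V: "z \<in> polytope_vertices (level P (rf a) 0)" "q \<in> polytope_vertices (level P (rf a) 0)"
    using G(3) zV z3 qP a13 by auto
  have CB: "coords (level P (rf a) 0) {rf b, c, d}" by (rule coords3(6)[OF G(2)])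
  obtain y where y: "y \<in> polytope_vertices (level P (rf a) 0)" "rf b y = 0"
    "near (level P (rf a) 0) (rf b z) z y"
    using coords_descend0[OF CB V(2) _ V(1)] b13 by auto
  have zy: "near P 1 z y" using near_face[OF G(1) y(3)] bz by simp
  \<comment> \<open>In the polygon \<open>a = b = 3\<close> the vertex \<open>q = (3,3,0,0)\<close>
    is a corner of the box. The path \<open>u\<close>, \<open>q\<close>, \<open>y\<close>,
    \<open>z\<close>, \<open>v\<close> has length 3 + 3 + 1 + 1.\<close>
  have "near (level P (rf a) 0) 3 q y"
    using near_level_dim2[OF CB V(2) y(1)] y(2) b13 qP far2.not_corner by fastforce
  then have "near P 3 q y" by (rule near_face[OF G(1)])
  then show False
    using far_via2[OF uq _ near_sym[OF near_trans[OF near_adj[OF z(1)] zy, of 2]], of 3] by force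
qed

text \<open>Along each of the axes \<open>a\<close> and \<open>b\<close>, edges bend in exactly one
  direction at \<open>u\<close> and in exactly the opposite one at \<open>v\<close>. Reflections
  give both axes the orientation of \<open>oriented_contradiction\<close>.\<close>

lemma (in far4_inner2) contradiction: False
proof -
  have f: False
    if "far4_inner2 P f g c d u v" "bends P (rf f) {b, c, d} v"
      "\<not> bends P (rf f) {b, c, d} u" "\<not> bends P f {b, c, d} v"
      "\<not> bends P (rf g) {a, c, d} u" "\<not> bends P g {a, c, d} v"
      "f = a \<or> f = rf a" "g = b \<or> g = rf b" for f g
    using far4_inner2.oriented_contradiction[OF that(1)] that by (auto simp: bends_rf)
  have ea: "bends P a {b, c, d} u \<or> bends P (rf a) {b, c, d} u"
    "bends P a {b, c, d} v \<or> bends P (rf a) {b, c, d} v"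
    "\<not> (bends P a {b, c, d} u \<and> bends P a {b, c, d} v)"
    "\<not> (bends P (rf a) {b, c, d} u \<and> bends P (rf a) {b, c, d} v)"
    using bends_exists bends_exists_opposite bends_exclusive far4_inner2.bends_exclusive[OF i_refl1] by auto
  have eb: "bends P b {a, c, d} u \<or> bends P (rf b) {a, c, d} u"
    "bends P b {a, c, d} v \<or> bends P (rf b) {a, c, d} v"
    "\<not> (bends P b {a, c, d} u \<and> bends P b {a, c, d} v)"
    "\<not> (bends P (rf b) {a, c, d} u \<and> bends P (rf b) {a, c, d} v)"
    using far4_inner2.bends_exists[OF i_comm12] far4_inner2.bends_exists_opposite[OF i_comm12]
      far4_inner2.bends_exclusive[OF i_comm12]
      far4_inner2.bends_exclusive[OF far4_inner2.i_refl1[OF i_comm12]] by auto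
  have i12: "far4_inner2 P (rf a) (rf b) c d u v" by (rule far4_inner2.i_refl1[OF i_refl2])
  have i0: "far4_inner2 P a b c d u v" ..
  note f[OF i0] f[OF i_refl1] f[OF i_refl2] f[OF i12]
  then show False
    using ea eb by (smt (verit) rf_rf)
qed

section \<open>Conclusion of the upper bound\<close>

text \<open>The number of ones decides which of the five cases applies; permutations bring them to
  the front.\<close>

lemma (in far4) normalized_contradiction:
  assumes "a u = 0 \<or> a u = 1" "b u = 0 \<or> b u = 1" "c u = 0 \<or> c u = 1" "d u = 0 \<or> d u = 1"
  shows False
proof -
  have one: "\<not> (f u = 1 \<and> g u = 0 \<and> h u = 0 \<and> k u = 0)" if "far4 P f g h k u v" for f g h k
    using far4.no_inner1[OF that] by blast
  have two: "\<not> (f u = 1 \<and> g u = 1 \<and> h u = 0 \<and> k u = 0)" if "far4 P f g h k u v" for f g h k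
  proof
    assume *: "f u = 1 \<and> g u = 1 \<and> h u = 0 \<and> k u = 0"
    have "far4_inner2 P f g h k u v"
      by (rule far4_inner2.intro[OF that]) (simp add: far4_inner2_axioms_def *)
    then show False by (rule far4_inner2.contradiction)
  qed
  have three: "\<not> (f u = 1 \<and> g u = 1 \<and> h u = 1 \<and> k u = 0)" if "far4 P f g h k u v" for f g h k
    using far4.no_inner3[OF that] by auto
  have zero: "\<not> (a u = 0 \<and> b u = 0 \<and> c u = 0 \<and> d u = 0)" using no_corner by blast
  have four: "\<not> (a u = 1 \<and> b u = 1 \<and> c u = 1 \<and> d u = 1)" using no_inner4 by auto
  have f0: "far4 P a b c d u v" by (rule far4.intro[OF C u v far])
  note clauses = zero four one[OF f0] one[OF comm12] one[OF far4.comm12[OF comm23]]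
    one[OF far4.comm12[OF far4.comm23[OF comm34]]]
    two[OF f0] two[OF comm23] two[OF far4.comm23[OF comm34]]
    two[OF far4.comm23[OF comm12]] two[OF far4.comm23[OF far4.comm34[OF comm12]]] two[OF perm]
    three[OF f0] three[OF comm34] three[OF far4.comm34[OF comm23]]
    three[OF far4.comm34[OF far4.comm23[OF comm12]]]
  show False using assms clauses by argo
qed

lemma (in far4) contradiction: False
proof -
  have 1: "\<exists>f. far4 P f g h k u v \<and> (f u = 0 \<or> f u = 1)" if e: "far4 P e g h k u v" for e g h k
  proof (cases "e u = 0 \<or> e u = 1")
    case True
    then show ?thesis using e by blast
  next
    case False
    then have "rf e u = 0 \<or> rf e u = 1" using far4.ga[OF e u] by auto
    then show ?thesis using far4.refl1[OF e] by blast
  qed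
  obtain f where f: "far4 P f b c d u v" "f u = 0 \<or> f u = 1"
    using 1[OF far4.intro[OF C u v far]] by blast
  obtain g where g: "far4 P g f c d u v" "g u = 0 \<or> g u = 1" using 1[OF far4.comm12[OF f(1)]] by blast
  obtain h where h: "far4 P h d g f u v" "h u = 0 \<or> h u = 1" using 1[OF far4.perm[OF g(1)]] by blast
  obtain k where k: "far4 P k h g f u v" "k u = 0 \<or> k u = 1" using 1[OF far4.comm12[OF h(1)]] by blast
  show False by (rule far4.normalized_contradiction[OF k(1) k(2) h(2) g(2) f(2)])
qed

lemma near_dim4:
  assumes "coords P {a, b, c, d}" "u \<in> polytope_vertices P" "v \<in> polytope_vertices P"
  shows "near P 8 u v"
  using far4.contradiction far4.intro[OF assms] by blast

lemma lattice_polytope_coords: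
  fixes P :: "(real ^ 4) set"
  assumes "lattice_polytope 3 P"
  shows "coords P {\<lambda>x. x $ 1, \<lambda>x. x $ 2, \<lambda>x. x $ 3, \<lambda>x. x $ 4}"
proof -
  have V: "v $ i \<in> real ` {0..3}" if "v \<in> polytope_vertices P" for v i
    using assms that by (auto simp: lattice_polytope_def)
  have "polytope P" using assms by (auto simp: lattice_polytope_def polytope_def)
  moreover have "grid P (\<lambda>x. x $ i)" for i
    unfolding grid_def affine_fun_def
  proof (intro conjI ballI exI allI)
    show "x $ i = axis i 1 \<bullet> x + 0" for x :: "real ^ 4" by (simp add: inner_axis inner_commute)
    fix v assume "v \<in> polytope_vertices P"
    then obtain n :: nat where n: "v $ i = real n" "n \<le> 3" using V by force
    then have "n = 0 \<or> n = 1 \<or> n = 2 \<or> n = 3" by linarith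
    then show "v $ i \<in> {0, 1, 2, 3}" using n by auto
  qed
  ultimately show ?thesis
    unfolding coords_def by (auto simp: vec_eq_iff forall_4)
qed

lemma graph_dist_le:
  assumes "near P (real k) u v"
  shows "graph_dist (polytope_adj P) u v \<le> enat k"
proof -
  obtain n where n: "n \<le> k" "(u, v) \<in> polytope_adj P ^^ n"
    using assms by (auto simp: near_def)
  then have "graph_dist (polytope_adj P) u v \<le> enat n"
    unfolding graph_dist_def by (intro INF_lower) simp
  then show ?thesis using n(1) by (meson enat_ord_simps(1) order_trans)
qed

lemma max_lattice_diameter_le: "max_lattice_diameter TYPE(4) 3 \<le> 8"
  unfolding max_lattice_diameter_def polytope_diameter_def
proof (intro SUP_least)
  fix P :: "(real ^ 4) set" and u v
  assume "P \<in> {P. lattice_polytope 3 P}" and uv: "u \<in> polytope_vertices P" "v \<in> polytope_vertices P"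
  then have "near P 8 u v" by (intro near_dim4[OF lattice_polytope_coords]) auto
  then show "graph_dist (polytope_adj P) u v \<le> 8"
    using graph_dist_le[of P 8 u v] by (simp add: numeral_eq_enat)
qed

section \<open>A zonotope with eight generators\<close>

definition zonotope :: "'a::euclidean_space set \<Rightarrow> 'a set" where
  "zonotope G = convex hull ((\<lambda>S. \<Sum>S) ` Pow G)"

lemma subset_sum_in_zonotope: "S \<subseteq> G \<Longrightarrow> \<Sum>S \<in> zonotope G"
  unfolding zonotope_def by (intro hull_inc) auto

lemma midpoint_in_zonotope:
  assumes "S \<subseteq> G" "T \<subseteq> G"
  shows "(1/2) *\<^sub>R \<Sum>S + (1/2) *\<^sub>R \<Sum>T \<in> zonotope G"
  by (rule convexD) (use assms subset_sum_in_zonotope in \<open>auto simp: zonotope_def\<close>)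

lemma zonotope_vertex_sum:
  assumes "v \<in> polytope_vertices (zonotope G)"
  shows "\<exists>S \<subseteq> G. v = \<Sum>S"
  using assms extreme_point_of_convex_hull[of v] unfolding polytope_vertices_def zonotope_def by blast

text \<open>For a generator \<open>g\<close> in \<open>S\<close> but not in \<open>T\<close>, the
  vertex would be the midpoint of itself minus \<open>g\<close> and itself plus
  \<open>g\<close>.\<close>

lemma zonotope_vertex_unique:
  assumes G: "finite G" "0 \<notin> G" and v: "\<Sum>S \<in> polytope_vertices (zonotope G)"
    and ST: "S \<subseteq> G" "T \<subseteq> G" "\<Sum>S = \<Sum>T"
  shows "S \<subseteq> T"
proof (rule ccontr)
  assume "\<not> ?thesis"
  then obtain g where g: "g \<in> S" "g \<notin> T" by blast
  have fin: "finite S" "finite T" using ST G finite_subset by auto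
  have 1: "\<Sum>(S - {g}) = \<Sum>S - g" using g fin by (simp add: sum_diff1)
  have 2: "\<Sum>(insert g T) = \<Sum>S + g" using g fin ST by simp
  have "\<Sum>(S - {g}) = \<Sum>(insert g T)"
  proof (rule vertex_not_between[OF v])
    show "\<Sum>(S - {g}) \<in> zonotope G" "\<Sum>(insert g T) \<in> zonotope G"
      using g ST by (auto intro!: subset_sum_in_zonotope)
    show "\<Sum>S = (1 - 1/2) *\<^sub>R \<Sum>(S - {g}) + (1/2) *\<^sub>R \<Sum>(insert g T)"
      unfolding 1 2 by (simp add: algebra_simps scaleR_2[symmetric])
  qed auto
  then have "g = - g" unfolding 1 2 by simp
  then have "2 *\<^sub>R g = 0" unfolding scaleR_2 by (metis add.right_inverse)
  then show False using g G ST by auto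
qed

text \<open>Moving the midpoint of an edge by half a generator keeps it in the zonotope, hence in the edge,
  so every generator on which the two endpoints differ is parallel to the edge.\<close>

lemma zonotope_edge_parallel:
  assumes G: "finite G" and e: "(\<Sum>S, \<Sum>T) \<in> polytope_adj (zonotope G)"
    and ST: "S \<subseteq> G" "T \<subseteq> G" and g: "g \<in> S" "g \<notin> T"
  shows "\<exists>r. g = r *\<^sub>R (\<Sum>T - \<Sum>S)"
proof (cases "g = 0")
  case True
  then show ?thesis by (intro exI[of _ 0]) simp
next
  case False
  have fin: "finite S" "finite T" using ST G finite_subset by auto
  let ?F = "closed_segment (\<Sum>S) (\<Sum>T)"
  define m where "m = (1/2) *\<^sub>R \<Sum>S + (1/2) *\<^sub>R \<Sum>T"
  have F: "?F face_of zonotope G" using e by (simp add: polytope_adj_def edge_of_def)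
  have 1: "\<Sum>(S - {g}) = \<Sum>S - g" using g fin by (simp add: sum_diff1)
  have 2: "\<Sum>(insert g T) = \<Sum>T + g" using g fin by simp
  have "(1/2) *\<^sub>R \<Sum>(S - {g}) + (1/2) *\<^sub>R \<Sum>T \<in> zonotope G" "(1/2) *\<^sub>R \<Sum>S + (1/2) *\<^sub>R \<Sum>(insert g T) \<in> zonotope G"
    using g ST by (auto intro!: midpoint_in_zonotope)
  then have Z: "m - (1/2) *\<^sub>R g \<in> zonotope G" "m + (1/2) *\<^sub>R g \<in> zonotope G"
    unfolding m_def 1 2 by (auto simp: algebra_simps)
  have "m \<in> open_segment (m - (1/2) *\<^sub>R g) (m + (1/2) *\<^sub>R g)"
    unfolding in_segment using False
    by (intro conjI exI[of _ "1/2"]) (auto simp: algebra_simps scaleR_2[symmetric])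
  moreover have "m \<in> ?F" unfolding in_segment m_def by (intro exI[of _ "1/2"]) auto
  ultimately have "m - (1/2) *\<^sub>R g \<in> ?F" "m + (1/2) *\<^sub>R g \<in> ?F"
    using face_ofD[OF F _ Z] by auto
  then obtain s t where s: "m - (1/2) *\<^sub>R g = (1 - s) *\<^sub>R \<Sum>S + s *\<^sub>R \<Sum>T"
    and t: "m + (1/2) *\<^sub>R g = (1 - t) *\<^sub>R \<Sum>S + t *\<^sub>R \<Sum>T"
    by (auto simp: in_segment)
  have "g = (m + (1/2) *\<^sub>R g) - (m - (1/2) *\<^sub>R g)" by (simp add: scaleR_2[symmetric])
  also have "\<dots> = (t - s) *\<^sub>R (\<Sum>T - \<Sum>S)" unfolding s t by (simp add: algebra_simps)
  finally show ?thesis by blast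
qed

definition zero_one_vectors :: "(real ^ 'n) set \<Rightarrow> bool" where
  "zero_one_vectors G \<longleftrightarrow> finite G \<and> 0 \<notin> G \<and> (\<forall>g\<in>G. \<forall>i. g $ i = 0 \<or> g $ i = 1)"

text \<open>The ratio of two parallel nonzero 0/1 vectors is read off at an entry 1 of the first and
  must itself be 1.\<close>

lemma zero_one_parallel:
  assumes "zero_one_vectors G" "g \<in> G" "h \<in> G" "g = r *\<^sub>R x" "h = s *\<^sub>R x"
  shows "g = h"
proof -
  have "g \<noteq> 0" "h \<noteq> 0" using assms by (auto simp: zero_one_vectors_def)
  then have rs: "r \<noteq> 0" "s \<noteq> 0" using assms by auto
  then have hg: "h = (s / r) *\<^sub>R g" using assms by simp
  obtain i where "g $ i \<noteq> 0" using \<open>g \<noteq> 0\<close> by (auto simp: vec_eq_iff)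
  then have "g $ i = 1" using assms(1,2) unfolding zero_one_vectors_def by blast
  then have "h $ i = s / r" by (simp add: hg)
  moreover have "h $ i = 0 \<or> h $ i = 1" using assms(1,3) by (simp add: zero_one_vectors_def)
  ultimately have "s / r = 1" using rs by auto
  then show ?thesis using hg by simp
qed

lemma zonotope_edge_card:
  assumes G: "zero_one_vectors G" and e: "(\<Sum>S, \<Sum>T) \<in> polytope_adj (zonotope G)"
    and ST: "S \<subseteq> G" "T \<subseteq> G"
  shows "card T \<le> card S + 1"
proof -
  have fin: "finite S" "finite T" "finite G" using ST G finite_subset by (auto simp: zero_one_vectors_def)
  have "\<exists>r. g = r *\<^sub>R (\<Sum>S - \<Sum>T)" if "g \<in> T - S" for g
    using zonotope_edge_parallel[OF fin(3) polytope_adj_sym[OF e] ST(2,1)] that by blast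
  note par = this
  have "g = h" if gh: "g \<in> T - S" "h \<in> T - S" for g h
  proof -
    obtain r s where "g = r *\<^sub>R (\<Sum>S - \<Sum>T)" "h = s *\<^sub>R (\<Sum>S - \<Sum>T)"
      using par[OF gh(1)] par[OF gh(2)] by blast
    moreover have "g \<in> G" "h \<in> G" using gh ST by auto
    ultimately show ?thesis using zero_one_parallel[OF G] by blast
  qed
  then have "card (T - S) \<le> Suc 0"
    using card_le_Suc0_iff_eq[of "T - S"] fin by blast
  moreover have "card T \<le> card (S \<union> (T - S))"
    by (rule card_mono) (use fin in auto)
  moreover have "card (S \<union> (T - S)) \<le> card S + card (T - S)" by (rule card_Un_le)
  ultimately show ?thesis by linarith
qed

lemma zonotope_path_card:
  assumes G: "zero_one_vectors G"
  shows "(0, \<Sum>T) \<in> polytope_adj (zonotope G) ^^ n \<Longrightarrow> T \<subseteq> G \<Longrightarrow>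
    0 \<in> polytope_vertices (zonotope G) \<Longrightarrow> card T \<le> n"
proof (induction n arbitrary: T)
  case 0
  have fin: "finite G" "0 \<notin> G" using G by (auto simp: zero_one_vectors_def)
  \<comment> \<open>The vertex 0 has only the empty representation, so a path of length zero has
    collected no generator.\<close>
  have T: "\<Sum>T = \<Sum>{}" using 0(1) by simp
  then have "\<Sum>T \<in> polytope_vertices (zonotope G)" using 0(3) by simp
  then have "T \<subseteq> {}" by (rule zonotope_vertex_unique[OF fin _ 0(2) empty_subsetI T])
  then show ?case by simp
next
  case (Suc n)
  then obtain w where w: "(0, w) \<in> polytope_adj (zonotope G) ^^ n" "(w, \<Sum>T) \<in> polytope_adj (zonotope G)" by auto
  obtain S where S: "S \<subseteq> G" "w = \<Sum>S" using zonotope_vertex_sum[OF adj_vertices(1)[OF w(2)]] by blast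
  have "card S \<le> n" using Suc.IH[of S] w(1) S Suc.prems(3) by simp
  then show ?case using zonotope_edge_card[OF G, of S T] w(2) S Suc.prems(2) by simp
qed

lemma subset_sum_bounds:
  assumes G: "zero_one_vectors G" and S: "S \<subseteq> G"
  shows "0 \<le> (\<Sum>S) $ i" "(\<Sum>S) $ i \<le> (\<Sum>G) $ i" "(\<Sum>S) $ i \<in> \<int>"
proof -
  have fin: "finite S" "finite G" using S G finite_subset by (auto simp: zero_one_vectors_def)
  have g: "g $ i = 0 \<or> g $ i = 1" if "g \<in> G" for g using G that by (auto simp: zero_one_vectors_def)
  show "0 \<le> (\<Sum>S) $ i" unfolding sum_component by (rule sum_nonneg) (use g S in force)
  show "(\<Sum>S) $ i \<le> (\<Sum>G) $ i" unfolding sum_component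
    by (rule sum_mono2) (use fin S g in force)+
  show "(\<Sum>S) $ i \<in> \<int>" unfolding sum_component by (rule Ints_sum) (use g S in force)
qed

lemma zonotope_bounds:
  assumes G: "zero_one_vectors G" and x: "x \<in> zonotope G"
  shows "0 \<le> x $ i" "x $ i \<le> (\<Sum>G) $ i"
proof -
  have "convex hull ((\<lambda>S. \<Sum>S) ` Pow G) \<subseteq> {x. 0 \<le> x $ i} \<inter> {x. x $ i \<le> (\<Sum>G) $ i}"
  proof (rule hull_minimal)
    show "(\<lambda>S. \<Sum>S) ` Pow G \<subseteq> {x. 0 \<le> x $ i} \<inter> {x. x $ i \<le> (\<Sum>G) $ i}"
      using subset_sum_bounds[OF G] by auto
    show "convex ({x. 0 \<le> x $ i} \<inter> {x. x $ i \<le> (\<Sum>G) $ i})"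
      using convex_halfspace_ge[of 0 "axis i (1::real)"] convex_halfspace_le[of "axis i (1::real)" "(\<Sum>G) $ i"]
      by (intro convex_Int) (simp_all add: inner_axis')
  qed
  then show "0 \<le> x $ i" "x $ i \<le> (\<Sum>G) $ i" using x by (auto simp: zonotope_def)
qed

text \<open>The factor \<open>k\<close> treats both corners at once: 1 for the lowest point, -1 for
  the highest.\<close>

lemma box_corner_vertex:
  fixes Z :: "(real ^ 'n) set"
  assumes "l \<in> Z" "\<And>x i. x \<in> Z \<Longrightarrow> k * (l $ i) \<le> k * (x $ i)" "k \<noteq> 0"
  shows "l \<in> polytope_vertices Z"
  unfolding polytope_vertices_def extreme_point_of_def
proof (intro CollectI conjI ballI notI assms(1))
  fix p q assume pq: "p \<in> Z" "q \<in> Z" "l \<in> open_segment p q"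
  then obtain t where t: "0 < t" "t < 1" "l = (1 - t) *\<^sub>R p + t *\<^sub>R q" "p \<noteq> q" by (auto simp: in_segment)
  have "p $ i = q $ i" for i
  proof -
    have "l $ i = (1 - t) * p $ i + t * q $ i" unfolding t(3) by simp
    then have "k * (l $ i) = k * ((1 - t) * p $ i + t * q $ i)" by (rule arg_cong)
    also have "\<dots> = (1 - t) * (k * (p $ i)) + t * (k * (q $ i))" by (simp add: algebra_simps)
    finally have "k * (l $ i) = (1 - t) * (k * (p $ i)) + t * (k * (q $ i))" .
    moreover have "(1 - t) * (k * (l $ i)) \<le> (1 - t) * (k * (p $ i))" "t * (k * (l $ i)) \<le> t * (k * (q $ i))"
      using assms(2) pq t by (auto intro: mult_left_mono)
    ultimately have "(1 - t) * (k * (l $ i)) = (1 - t) * (k * (p $ i))" "t * (k * (l $ i)) = t * (k * (q $ i))"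
      by (auto simp: algebra_simps)
    then show ?thesis using t assms(3) by auto
  qed
  then show False using t(4) by (simp add: vec_eq_iff)
qed

lemma zonotope_graph_dist:
  assumes G: "zero_one_vectors G"
  shows "0 \<in> polytope_vertices (zonotope G)" "\<Sum>G \<in> polytope_vertices (zonotope G)"
    "enat (card G) \<le> graph_dist (polytope_adj (zonotope G)) 0 (\<Sum>G)"
proof -
  show 0: "0 \<in> polytope_vertices (zonotope G)"
  proof (rule box_corner_vertex[of 0 "zonotope G" 1])
    show "0 \<in> zonotope G" using subset_sum_in_zonotope[of "{}" G] by simp
    show "1 * 0 $ i \<le> 1 * x $ i" if "x \<in> zonotope G" for x i
      using zonotope_bounds(1)[OF G that] by simp
  qed simp
  show "\<Sum>G \<in> polytope_vertices (zonotope G)"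
  proof (rule box_corner_vertex[of "\<Sum>G" "zonotope G" "-1"])
    show "\<Sum>G \<in> zonotope G" by (rule subset_sum_in_zonotope) simp
    show "- 1 * (\<Sum>G) $ i \<le> - 1 * x $ i" if "x \<in> zonotope G" for x i
      using zonotope_bounds(2)[OF G that, of i] by linarith
  qed simp
  show "enat (card G) \<le> graph_dist (polytope_adj (zonotope G)) 0 (\<Sum>G)"
    unfolding graph_dist_def
  proof (rule INF_greatest)
    fix n assume "n \<in> {n. (0, \<Sum>G) \<in> polytope_adj (zonotope G) ^^ n}"
    then show "enat (card G) \<le> enat n" using zonotope_path_card[OF G _ subset_refl 0, of n] by simp
  qed
qed

lemma lattice_polytope_zonotope:
  assumes G: "zero_one_vectors G" and k: "\<And>i. (\<Sum>G) $ i \<le> real k"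
  shows "lattice_polytope k (zonotope G)"
  unfolding lattice_polytope_def
proof (intro conjI exI ballI allI)
  have "finite G" using G by (simp add: zero_one_vectors_def)
  then show "finite ((\<lambda>S. \<Sum>S) ` Pow G)" by simp
  show "(\<lambda>S. \<Sum>S) ` Pow G \<noteq> {}" by auto
  show "zonotope G = convex hull ((\<lambda>S. \<Sum>S) ` Pow G)" by (simp add: zonotope_def)
  show "lattice_point x" if "x \<in> (\<lambda>S. \<Sum>S) ` Pow G" for x
    using that subset_sum_bounds(3)[OF G] by (auto simp: lattice_point_def)
  fix v i assume "v \<in> polytope_vertices (zonotope G)"
  then obtain S where S: "S \<subseteq> G" "v = \<Sum>S" using zonotope_vertex_sum by blast
  have v: "0 \<le> v $ i" "v $ i \<le> real k" "v $ i \<in> \<int>"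
    using subset_sum_bounds[OF G S(1), of i] k[of i] S(2) by auto
  obtain n :: int where n: "v $ i = of_int n" using v(3) by (rule Ints_cases)
  then have "0 \<le> n" "n \<le> int k" using v(1,2) by linarith+
  then show "v $ i \<in> real ` {0..k}" using n by (intro image_eqI[of _ _ "nat n"]) auto
qed

section \<open>The eight generators in dimension four\<close>

definition indicator_vec :: "'n set \<Rightarrow> real ^ 'n" where
  "indicator_vec A = (\<chi> i. if i \<in> A then 1 else 0)"

text \<open>Vertices and edges of a 4-cycle: each index lies in one singleton and two edges, so
  every coordinate of the sum is 3.\<close>

definition cycle_sets :: "4 set set" where
  "cycle_sets = {{1}, {2}, {3}, {4}, {1, 2}, {2, 3}, {3, 4}, {4, 1}}"

lemma indicator_vec_inj: "inj indicator_vec"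
  by (rule injI) (auto simp: indicator_vec_def vec_eq_iff split: if_splits)

lemma cycle_sets_card: "card cycle_sets = 8"
proof -
  have "(1::4) \<noteq> 2" "(1::4) \<noteq> 3" "(1::4) \<noteq> 4" "(2::4) \<noteq> 3" "(2::4) \<noteq> 4" "(3::4) \<noteq> 4" by simp_all
  then show ?thesis unfolding cycle_sets_def by (simp add: doubleton_eq_iff)
qed

lemma cycle_sets_sum: "(\<Sum>(indicator_vec ` cycle_sets)) $ i = 3"
proof -
  have ne: "(1::4) \<noteq> 2" "(1::4) \<noteq> 3" "(1::4) \<noteq> 4" "(2::4) \<noteq> 3" "(2::4) \<noteq> 4" "(3::4) \<noteq> 4" by simp_all
  have "(\<Sum>(indicator_vec ` cycle_sets)) $ i = (\<Sum>A\<in>cycle_sets. indicator_vec A $ i)"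
    by (subst sum.reindex) (auto simp: sum_component intro: inj_on_subset[OF indicator_vec_inj])
  also have "\<dots> = 3"
    using ne exhaust_4[of i] unfolding cycle_sets_def indicator_vec_def by (auto simp: doubleton_eq_iff)
  finally show ?thesis .
qed

lemma max_lattice_diameter_ge: "8 \<le> max_lattice_diameter TYPE(4) 3"
proof -
  define G where "G = indicator_vec ` cycle_sets"
  have G: "zero_one_vectors G"
    unfolding zero_one_vectors_def G_def cycle_sets_def by (auto simp: indicator_vec_def vec_eq_iff)
  have "card G = 8"
    unfolding G_def
    by (simp add: card_image[OF inj_on_subset[OF indicator_vec_inj subset_UNIV]] cycle_sets_card)
  have le: "(\<Sum>G) $ i \<le> real 3" for i
    using cycle_sets_sum[of i] unfolding G_def by simp
  from \<open>card G = 8\<close> have "8 \<le> graph_dist (polytope_adj (zonotope G)) 0 (\<Sum>G)"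
    using zonotope_graph_dist(3)[OF G] by (simp add: numeral_eq_enat)
  also have "\<dots> \<le> polytope_diameter (zonotope G)"
    unfolding polytope_diameter_def
    by (rule SUP_upper2[OF zonotope_graph_dist(1)[OF G]], rule SUP_upper, rule zonotope_graph_dist(2)[OF G])
  also have "\<dots> \<le> max_lattice_diameter TYPE(4) 3"
    unfolding max_lattice_diameter_def
    by (intro SUP_upper CollectI lattice_polytope_zonotope[OF G] le)
  finally show ?thesis .
qed

theorem corollary1p5:
  shows "max_lattice_diameter TYPE(4) 3 = 8"
  using max_lattice_diameter_le max_lattice_diameter_ge by (rule antisym)

end
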